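(* Let $(Q,Q')$ be a completely extended linear quiver with $n=|Q_0|>1$ and $n'=|Q'_0|=2n+3$. Define $\mathbf{a}_Q\in\{0,1\}^{n'}$ by $a_v=1$ if $v\in Q_0$ and $a_v=0$ otherwise. For $i\in[1,n-1]$, let $\mathcal{D}^{(i)}$ be a Dyck path with one horizontal edge $u^{(i)}$ and one vertical edge $v^{(i)}$, and let $S_{i,1}\subseteq\{u^{(i)}\}$ and $S_{i,2}\subseteq\{v^{(i)}\}$. The collection $\{S_{i,r}\}$ is a GCC if $(|S_{i,1}|,|S_{i,2}|)\neq(1,1)$ for all $i\in[1,n-1]$, and for all $i\in[2,n-1]$: - (a) if $(\delta_{i-1},\delta_i)=(0,0)$ then $|S_{i-1,2}|\neq|S_{i,1}|$; - (b) if $(1,1)$ then $|S_{i-1,1}|\neq|S_{i,2}|$; - (c) if $(0,1)$ then $|S_{i-1,2}|=|S_{i,2}|$; - (d) if $(1,0)$ then $|S_{i-1,1}|=|S_{i,1}|$. For a GCC, define the following: - For $i\in[1,n-1]$, $y_i=x_{i+\delta_i}^{|S_{i,2}|}x_{i+1-\delta_i}^{|S_{i,1}|}x_{i,i+1}^{1-|S_{i,1}|-|S_{i,2}|}$. - $y_0=x_{1,0}$ if $|S_{1,1+\delta_1}|=1-\delta_1$, and $y_0=x_{1,1}$ otherwise. - $y_n=x_{n,0}$ if $|S_{n-1,2-\delta_{n-1}}|=\delta_{n-1}$, and $y_n=x_{n,1}$ otherwise. Then the cluster variable of $\mathcal{A}(Q')$ with $\mathbf{d}$-vector $\mathbf{a}_Q$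 is $$x[\mathbf{a}_Q]=\Big(\prod_{i=1}^n x_i^{-1}\Big)\sum\prod_{i=0}^n y_i,$$ the sum running over all GCCs $\{S_{i,r}\}$.
   Context: A linear quiver $Q$ has vertices $v_1,\dots,v_n$ (identified with $1,\dots,n$). For each $i\in[1,n-1]$ it has exactly one arrow between $v_i$ and $v_{i+1}$ (in either direction), and no other arrows. Set $\delta_i=0$ if the arrow is $v_i\to v_{i+1}$ and $\delta_i=1$ otherwise. The completely extended linear quiver $Q'$ is obtained from $Q$ as follows: - for each $i\in[1,n-1]$, add a vertex $v_{i,i+1}$ and two arrows making $v_i,v_{i+1},v_{i,i+1}$ an oriented $3$-cycle; - add vertices $v_{1,0},v_{1,1}$ with arrows $v_1\to v_{1,0}\to v_{1,1}\to v_1$; - add vertices $v_{n,0},v_{n,1}$ with arrows $v_n\to v_{n,0}\to v_{n,1}\to v_n$. The initial cluster variables of $\mathcal{A}(Q')$ are denoted $x_i$ ($i\in[1,n]$), $x_{i,i+1}$, $x_{1,0},x_{1,1},x_{n,0},x_{n,1}$ according to their vertices. $\mathcal{A}(Q')$ is the coefficient-free cluster algebra of $Q'$, with all vertices mutable. Its cluster variables are obtained from $((x_v)_{v\in Q'_0},Q')$ by iterated quiver mutations and exchange relations $u_k'=(\prod_{j\to k}u_j+\prod_{k\to j}u_j)/u_k$. $Q'$ is a type $A$ quiver, i.e. mutation-equivalent to an equioriented path. It arises from a triangulation of a convex $(n'+3)$-gon by non-crossing diagonals $T_v$ ($v\in Q'_0$): there is an arrow $v\to w$ iff $T_v,T_w$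 are sides of a common triangle and $T_w$ is obtained from $T_v$ by counterclockwise rotation (less than $180^\circ$) about their common endpoint. Cluster variables correspond to diagonals, with $x_v\leftrightarrow T_v$. The $\mathbf{d}$-vector of the cluster variable of a diagonal $D$ has $v$-coordinate $1$ if $D$ crosses $T_v$ in the interior, $-1$ if $D=T_v$, and $0$ otherwise. *)

theory Defs
  imports
    "HOL-Library.Poly_Mapping"
    "HOL-Library.Countable"
    "HOL-Library.FuncSet"
    "HOL-Computational_Algebra.Fraction_Field"
begin

section \<open>Quivers and coefficient-free cluster algebras\<close>

text \<open>A quiver on vertices of type \<^typ>\<open>'v\<close> is given by its arrow multiplicities:
  \<open>B v w\<close> is the number of arrows \<open>v \<rightarrow> w\<close>.\<close>

type_synonym 'v quiver = "'v \<Rightarrow> 'v \<Rightarrow> nat"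

text \<open>For each path \<open>v \<rightarrow> k \<rightarrow> w\<close> an arrow \<open>v \<rightarrow> w\<close> is added, the arrows at \<open>k\<close> are reversed, and
  a maximal set of 2-cycles is deleted; the deletion is the truncated subtraction.\<close>

definition mutate_quiver :: "'v \<Rightarrow> 'v quiver \<Rightarrow> 'v quiver" where
  "mutate_quiver k B = (\<lambda>v w.
     if v = k \<or> w = k then B w v
     else (B v w + B v k * B k w) - (B w v + B w k * B k v))"

definition mutate_cluster :: "'v set \<Rightarrow> 'v \<Rightarrow> 'v quiver \<Rightarrow> ('v \<Rightarrow> 'f::field) \<Rightarrow> ('v \<Rightarrow> 'f)" where
  "mutate_cluster N k B u =
     u(k := ((\<Prod>j\<in>N. u j ^ B j k) + (\<Prod>j\<in>N. u j ^ B k j)) / u k)"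

text \<open>The ambient field is the field of rational functions over the rationals in variables
  indexed by \<^typ>\<open>'v\<close>. The order on \<^typ>\<open>'v\<close> only serves to make the polynomial ring an
  instance of the class of integral domains.\<close>

type_synonym 'v polyn = "('v \<Rightarrow>\<^sub>0 nat) \<Rightarrow>\<^sub>0 rat"
type_synonym 'v ratfun = "'v polyn fract"

definition pvar :: "'v::linorder \<Rightarrow> 'v polyn" where
  "pvar v = Poly_Mapping.single (Poly_Mapping.single v 1) 1"

definition var :: "'v::linorder \<Rightarrow> 'v ratfun" where
  "var v = Fract (pvar v) 1"

inductive seed :: "'v::linorder set \<Rightarrow> 'v quiver \<Rightarrow> ('v \<Rightarrow> 'v ratfun) \<Rightarrow> 'v quiver \<Rightarrow> bool"
  for N :: "'v::linorder set" and B0 :: "'v quiver"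
where
  initial: "seed N B0 var B0"
| mutation: "seed N B0 u B \<Longrightarrow> k \<in> N \<Longrightarrow> seed N B0 (mutate_cluster N k B u) (mutate_quiver k B)"

definition cluster_variables :: "'v::linorder set \<Rightarrow> 'v quiver \<Rightarrow> 'v ratfun set" where
  "cluster_variables N B0 = {u v | u B v. seed N B0 u B \<and> v \<in> N}"

text \<open>The \<open>d\<close>-vector is the denominator vector: \<open>z = P / (\<Prod>v\<in>N. x\<^sub>v ^ d\<^sub>v)\<close> in lowest terms, that
  is, with a polynomial \<open>P\<close> not divisible by any initial cluster variable.\<close>

definition has_dvector :: "'v::linorder set \<Rightarrow> 'v ratfun \<Rightarrow> ('v \<Rightarrow> int) \<Rightarrow> bool" where
  "has_dvector N z d \<longleftrightarrow>
     (\<exists>P. (\<forall>v\<in>N. \<not> pvar v dvd P) \<and> z = Fract P 1 / (\<Prod>v\<in>N. var v powi d v))"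


section \<open>Completely extended linear quivers\<close>

definition linear_quiver :: "nat \<Rightarrow> nat quiver \<Rightarrow> bool" where
  "linear_quiver n Q \<longleftrightarrow>
     (\<forall>i\<in>{1..<n}. Q i (i + 1) + Q (i + 1) i = 1) \<and>
     (\<forall>i j. Q i j \<noteq> 0 \<longrightarrow> i \<in> {1..n} \<and> j \<in> {1..n} \<and> (j = i + 1 \<or> i = j + 1))"

definition delta :: "nat quiver \<Rightarrow> nat \<Rightarrow> nat" where
  "delta Q i = (if Q i (i + 1) = 1 then 0 else 1)"

text \<open>\<open>V i\<close> is the vertex \<open>v\<^sub>i\<close> of \<open>Q\<close>; \<open>VV i j\<close> is the added vertex \<open>v\<^sub>i\<^sub>,\<^sub>j\<close>.\<close>

datatype vertex = V nat | VV nat nat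

instance vertex :: countable
  by countable_datatype

instantiation vertex :: linorder
begin

definition less_eq_vertex :: "vertex \<Rightarrow> vertex \<Rightarrow> bool" where
  "less_eq_vertex v w \<longleftrightarrow> to_nat v \<le> to_nat w"

definition less_vertex :: "vertex \<Rightarrow> vertex \<Rightarrow> bool" where
  "less_vertex v w \<longleftrightarrow> to_nat v < to_nat w"

instance
  by standard (auto simp: less_eq_vertex_def less_vertex_def)

end

definition old_verts :: "nat \<Rightarrow> vertex set" where
  "old_verts n = V ` {1..n}"

definition ext_verts :: "nat \<Rightarrow> vertex set" where
  "ext_verts n = old_verts n \<union> (\<lambda>i. VV i (i + 1)) ` {1..<n} \<union> {VV 1 0, VV 1 1, VV n 0, VV n 1}"

lemma card_ext_verts:
  assumes "n > 1"
  shows "card (ext_verts n) = 2 * n + 3"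
proof -
  have "card (old_verts n) = n"
    by (simp add: old_verts_def card_image inj_on_def)
  moreover have "card ((\<lambda>i. VV i (i + 1)) ` {1..<n}) = n - 1"
    by (simp add: card_image inj_on_def)
  moreover have "card {VV 1 0, VV 1 1, VV n 0, VV n 1} = 4"
    using assms by simp
  moreover have "old_verts n \<inter> (\<lambda>i. VV i (i + 1)) ` {1..<n} = {}"
    by (auto simp: old_verts_def)
  moreover have "(old_verts n \<union> (\<lambda>i. VV i (i + 1)) ` {1..<n}) \<inter> {VV 1 0, VV 1 1, VV n 0, VV n 1} = {}"
    by (auto simp: old_verts_def)
  moreover have "finite (old_verts n)"
    by (simp add: old_verts_def)
  ultimately show ?thesis
    using assms unfolding ext_verts_def by (subst card_Un_disjoint; simp add: card_Un_disjoint)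
qed

inductive ext_arrow :: "nat \<Rightarrow> nat quiver \<Rightarrow> vertex \<Rightarrow> vertex \<Rightarrow> bool"
  for n :: nat and Q :: "nat quiver"
where
  "Q i j = 1 \<Longrightarrow> ext_arrow n Q (V i) (V j)"
| "i \<in> {1..<n} \<Longrightarrow> Q i (i + 1) = 1 \<Longrightarrow> ext_arrow n Q (V (i + 1)) (VV i (i + 1))"
| "i \<in> {1..<n} \<Longrightarrow> Q i (i + 1) = 1 \<Longrightarrow> ext_arrow n Q (VV i (i + 1)) (V i)"
| "i \<in> {1..<n} \<Longrightarrow> Q (i + 1) i = 1 \<Longrightarrow> ext_arrow n Q (V i) (VV i (i + 1))"
| "i \<in> {1..<n} \<Longrightarrow> Q (i + 1) i = 1 \<Longrightarrow> ext_arrow n Q (VV i (i + 1)) (V (i + 1))"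
| "k \<in> {1, n} \<Longrightarrow> ext_arrow n Q (V k) (VV k 0)"
| "k \<in> {1, n} \<Longrightarrow> ext_arrow n Q (VV k 0) (VV k 1)"
| "k \<in> {1, n} \<Longrightarrow> ext_arrow n Q (VV k 1) (V k)"

definition ext_quiver :: "nat \<Rightarrow> nat quiver \<Rightarrow> vertex quiver" where
  "ext_quiver n Q v w = (if ext_arrow n Q v w then 1 else 0)"

definition a_vec :: "nat \<Rightarrow> vertex \<Rightarrow> int" where
  "a_vec n v = (if v \<in> old_verts n then 1 else 0)"


section \<open>Globally compatible collections\<close>

text \<open>\<open>Hor i\<close> and \<open>Ver i\<close> are the edges \<open>u\<^sup>(\<^sup>i\<^sup>)\<close> and \<open>v\<^sup>(\<^sup>i\<^sup>)\<close> of the Dyck path \<open>D\<^sup>(\<^sup>i\<^sup>)\<close>.\<close>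

datatype dyck_edge = Hor nat | Ver nat

text \<open>Collections are taken extensional, so that each is counted exactly once.\<close>

definition edge_collections :: "nat \<Rightarrow> (nat \<times> nat \<Rightarrow> dyck_edge set) set" where
  "edge_collections n =
     (\<Pi>\<^sub>E (i, r) \<in> {1..n - 1} \<times> {1, 2}. if r = 1 then Pow {Hor i} else Pow {Ver i})"

definition is_GCC :: "nat \<Rightarrow> nat quiver \<Rightarrow> (nat \<times> nat \<Rightarrow> dyck_edge set) \<Rightarrow> bool" where
  "is_GCC n Q S \<longleftrightarrow>
     S \<in> edge_collections n \<and>
     (\<forall>i\<in>{1..n - 1}. (card (S (i, 1)), card (S (i, 2))) \<noteq> (1, 1)) \<and>
     (\<forall>i\<in>{2..n - 1}.
        ((delta Q (i - 1), delta Q i) = (0, 0) \<longrightarrow> card (S (i - 1, 2)) \<noteq> card (S (i, 1))) \<and>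
        ((delta Q (i - 1), delta Q i) = (1, 1) \<longrightarrow> card (S (i - 1, 1)) \<noteq> card (S (i, 2))) \<and>
        ((delta Q (i - 1), delta Q i) = (0, 1) \<longrightarrow> card (S (i - 1, 2)) = card (S (i, 2))) \<and>
        ((delta Q (i - 1), delta Q i) = (1, 0) \<longrightarrow> card (S (i - 1, 1)) = card (S (i, 1))))"

definition y_factor ::
  "nat \<Rightarrow> nat quiver \<Rightarrow> (nat \<times> nat \<Rightarrow> dyck_edge set) \<Rightarrow> nat \<Rightarrow> vertex ratfun" where
  "y_factor n Q S i =
     (if i = 0 then
        (if card (S (1, 1 + delta Q 1)) = 1 - delta Q 1 then var (VV 1 0) else var (VV 1 1))
      else if i = n then
        (if card (S (n - 1, 2 - delta Q (n - 1))) = delta Q (n - 1)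
         then var (VV n 0) else var (VV n 1))
      else
        var (V (i + delta Q i)) ^ card (S (i, 2)) *
        var (V (i + 1 - delta Q i)) ^ card (S (i, 1)) *
        var (VV i (i + 1)) powi (1 - int (card (S (i, 1))) - int (card (S (i, 2)))))"

end

theory Submission
  imports Defs
begin

text \<open>
  The cluster algebra is realised inside a polygon whose vertices carry vectors of the plane over the
  ambient field: the variable of a chord is the determinant of its two end vectors, so that the
  exchange relations become Pluecker relations and every seed is a labelled triangulation.
  In the triangulation of \<open>Q'\<close> the diagonals of \<open>Q\<close> form a snake from one vertex to another, and
  the remaining diagonals cut off ears. The chord joining the two ends of the snake is reached by
  flipping the diagonals \<open>v\<^sub>1, \<dots>, v\<^sub>n\<close> in this order. It is the only chord with the required
  denominator: a chord that misses \<open>v\<^sub>1\<close> or \<open>v\<^sub>n\<close> has no pole along it, and a chord that starts in an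
  ear has a pole along the side below that ear. Its variable satisfies a two-term linear recursion
  along the snake, and a globally compatible collection is the same thing as a path in the
  corresponding transfer matrices.
\<close>

section \<open>Laurent polynomials with nonnegative coefficients\<close>

text \<open>A d-vector is a denominator in lowest terms, so both establishing and excluding it
  require control of divisibility, which sums do not respect. The remedy is to stay
  subtraction-free: with nonnegative coefficients a term free of \<open>x_g\<close> never cancels,
  so being nonzero at \<open>x_g = 0\<close> is stable under sums and products. Chord values are
  therefore obtained from the labels by Ptolemy relations, and the bookkeeping records only which
  labels are inverted on the way; a label never inverted gives no pole. The vector model is used
  because determinants satisfy all Ptolemy relations at once, so the value of a chord does not
  depend on a sequence of flips. It does not show that these values are nonzero, as needed for
  division in exchanges; positivity along a variable outside the cluster supplies this. The polygon
  sides have value 1 because the cluster algebra has no coefficients. The 3-cycles at the ends of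
  \<open>Q\<close> become the ordinary steps \<open>0\<close> and \<open>n\<close> of the snake, so
  the polygon has \<open>2 * n + 6\<close> vertices: \<open>n + 3\<close> on the snake and as many
  ear tips.\<close>

definition nonneg_poly :: "'v::linorder polyn \<Rightarrow> bool" where
  "nonneg_poly F \<longleftrightarrow> (\<forall>m. Poly_Mapping.lookup F m \<ge> 0)"

text \<open>The second clause says that the polynomial stays nonzero when the variable
  \<open>g\<close> is set to 0. Together with nonnegative coefficients it survives addition, which
  indivisibility by \<open>pvar g\<close> alone does not.\<close>

definition pos_poly :: "'v::linorder \<Rightarrow> 'v polyn \<Rightarrow> bool" where
  "pos_poly g F \<longleftrightarrow> nonneg_poly F \<and> (\<exists>m. Poly_Mapping.lookup m g = 0 \<and> Poly_Mapping.lookup F m > 0)"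

abbreviation monomial :: "('v::linorder \<Rightarrow>\<^sub>0 nat) \<Rightarrow> 'v polyn" where
  "monomial m \<equiv> Poly_Mapping.single m 1"

lemma nonneg_poly_add: "nonneg_poly F \<Longrightarrow> nonneg_poly G \<Longrightarrow> nonneg_poly (F + G)"
  by (simp add: nonneg_poly_def lookup_add)

lemma nonneg_poly_mult: "nonneg_poly F \<Longrightarrow> nonneg_poly G \<Longrightarrow> nonneg_poly (F * G)"
  unfolding nonneg_poly_def lookup_mult Sum_any.expand_set when_def
  by (intro allI sum_nonneg mult_nonneg_nonneg) auto

lemma nonneg_poly_single: "c \<ge> 0 \<Longrightarrow> nonneg_poly (Poly_Mapping.single m c)"
  by (simp add: nonneg_poly_def lookup_single when_def)

lemma pos_poly_imp_nonneg: "pos_poly g F \<Longrightarrow> nonneg_poly F"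
  by (simp add: pos_poly_def)

lemma pos_poly_add: "pos_poly g F \<Longrightarrow> nonneg_poly G \<Longrightarrow> pos_poly g (F + G)"
  unfolding pos_poly_def nonneg_poly_def lookup_add
  by (metis add_nonneg_nonneg add_pos_nonneg)

lemma pos_poly_split:
  assumes "pos_poly g F"
  obtains m c G where "F = Poly_Mapping.single m c + G" "c > 0" "Poly_Mapping.lookup m g = 0" "nonneg_poly G"
proof -
  obtain m where m: "Poly_Mapping.lookup m g = 0" "Poly_Mapping.lookup F m > 0" and F: "nonneg_poly F"
    using assms by (auto simp: pos_poly_def)
  have "nonneg_poly (F - Poly_Mapping.single m (Poly_Mapping.lookup F m))"
    using F by (auto simp: nonneg_poly_def lookup_minus lookup_single when_def)
  then show thesis using that[of m "Poly_Mapping.lookup F m" "F - Poly_Mapping.single m (Poly_Mapping.lookup F m)"] m by simp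
qed

lemma pos_poly_single: "c > 0 \<Longrightarrow> Poly_Mapping.lookup m g = 0 \<Longrightarrow> pos_poly g (Poly_Mapping.single m c)"
  unfolding pos_poly_def by (auto simp: nonneg_poly_single intro: exI[of _ m])

text \<open>The product of the two chosen \<open>g\<close>-free terms is again
  \<open>g\<close>-free, and the remaining terms are nonnegative, so nothing cancels it.\<close>

lemma pos_poly_mult:
  assumes "pos_poly g F" "pos_poly g G"
  shows "pos_poly g (F * G)"
proof -
  obtain m c F' where F: "F = Poly_Mapping.single m c + F'" "c > 0" "Poly_Mapping.lookup m g = 0" "nonneg_poly F'"
    using assms(1) by (rule pos_poly_split)
  obtain k d G' where G: "G = Poly_Mapping.single k d + G'" "d > 0" "Poly_Mapping.lookup k g = 0" "nonneg_poly G'"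
    using assms(2) by (rule pos_poly_split)
  have "F * G = Poly_Mapping.single (m + k) (c * d) + (Poly_Mapping.single m c * G' + F' * G)"
    by (simp add: F G algebra_simps mult_single)
  moreover have "pos_poly g (Poly_Mapping.single (m + k) (c * d))"
    using F G by (intro pos_poly_single) (auto simp: lookup_add)
  moreover have "nonneg_poly (Poly_Mapping.single m c * G' + F' * G)"
    using F G assms(2)
    by (intro nonneg_poly_add nonneg_poly_mult nonneg_poly_single pos_poly_imp_nonneg[of g G]) auto
  ultimately show ?thesis by (simp add: pos_poly_add)
qed

lemma pvar_dvd_iff: "pvar g dvd F \<longleftrightarrow> (\<forall>m \<in> Poly_Mapping.keys F. Poly_Mapping.lookup m g \<noteq> 0)"
proof
  assume "pvar g dvd F"
  then obtain G where "F = pvar g * G" by (auto simp: dvd_def)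
  then have "Poly_Mapping.keys F \<subseteq> {a + b | a b. a \<in> Poly_Mapping.keys (pvar g) \<and> b \<in> Poly_Mapping.keys G}"
    by (simp add: keys_mult)
  then show "\<forall>m \<in> Poly_Mapping.keys F. Poly_Mapping.lookup m g \<noteq> 0"
    by (force simp: pvar_def lookup_add split: if_splits)
next
  assume *: "\<forall>m \<in> Poly_Mapping.keys F. Poly_Mapping.lookup m g \<noteq> 0"
  have "F = (\<Sum>m\<in>Poly_Mapping.keys F. Poly_Mapping.single m (Poly_Mapping.lookup F m))"
    by (intro poly_mapping_eqI) (auto simp: lookup_sum lookup_single when_def in_keys_iff)
  also have "pvar g dvd \<dots>"
  proof (rule dvd_sum)
    fix m assume "m \<in> Poly_Mapping.keys F"
    then have "Poly_Mapping.lookup m g \<noteq> 0" using * by blast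
    then have "m = Poly_Mapping.single g 1 + (m - Poly_Mapping.single g 1)"
      by (intro poly_mapping_eqI) (auto simp: lookup_add lookup_minus lookup_single when_def)
    then have "Poly_Mapping.single m (Poly_Mapping.lookup F m)
        = pvar g * Poly_Mapping.single (m - Poly_Mapping.single g 1) (Poly_Mapping.lookup F m)"
      by (simp add: pvar_def mult_single)
    then show "pvar g dvd Poly_Mapping.single m (Poly_Mapping.lookup F m)" by simp
  qed
  finally show "pvar g dvd F" .
qed

lemma pos_poly_not_dvd: "pos_poly g F \<Longrightarrow> \<not> pvar g dvd F"
  by (force simp: pos_poly_def pvar_dvd_iff in_keys_iff)

text \<open>Takes the place of primality of \<open>pvar g\<close>: multiplication by a
  \<open>g\<close>-free monomial shifts exponents without changing that of \<open>g\<close>.\<close>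

lemma pvar_dvd_mult_monomial:
  assumes "pvar g dvd F * monomial m" "Poly_Mapping.lookup m g = 0"
  shows "pvar g dvd F"
  unfolding pvar_dvd_iff
proof
  fix k assume k: "k \<in> Poly_Mapping.keys F"
  have "Poly_Mapping.lookup (monomial m * F) (m + k) = Poly_Mapping.lookup F k"
    by (simp add: lookup_mult lookup_single when_mult eq_commute[of m])
  then have "m + k \<in> Poly_Mapping.keys (F * monomial m)"
    using k by (simp add: in_keys_iff mult.commute)
  then show "Poly_Mapping.lookup k g \<noteq> 0"
    using assms by (auto simp: pvar_dvd_iff lookup_add dest!: bspec[of _ _ "m + k"])
qed

lemma pvar_neq_0 [simp]: "pvar v \<noteq> 0"
  by (metis keys_single keys_zero empty_not_insert one_neq_zero pvar_def)

lemma var_neq_0 [simp]: "var v \<noteq> 0"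
  by (simp add: var_def Zero_fract_def eq_fract)

lemma monomial_neq_0 [simp]: "monomial m \<noteq> 0"
  by (metis keys_single keys_zero empty_not_insert one_neq_zero)

lemma monomial_mult: "monomial m * monomial k = monomial (m + k)"
  by (simp add: mult_single)

text \<open>Regularity along \<open>g\<close>: other variables may be inverted freely, and the
  numerator may still vanish at \<open>g = 0\<close>. In \<open>laurent_pos\<close> it may not, so
  the elements there have order exactly 0 along \<open>g\<close>.\<close>

definition laurent_nonneg :: "'v::linorder \<Rightarrow> 'v ratfun set" where
  "laurent_nonneg g = {Fract F (monomial m) | F m. nonneg_poly F \<and> Poly_Mapping.lookup m g = 0}"

definition laurent_pos :: "'v::linorder \<Rightarrow> 'v ratfun set" where
  "laurent_pos g = {Fract F (monomial m) | F m. pos_poly g F \<and> Poly_Mapping.lookup m g = 0}"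

lemma laurent_posI: "pos_poly g F \<Longrightarrow> Poly_Mapping.lookup m g = 0 \<Longrightarrow> Fract F (monomial m) \<in> laurent_pos g"
  by (auto simp: laurent_pos_def)

lemma laurent_nonnegI:
  "nonneg_poly F \<Longrightarrow> Poly_Mapping.lookup m g = 0 \<Longrightarrow> Fract F (monomial m) \<in> laurent_nonneg g"
  by (auto simp: laurent_nonneg_def)

definition semiring_closed :: "'a::semiring set \<Rightarrow> bool" where
  "semiring_closed P \<longleftrightarrow> (\<forall>x\<in>P. \<forall>y\<in>P. x + y \<in> P \<and> x * y \<in> P)"

lemma pos_monomial: "Poly_Mapping.lookup m g = 0 \<Longrightarrow> pos_poly g (monomial m)"
  by (simp add: pos_poly_single)

lemma nonneg_monomial: "nonneg_poly (monomial m)"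
  by (simp add: nonneg_poly_single)

text \<open>One summand that is nonzero at \<open>g = 0\<close> suffices. The asymmetry is needed
  for ears, where only one of two summands is known to be so.\<close>

lemma laurent_pos_add:
  assumes "x \<in> laurent_pos g" "y \<in> laurent_nonneg g"
  shows "x + y \<in> laurent_pos g"
proof -
  obtain F m G k where x: "x = Fract F (monomial m)" "pos_poly g F" "Poly_Mapping.lookup m g = 0"
    and y: "y = Fract G (monomial k)" "nonneg_poly G" "Poly_Mapping.lookup k g = 0"
    using assms by (auto simp: laurent_pos_def laurent_nonneg_def)
  have "x + y = Fract (F * monomial k + G * monomial m) (monomial (m + k))"
    by (simp add: x y monomial_mult)
  moreover have "pos_poly g (F * monomial k + G * monomial m)"
    using x y by (intro pos_poly_add pos_poly_mult nonneg_poly_mult pos_monomial nonneg_monomial)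
  ultimately show ?thesis using x y laurent_posI[of g _ "m + k"] by (simp add: lookup_add monomial_mult)
qed

lemma laurent_pos_subset: "laurent_pos g \<subseteq> laurent_nonneg g"
  by (auto simp: laurent_pos_def laurent_nonneg_def pos_poly_def)

lemma laurent_pos_closed: "semiring_closed (laurent_pos g)"
  unfolding semiring_closed_def
proof (intro ballI conjI)
  fix x y assume xy: "x \<in> laurent_pos g" "y \<in> laurent_pos g"
  then show "x + y \<in> laurent_pos g" using laurent_pos_add laurent_pos_subset by blast
  obtain F m G k where x: "x = Fract F (monomial m)" "pos_poly g F" "Poly_Mapping.lookup m g = 0"
    and y: "y = Fract G (monomial k)" "pos_poly g G" "Poly_Mapping.lookup k g = 0"
    using xy by (auto simp: laurent_pos_def)
  have "x * y = Fract (F * G) (monomial (m + k))"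
    by (simp add: x y monomial_mult)
  then show "x * y \<in> laurent_pos g"
    using x y laurent_posI[OF pos_poly_mult, of g F G "m + k"] by (simp add: lookup_add monomial_mult)
qed

lemma laurent_nonneg_closed: "semiring_closed (laurent_nonneg g)"
  unfolding semiring_closed_def
proof (intro ballI conjI)
  fix x y assume xy: "x \<in> laurent_nonneg g" "y \<in> laurent_nonneg g"
  obtain F m G k where x: "x = Fract F (monomial m)" "nonneg_poly F" "Poly_Mapping.lookup m g = 0"
    and y: "y = Fract G (monomial k)" "nonneg_poly G" "Poly_Mapping.lookup k g = 0"
    using xy by (auto simp: laurent_nonneg_def)
  have "x * y = Fract (F * G) (monomial (m + k))"
    by (simp add: x y monomial_mult)
  then show "x * y \<in> laurent_nonneg g"
    using x y laurent_nonnegI[OF nonneg_poly_mult, of F G "m + k" g] by (simp add: lookup_add monomial_mult)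
  have "x + y = Fract (F * monomial k + G * monomial m) (monomial (m + k))"
    by (simp add: x y monomial_mult)
  moreover have "nonneg_poly (F * monomial k + G * monomial m)"
    using x y by (intro nonneg_poly_add nonneg_poly_mult nonneg_monomial)
  ultimately show "x + y \<in> laurent_nonneg g"
    using x y laurent_nonnegI[of _ "m + k"] by (simp add: lookup_add monomial_mult)
qed

lemma pos_poly_1: "pos_poly g 1"
  using pos_monomial[of 0 g] by simp

lemma laurent_pos_1: "1 \<in> laurent_pos g"
  using laurent_posI[OF pos_poly_1, of 0 g] by (simp add: One_fract_def)

lemma laurent_pos_var: "v \<noteq> g \<Longrightarrow> var v \<in> laurent_pos g"
  using laurent_posI[OF pos_monomial, of "Poly_Mapping.single v 1" g 0]
  by (simp add: var_def pvar_def lookup_single)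

lemma laurent_pos_inverse_var: "v \<noteq> g \<Longrightarrow> inverse (var v) \<in> laurent_pos g"
  using laurent_posI[OF pos_poly_1, of "Poly_Mapping.single v 1" g]
  by (simp add: var_def pvar_def lookup_single)

lemma laurent_nonneg_var: "var v \<in> laurent_nonneg g"
  using laurent_nonnegI[OF nonneg_monomial, of 0 g "Poly_Mapping.single v 1"]
  by (simp add: var_def pvar_def)

lemma laurent_pos_neq_0: "x \<in> laurent_pos g \<Longrightarrow> x \<noteq> 0"
  by (auto simp: laurent_pos_def Zero_fract_def eq_fract) (simp add: pos_poly_def)

section \<open>Flips of polygon triangulations\<close>

text \<open>Counterclockwise order on the circle obtained by closing up the integer line; the
  disjuncts are the rotations of \<open>a < b < c\<close>. Under \<open>cyc4\<close> the chords
  \<open>{a, c}\<close> and \<open>{b, d}\<close> cross.\<close>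

definition cyc :: "int \<Rightarrow> int \<Rightarrow> int \<Rightarrow> bool" where
  "cyc a b c \<longleftrightarrow> a < b \<and> b < c \<or> b < c \<and> c < a \<or> c < a \<and> a < b"

definition cyc4 :: "int \<Rightarrow> int \<Rightarrow> int \<Rightarrow> int \<Rightarrow> bool" where
  "cyc4 a b c d \<longleftrightarrow> cyc a b c \<and> cyc a c d"

definition noncrossing :: "int set set \<Rightarrow> bool" where
  "noncrossing T \<longleftrightarrow> (\<forall>a b c d. cyc4 a b c d \<longrightarrow> {a, c} \<in> T \<longrightarrow> {b, d} \<notin> T)"

text \<open>With \<open>p\<close>, \<open>q\<close>, \<open>r\<close> counterclockwise, turning
  \<open>{p, q}\<close> about \<open>p\<close> onto \<open>{p, r}\<close> is counterclockwise by
  less than a half turn. \<open>T\<close> is meant to contain the polygon sides too, as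
  \<open>{q, r}\<close> may be one.\<close>

definition tri_arrow :: "int set set \<Rightarrow> int set \<Rightarrow> int set \<Rightarrow> bool" where
  "tri_arrow T C D \<longleftrightarrow> (\<exists>p q r. cyc p q r \<and> C = {p, q} \<and> D = {p, r} \<and> {q, r} \<in> T)"

lemma cyc_rotate: "cyc a b c \<longleftrightarrow> cyc b c a"
  by (auto simp: cyc_def)

lemma cyc_asym: "cyc a b c \<Longrightarrow> \<not> cyc b a c"
  by (auto simp: cyc_def)

lemma cyc4_rotate: "cyc4 a b c d \<longleftrightarrow> cyc4 b c d a"
  by (auto simp: cyc4_def cyc_def)

lemma cyc4_join: "cyc a b c \<Longrightarrow> cyc c d a \<Longrightarrow> cyc4 a b c d"
  by (auto simp: cyc4_def cyc_def)

lemma noncrossingD: "noncrossing T \<Longrightarrow> cyc4 a b c d \<Longrightarrow> {a, c} \<in> T \<Longrightarrow> {b, d} \<in> T \<Longrightarrow> False"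
  by (auto simp: noncrossing_def)

text \<open>Two different apexes on the same side of \<open>{a, c}\<close> would give crossing
  edges, one from each triangle.\<close>

lemma apex_unique:
  assumes nc: "noncrossing T"
    and b: "cyc a b c" "{a, b} \<in> T" "{b, c} \<in> T"
    and q: "cyc a q c" "{a, q} \<in> T" "{q, c} \<in> T"
  shows "q = b"
proof (rule ccontr)
  assume "q \<noteq> b"
  then have "cyc4 a q b c \<or> cyc4 a b q c"
    using b(1) q(1) by (auto simp: cyc4_def cyc_def)
  then show False
    using noncrossingD[OF nc, of a q b c] noncrossingD[OF nc, of a b q c] b q by auto
qed

lemma tri_arrow_asym: "tri_arrow T C D \<Longrightarrow> \<not> tri_arrow T D C"
  unfolding tri_arrow_def by (auto simp: cyc_def doubleton_eq_iff)

lemma tri_arrow_into: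
  assumes nc: "noncrossing T" and q: "cyc4 a b c d"
    and T: "{a, b} \<in> T" "{b, c} \<in> T" "{c, d} \<in> T" "{d, a} \<in> T" "C \<in> T"
  shows "tri_arrow T C {a, c} \<longleftrightarrow> C = {a, b} \<or> C = {c, d}"
proof
  assume "tri_arrow T C {a, c}"
  then obtain p q r where *: "cyc p q r" "C = {p, q}" "{a, c} = {p, r}" "{q, r} \<in> T"
    by (auto simp: tri_arrow_def)
  from *(3) consider "p = a" "r = c" | "p = c" "r = a"
    by (auto simp: doubleton_eq_iff)
  then show "C = {a, b} \<or> C = {c, d}"
  proof cases
    case 1
    then show ?thesis using apex_unique[OF nc, of a b c q] * T q by (auto simp: cyc4_def)
  next
    case 2
    then show ?thesis using apex_unique[OF nc, of c d a q] * T q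
      by (auto simp: cyc4_def cyc_rotate[of c d a] cyc_rotate[of d a c])
  qed
next
  have "cyc a b c" "cyc c d a" using q by (auto simp: cyc4_def cyc_def)
  then show "C = {a, b} \<or> C = {c, d} \<Longrightarrow> tri_arrow T C {a, c}"
    unfolding tri_arrow_def using T by (metis insert_commute)
qed

lemma tri_arrow_from:
  assumes nc: "noncrossing T" and q: "cyc4 a b c d"
    and T: "{a, b} \<in> T" "{b, c} \<in> T" "{c, d} \<in> T" "{d, a} \<in> T" "C \<in> T"
  shows "tri_arrow T {a, c} C \<longleftrightarrow> C = {b, c} \<or> C = {d, a}"
proof
  assume "tri_arrow T {a, c} C"
  then obtain p q r where *: "cyc p q r" "{a, c} = {p, q}" "C = {p, r}" "{q, r} \<in> T"
    by (auto simp: tri_arrow_def)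
  from *(2) consider "p = a" "q = c" | "p = c" "q = a"
    by (auto simp: doubleton_eq_iff)
  then show "C = {b, c} \<or> C = {d, a}"
  proof cases
    case 1
    then have "r = d" using apex_unique[OF nc, of c d a r] * T q
      by (auto simp: cyc4_def cyc_def insert_commute)
    then show ?thesis using 1 * by auto
  next
    case 2
    then have "r = b" using apex_unique[OF nc, of a b c r] * T q
      by (auto simp: cyc4_def cyc_def insert_commute)
    then show ?thesis using 2 * by auto
  qed
next
  have c: "cyc a c d" "cyc c a b" using q by (auto simp: cyc4_def cyc_def)
  show "C = {b, c} \<or> C = {d, a} \<Longrightarrow> tri_arrow T {a, c} C"
    unfolding tri_arrow_def using T c by (metis insert_commute)
qed

lemma tri_arrow_pair:
  assumes "q \<noteq> r"
  shows "tri_arrow T {p, q} {p, r} \<longleftrightarrow> cyc p q r \<and> {q, r} \<in> T"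
    and "tri_arrow T {q, p} {p, r} \<longleftrightarrow> cyc p q r \<and> {q, r} \<in> T"
    and "tri_arrow T {p, q} {r, p} \<longleftrightarrow> cyc p q r \<and> {q, r} \<in> T"
proof -
  show *: "tri_arrow T {p, q} {p, r} \<longleftrightarrow> cyc p q r \<and> {q, r} \<in> T"
    using assms unfolding tri_arrow_def by (auto simp: doubleton_eq_iff)
  show "tri_arrow T {q, p} {p, r} \<longleftrightarrow> cyc p q r \<and> {q, r} \<in> T"
    "tri_arrow T {p, q} {r, p} \<longleftrightarrow> cyc p q r \<and> {q, r} \<in> T"
    using * by (simp_all add: insert_commute)
qed

section \<open>The flip of a diagonal inside its quadrilateral\<close>

text \<open>Maximality of a triangulation in local form. Both orders of the pair
  \<open>{a, c}\<close> are quantified over, so there is an apex on each side of the chord. In use,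
  \<open>D\<close> holds the diagonals and \<open>T\<close> also the polygon sides.\<close>

definition two_sided :: "int set set \<Rightarrow> int set set \<Rightarrow> bool" where
  "two_sided D T \<longleftrightarrow> (\<forall>a c. {a, c} \<in> D \<longrightarrow> (\<exists>b. cyc a b c \<and> {a, b} \<in> T \<and> {b, c} \<in> T))"

text \<open>\<open>{p, q}\<close> crosses \<open>{b, d}\<close>. Unless it is \<open>{a, c}\<close>,
  it leaves the quadrilateral through a side: \<open>{b, c}\<close> or \<open>{c, d}\<close> when
  \<open>p\<close> is not \<open>c\<close>, and \<open>{d, a}\<close> or \<open>{a, b}\<close> when
  it is.\<close>

lemma cyc4_crossing_cases:
  assumes "cyc4 a b c d" "cyc4 b p d q"
  shows "p = c \<and> q = a \<or> cyc4 b p c q \<or> cyc4 c p d q \<or> p = c \<and> (cyc4 d q a p \<or> cyc4 a q b p)"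
  using assms unfolding cyc4_def cyc_def by smt

context
  fixes T :: "int set set" and a b c d :: int
  assumes nc: "noncrossing T" and quad: "cyc4 a b c d"
    and sides: "{a, b} \<in> T" "{b, c} \<in> T" "{c, d} \<in> T" "{d, a} \<in> T" and diag: "{a, c} \<in> T"
begin

lemma flip_new: "{b, d} \<notin> T"
  using noncrossingD[OF nc quad] diag by blast

abbreviation "flipped \<equiv> insert {b, d} (T - {{a, c}})"

lemma flip_distinct: "a \<noteq> b" "a \<noteq> c" "a \<noteq> d" "b \<noteq> c" "b \<noteq> d" "c \<noteq> d"
  using quad by (auto simp: cyc4_def cyc_def)

lemma flip_no_cross_new:
  assumes "cyc4 b p d q" "{p, q} \<in> flipped"
  shows False
proof -
  have pq: "{p, q} \<in> T" "{p, q} \<noteq> {a, c}"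
    using assms by (auto simp: cyc4_def cyc_def doubleton_eq_iff)
  have qp: "{q, p} \<in> T" using pq(1) by (simp add: insert_commute)
  consider "cyc4 b p c q" | "cyc4 c p d q" | "p = c" "cyc4 d q a p" | "p = c" "cyc4 a q b p"
    using cyc4_crossing_cases[OF quad assms(1)] pq(2) by (auto simp: insert_commute)
  then show False
    using pq(1) qp sides noncrossingD[OF nc] by cases blast+
qed

lemma flip_noncrossing: "noncrossing flipped"
  unfolding noncrossing_def
proof (intro allI impI notI)
  fix p q r s assume *: "cyc4 p q r s" "{p, r} \<in> flipped" "{q, s} \<in> flipped"
  show False
  proof (cases "{p, r} = {b, d} \<or> {q, s} = {b, d}")
    case True
    then consider "p = b" "r = d" | "p = d" "r = b" | "q = b" "s = d" | "q = d" "s = b"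
      by (auto simp: doubleton_eq_iff)
    then show False
      using * flip_no_cross_new[of q s] flip_no_cross_new[of s q]
        flip_no_cross_new[of r p] flip_no_cross_new[of p r]
      by cases (metis cyc4_rotate insert_commute)+
  next
    case False
    then show False using * noncrossingD[OF nc *(1)] by blast
  qed
qed

text \<open>This is the mutation rule between chords other than the flipped one. The membership
  conditions count paths through \<open>{a, c}\<close>, by \<open>tri_arrow_into\<close> and
  \<open>tri_arrow_from\<close>, and the truncated subtraction cancels 2-cycles.\<close>

lemma flip_arrow:
  assumes C: "C \<in> T" "C \<noteq> {a, c}" and D: "D \<in> T" "D \<noteq> {a, c}"
  shows "(of_bool (tri_arrow T C D) + of_bool (C \<in> {{a, b}, {c, d}} \<and> D \<in> {{b, c}, {d, a}}))
       - (of_bool (tri_arrow T D C) + of_bool (D \<in> {{a, b}, {c, d}} \<and> C \<in> {{b, c}, {d, a}}))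
       = (of_bool (tri_arrow flipped C D) :: nat)"
proof -
  note ds = flip_distinct
  have cy: "cyc a b c" "cyc a c d" "cyc a b d" "cyc b c d"
    using quad by (auto simp: cyc4_def cyc_def)
  have apexes: "p = b" if "cyc a p c" "{a, p} \<in> T" "{p, c} \<in> T" for p
    using apex_unique[OF nc cy(1) sides(1,2) that] .
  have apexes2: "p = d" if "cyc c p a" "{c, p} \<in> T" "{p, a} \<in> T" for p
    using apex_unique[OF nc _ sides(3,4) that] cy(2) cyc_rotate by blast
  have apexes3: "p = c" if "cyc b p d" "{b, p} \<in> flipped" "{p, d} \<in> flipped" for p
    using apex_unique[OF flip_noncrossing cy(4) _ _ that] sides ds by (auto simp: doubleton_eq_iff)
  have apexes4: "p = a" if "cyc d p b" "{d, p} \<in> flipped" "{p, b} \<in> flipped" for p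
    using apex_unique[OF flip_noncrossing _ _ _ that, of a] sides ds cy(3)
    by (auto simp: doubleton_eq_iff cyc_def)
  have cy': "cyc b c a" "cyc c d b" "cyc d a c" using cy cyc_rotate by blast+
  have ncy: "\<not> cyc b a c" "\<not> cyc a d b" "\<not> cyc c b d" "\<not> cyc d c a"
    using cy cyc_asym cyc_rotate by blast+
  have ca: "{c, a} = {a, c}" and db: "{d, b} = {b, d}" by auto
  \<comment> \<open>For consecutive sides the cyclic order rules out one direction, and the other
    holds exactly if the diagonal closing their triangle is in \<open>S\<close>. A flip trades the
    arrows closed by \<open>{a, c}\<close> for those closed by \<open>{b, d}\<close>.\<close>
  have table: "\<not> tri_arrow S {a, b} {b, c}" "tri_arrow S {b, c} {a, b} \<longleftrightarrow> {a, c} \<in> S"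
      "tri_arrow S {a, b} {d, a} \<longleftrightarrow> {b, d} \<in> S" "\<not> tri_arrow S {d, a} {a, b}"
      "tri_arrow S {c, d} {b, c} \<longleftrightarrow> {b, d} \<in> S" "\<not> tri_arrow S {b, c} {c, d}"
      "\<not> tri_arrow S {c, d} {d, a}" "tri_arrow S {d, a} {c, d} \<longleftrightarrow> {a, c} \<in> S" for S
    using tri_arrow_pair(2)[OF ds(2), of S b] tri_arrow_pair(3)[OF ds(2)[symmetric], of S b]
      tri_arrow_pair(3)[OF ds(5), of S a] tri_arrow_pair(2)[OF ds(5)[symmetric], of S a]
      tri_arrow_pair(3)[OF ds(5)[symmetric], of S c] tri_arrow_pair(2)[OF ds(5), of S c]
      tri_arrow_pair(2)[OF ds(2)[symmetric], of S d] tri_arrow_pair(3)[OF ds(2), of S d]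
    unfolding ca db by (simp_all only: ncy cy cy' simp_thms)
  have ne: "{a, b} \<noteq> {b, c}" "{a, b} \<noteq> {d, a}" "{c, d} \<noteq> {b, c}" "{c, d} \<noteq> {d, a}" "{a, c} \<noteq> {b, d}"
    using ds by (simp_all add: doubleton_eq_iff)
  define In where "In = {{a, b}, {c, d}}"
  define Out where "Out = {{b, c}, {d, a}}"
  consider (io) "C \<in> In" "D \<in> Out" | (oi) "D \<in> In" "C \<in> Out"
    | (no) "\<not> (C \<in> In \<and> D \<in> Out)" "\<not> (D \<in> In \<and> C \<in> Out)" by blast
  then show ?thesis
  proof cases
    case io
    then have "C = {a, b} \<or> C = {c, d}" "D = {b, c} \<or> D = {d, a}"
      by (simp_all only: In_def Out_def insert_iff empty_iff simp_thms)
    then show ?thesis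
      by (-, elim disjE) (simp_all add: table diag flip_new ne ne[symmetric])
  next
    case oi
    then have "D = {a, b} \<or> D = {c, d}" "C = {b, c} \<or> C = {d, a}"
      by (simp_all only: In_def Out_def insert_iff empty_iff simp_thms)
    then show ?thesis
      by (-, elim disjE) (simp_all add: table diag flip_new ne ne[symmetric])
  next
    case no
    \<comment> \<open>Only an arrow closed by one of the two diagonals could change. Uniqueness of
      apexes would make its chords consecutive sides of the quadrilateral, one incoming and one
      outgoing, which is excluded in this case.\<close>
    have "tri_arrow flipped C D \<longleftrightarrow> tri_arrow T C D"
    proof
      assume "tri_arrow T C D"
      then obtain p q r where *: "cyc p q r" "C = {p, q}" "D = {p, r}" "{q, r} \<in> T"
        by (auto simp: tri_arrow_def)
      have "{q, r} \<noteq> {a, c}"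
      proof
        assume "{q, r} = {a, c}"
        then consider "q = a" "r = c" | "q = c" "r = a" by (auto simp: doubleton_eq_iff)
        then show False
        proof cases
          case 1
          then have "p = d" using apexes2[of p] * C D by (auto simp: cyc_def insert_commute)
          then show ?thesis using 1 * no by (simp add: In_def Out_def insert_commute)
        next
          case 2
          then have "p = b" using apexes[of p] * C D by (auto simp: cyc_def insert_commute)
          then show ?thesis using 2 * no by (simp add: In_def Out_def insert_commute)
        qed
      qed
      then show "tri_arrow flipped C D" using * unfolding tri_arrow_def by blast
    next
      assume "tri_arrow flipped C D"
      then obtain p q r where *: "cyc p q r" "C = {p, q}" "D = {p, r}" "{q, r} \<in> flipped"
        by (auto simp: tri_arrow_def)
      have "{q, r} \<noteq> {b, d}"
      proof
        assume "{q, r} = {b, d}"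
        then consider "q = b" "r = d" | "q = d" "r = b" by (auto simp: doubleton_eq_iff)
        then show False
        proof cases
          case 1
          then have "p = a" using apexes4[of p] * C D by (auto simp: cyc_def insert_commute)
          then show ?thesis using 1 * no by (simp add: In_def Out_def insert_commute)
        next
          case 2
          then have "p = c" using apexes3[of p] * C D by (auto simp: cyc_def insert_commute)
          then show ?thesis using 2 * no by (simp add: In_def Out_def insert_commute)
        qed
      qed
      then show "tri_arrow T C D" using * unfolding tri_arrow_def by blast
    qed
    moreover have "\<not> (tri_arrow T C D \<and> tri_arrow T D C)"
      using tri_arrow_asym by blast
    ultimately show ?thesis using no unfolding In_def[symmetric] Out_def[symmetric] by auto
  qed
qed

text \<open>Only triangles with edge \<open>{a, c}\<close> are destroyed. A chord using one of them
  is a side of the quadrilateral, and its new apex is the end of \<open>{b, d}\<close> not on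
  it.\<close>

lemma flip_two_sided:
  assumes ts: "two_sided D T" and DT: "D \<subseteq> T" 
  shows "two_sided (insert {b, d} (D - {{a, c}})) flipped"
  unfolding two_sided_def
proof (intro allI impI)
  fix p q assume pq: "{p, q} \<in> insert {b, d} (D - {{a, c}})"
  note ds = flip_distinct
  have cy: "cyc a b c" "cyc a c d" "cyc a b d" "cyc b c d" "cyc c d a"
    using quad by (auto simp: cyc4_def cyc_def)
  have s': "{a, b} \<in> flipped" "{b, c} \<in> flipped" "{c, d} \<in> flipped" "{d, a} \<in> flipped" "{b, d} \<in> flipped"
    using sides ds by (auto simp: doubleton_eq_iff)
  consider "p = b" "q = d" | "p = d" "q = b" | "{p, q} \<in> D - {{a, c}}"
    using pq by (auto simp: doubleton_eq_iff)
  then show "\<exists>r. cyc p r q \<and> {p, r} \<in> flipped \<and> {r, q} \<in> flipped"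
  proof cases
    case 1 then show ?thesis using cy s' by (intro exI[of _ c]) auto
  next
    case 2 then show ?thesis using cy s' by (intro exI[of _ a]) (auto simp: cyc_def insert_commute)
  next
    case 3
    then obtain r where r: "cyc p r q" "{p, r} \<in> T" "{r, q} \<in> T"
      using ts by (auto simp: two_sided_def)
    have pqT: "{p, q} \<in> T" using 3 DT by auto
    have ap1: "x = b" if "cyc a x c" "{a, x} \<in> T" "{x, c} \<in> T" for x
      using apex_unique[OF nc cy(1) sides(1,2) that] .
    have ap2: "x = d" if "cyc c x a" "{c, x} \<in> T" "{x, a} \<in> T" for x
      using apex_unique[OF nc cy(5) sides(3,4) that] .
    consider "p = a" "r = c" | "p = c" "r = a" | "r = a" "q = c" | "r = c" "q = a"
      | "{p, r} \<noteq> {a, c}" "{r, q} \<noteq> {a, c}" by (auto simp: doubleton_eq_iff)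
    then show ?thesis
    proof cases
      case 1
      then have "q = d" using ap2[of q] r pqT by (auto simp: cyc_def insert_commute)
      then show ?thesis using 1 cy s' by (intro exI[of _ b]) (auto simp: cyc_def insert_commute)
    next
      case 2
      then have "q = b" using ap1[of q] r pqT by (auto simp: cyc_def insert_commute)
      then show ?thesis using 2 cy s' by (intro exI[of _ d]) (auto simp: cyc_def insert_commute)
    next
      case 3
      then have "p = d" using ap2[of p] r pqT by (auto simp: cyc_def insert_commute)
      then show ?thesis using 3 cy s' by (intro exI[of _ b]) (auto simp: cyc_def insert_commute)
    next
      case 4
      then have "p = b" using ap1[of p] r pqT by (auto simp: cyc_def insert_commute)
      then show ?thesis using 4 cy s' by (intro exI[of _ d]) (auto simp: cyc_def insert_commute)
    next
      case 5
      then show ?thesis using r by blast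
    qed
  qed
qed

end

section \<open>Seeds as labelled triangulations\<close>

text \<open>What chord values must satisfy for seeds to be triangulations. Sides have value 1
  because no cluster variable belongs to them; nonvanishing allows a Ptolemy relation to be divided
  by the old diagonal.\<close>

locale polygon =
  fixes N :: "'v::linorder set" and bd :: "int set set" and verts :: "int set"
    and X :: "int set \<Rightarrow> 'v ratfun"
  assumes fin: "finite N"
    and ptolemy: "cyc4 a b c d \<Longrightarrow> X {a, c} * X {b, d} = X {a, b} * X {c, d} + X {b, c} * X {d, a}"
    and X_bd: "C \<in> bd \<Longrightarrow> X C = 1"
    and X_nz: "p \<in> verts \<Longrightarrow> q \<in> verts \<Longrightarrow> p \<noteq> q \<Longrightarrow> X {p, q} \<noteq> 0"
begin

definition triang_seed :: "('v \<Rightarrow> int set) \<Rightarrow> ('v \<Rightarrow> 'v ratfun) \<Rightarrow> 'v quiver \<Rightarrow> bool" where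
  "triang_seed e u B \<longleftrightarrow> inj_on e N \<and> e ` N \<inter> bd = {} \<and> (\<Union>(e ` N \<union> bd) \<subseteq> verts) \<and>
     noncrossing (e ` N \<union> bd) \<and> two_sided (e ` N) (e ` N \<union> bd) \<and> (\<forall>v\<in>N. u v = X (e v)) \<and>
     (\<forall>v\<in>N. \<forall>w\<in>N. B v w = of_bool (tri_arrow (e ` N \<union> bd) (e v) (e w)))"

text \<open>The product runs over labels only. A side of the quadrilateral that lies on the polygon
  has no label, and is put back as a factor 1.\<close>

lemma prod_pair:
  assumes inj: "inj_on e N" and C: "C \<in> e ` N \<union> bd" and D: "D \<in> e ` N \<union> bd" and "C \<noteq> D"
    and u: "\<And>v. v \<in> N \<Longrightarrow> u v = X (e v)"
    and m: "\<And>v. v \<in> N \<Longrightarrow> m v = of_bool (e v \<in> {C, D})"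
  shows "(\<Prod>j\<in>N. u j ^ m j) = X C * X D"
proof -
  have "(\<Prod>j\<in>N. u j ^ m j) = (\<Prod>j\<in>N. if e j \<in> {C, D} then X (e j) else 1)"
    using u m by (intro prod.cong) auto
  also have "\<dots> = (\<Prod>E\<in>e ` N. if E \<in> {C, D} then X E else 1)"
    using inj by (simp add: prod.reindex o_def)
  also have "\<dots> = (\<Prod>E\<in>e ` N \<inter> {C, D}. X E)"
    using fin by (subst prod.inter_restrict) auto
  also have "\<dots> = (\<Prod>E\<in>{C, D}. X E)"
    using C D X_bd by (intro prod.mono_neutral_left) auto
  finally show ?thesis using \<open>C \<noteq> D\<close> by simp
qed

lemma triang_seed_flip:
  assumes seed: "triang_seed e u B" and k: "k \<in> N"
    and quad: "cyc4 a b c d" and ek: "e k = {a, c}"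
    and sides: "{a, b} \<in> e ` N \<union> bd" "{b, c} \<in> e ` N \<union> bd" "{c, d} \<in> e ` N \<union> bd" "{d, a} \<in> e ` N \<union> bd"
  shows "triang_seed (e(k := {b, d})) (mutate_cluster N k B u) (mutate_quiver k B)"
proof -
  define T where "T = e ` N \<union> bd"
  define e' where "e' = e(k := {b, d})"
  have inj: "inj_on e N" and disj: "e ` N \<inter> bd = {}" and verts: "\<Union>T \<subseteq> verts"
    and nc: "noncrossing T" and ts: "two_sided (e ` N) T"
    and u: "\<And>v. v \<in> N \<Longrightarrow> u v = X (e v)"
    and B: "\<And>v w. v \<in> N \<Longrightarrow> w \<in> N \<Longrightarrow> B v w = of_bool (tri_arrow T (e v) (e w))"
    using seed by (auto simp: triang_seed_def T_def)
  have sides': "{a, b} \<in> T" "{b, c} \<in> T" "{c, d} \<in> T" "{d, a} \<in> T"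
    using sides by (simp_all add: T_def)
  have acN: "{a, c} \<in> e ` N" using k ek by (metis imageI)
  have diag: "{a, c} \<in> T" using acN by (simp add: T_def)
  note ds = flip_distinct[OF nc quad sides' diag]
  have bdT: "{b, d} \<notin> T" using flip_new[OF nc quad sides' diag] .
  have eN': "e' ` N = insert {b, d} (e ` N - {{a, c}})"
    using k ek inj_on_image_set_diff[OF inj, of N "{k}"] unfolding e'_def fun_upd_image by (simp only: if_True image_insert image_empty) simp
  have T': "e' ` N \<union> bd = insert {b, d} (T - {{a, c}})"
    using acN disj unfolding eN' T_def by auto
  have eT: "e v \<in> T" if "v \<in> N" for v using that by (simp add: T_def)
  have eac: "e v = {a, c} \<longleftrightarrow> v = k" if "v \<in> N" for v
    using that k ek inj by (metis inj_onD)
  have ne: "{a, b} \<noteq> {c, d}" "{b, c} \<noteq> {d, a}"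
    using ds by (simp_all add: doubleton_eq_iff)
  have into: "B v k = of_bool (e v \<in> {{a, b}, {c, d}})"
    and outof: "B k v = of_bool (e v \<in> {{b, c}, {d, a}})" if "v \<in> N" for v
    using B[OF that k] B[OF k that] tri_arrow_into[OF nc quad sides' eT[OF that]]
      tri_arrow_from[OF nc quad sides' eT[OF that]] by (simp_all add: ek)
  have prod_in: "(\<Prod>j\<in>N. u j ^ B j k) = X {a, b} * X {c, d}"
    using sides inj ne u into by (intro prod_pair) auto
  have prod_out: "(\<Prod>j\<in>N. u j ^ B k j) = X {b, c} * X {d, a}"
    using sides inj ne u outof by (intro prod_pair) auto
  have "X {a, c} \<noteq> 0"
    using X_nz[of a c] diag verts ds by auto
  then have new: "((\<Prod>j\<in>N. u j ^ B j k) + (\<Prod>j\<in>N. u j ^ B k j)) / u k = X {b, d}"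
    unfolding prod_in prod_out u[OF k] ek ptolemy[OF quad, symmetric] by simp
  have nc': "noncrossing (insert {b, d} (T - {{a, c}}))"
    by (rule flip_noncrossing[OF nc quad sides' diag])
  have sne: "{a, b} \<noteq> {a, c}" "{b, c} \<noteq> {a, c}" "{c, d} \<noteq> {a, c}" "{d, a} \<noteq> {a, c}"
    using ds by (simp_all add: doubleton_eq_iff)
  have nbd: "{a, b} \<noteq> {b, d}" "{b, c} \<noteq> {b, d}" "{c, d} \<noteq> {b, d}" "{d, a} \<noteq> {b, d}"
    using ds by (simp_all add: doubleton_eq_iff)
  \<comment> \<open>Seen from the new diagonal the quadrilateral starts at \<open>b\<close>, so
    incoming and outgoing sides exchange roles. This is the reversal of the arrows at
    \<open>k\<close>.\<close>
  have quad': "cyc4 b c d a" using quad cyc4_rotate by blast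
  have s': "{b, c} \<in> insert {b, d} (T - {{a, c}})" "{c, d} \<in> insert {b, d} (T - {{a, c}})"
     "{d, a} \<in> insert {b, d} (T - {{a, c}})" "{a, b} \<in> insert {b, d} (T - {{a, c}})"
    using sides' sne by simp_all
  show ?thesis unfolding triang_seed_def e'_def[symmetric] T'
  proof (intro conjI ballI)
    show "inj_on e' N"
      using inj_on_fun_updI[OF inj, of "{b, d}" k] bdT unfolding e'_def T_def by blast
    show "e' ` N \<inter> bd = {}" using eN' disj bdT by (auto simp: T_def)
    show "\<Union>(insert {b, d} (T - {{a, c}})) \<subseteq> verts" using verts sides' by blast
    show "noncrossing (insert {b, d} (T - {{a, c}}))" by (rule nc')
    show "two_sided (e' ` N) (insert {b, d} (T - {{a, c}}))"
      unfolding eN' using flip_two_sided[OF nc quad sides' diag ts] by (simp add: T_def)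
  next
    fix v assume v: "v \<in> N"
    show "mutate_cluster N k B u v = X (e' v)"
      using new u[OF v] by (simp add: mutate_cluster_def e'_def)
  next
    fix v w assume v: "v \<in> N" and w: "w \<in> N"
    have e'T: "e' x \<in> insert {b, d} (T - {{a, c}})" if "x \<in> N" for x
      using that T' by blast
    show "mutate_quiver k B v w = of_bool (tri_arrow (insert {b, d} (T - {{a, c}})) (e' v) (e' w))"
    proof (cases "v = k \<or> w = k")
      case True
      show ?thesis
      proof (cases "v = k")
        case vk: True
        have "B w k = of_bool (e' w \<in> {{c, d}, {a, b}})"
          using into[OF w] ek sne nbd by (cases "w = k") (auto simp: e'_def)
        then show ?thesis
          using tri_arrow_from[OF nc' quad' s' e'T[OF w]] vk
          by (simp add: mutate_quiver_def e'_def)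
      next
        case False
        then have wk: "w = k" using True by simp
        have "B k v = of_bool (e' v \<in> {{b, c}, {d, a}})"
          using outof[OF v] ek sne nbd by (cases "v = k") (auto simp: e'_def)
        then show ?thesis
          using tri_arrow_into[OF nc' quad' s' e'T[OF v]] wk
          by (simp add: mutate_quiver_def e'_def)
      qed
    next
      case False
      have "mutate_quiver k B v w
        = (of_bool (tri_arrow T (e v) (e w)) + of_bool (e v \<in> {{a, b}, {c, d}} \<and> e w \<in> {{b, c}, {d, a}}))
        - (of_bool (tri_arrow T (e w) (e v)) + of_bool (e w \<in> {{a, b}, {c, d}} \<and> e v \<in> {{b, c}, {d, a}}))"
        using False B v w into outof unfolding mutate_quiver_def by (auto simp only: of_bool_conj if_False)
      also have "\<dots> = of_bool (tri_arrow (insert {b, d} (T - {{a, c}})) (e v) (e w))"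
        using False eac v w eT by (intro flip_arrow[OF nc quad sides' diag]) auto
      finally show ?thesis using False by (simp add: e'_def)
    qed
  qed
qed

lemma triang_seed_mutate:
  assumes seed: "triang_seed e u B" and k: "k \<in> N" "\<exists>a c. e k = {a, c}"
  shows "\<exists>b d. triang_seed (e(k := {b, d})) (mutate_cluster N k B u) (mutate_quiver k B)"
proof -
  obtain a c where ek: "e k = {a, c}" using k by blast
  then have "{a, c} \<in> e ` N" "{c, a} \<in> e ` N" using k by (metis imageI insert_commute)+
  then obtain b d where b: "cyc a b c" "{a, b} \<in> e ` N \<union> bd" "{b, c} \<in> e ` N \<union> bd"
      and d: "cyc c d a" "{c, d} \<in> e ` N \<union> bd" "{d, a} \<in> e ` N \<union> bd"
    using seed unfolding triang_seed_def two_sided_def by metis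
  then show ?thesis
    using triang_seed_flip[OF seed k(1) cyc4_join[OF b(1) d(1)] ek b(2,3) d(2,3)] by blast
qed

lemma seed_triang:
  assumes "seed N B0 u B" and "triang_seed e0 var B0" and "\<And>v. v \<in> N \<Longrightarrow> \<exists>a c. e0 v = {a, c}"
  shows "\<exists>e. triang_seed e u B \<and> (\<forall>v\<in>N. \<exists>a c. e v = {a, c})"
  using assms(1)
proof induction
  case initial
  then show ?case using assms by blast
next
  case (mutation u B k)
  then obtain e where e: "triang_seed e u B" "\<forall>v\<in>N. \<exists>a c. e v = {a, c}" by blast
  obtain b d where "triang_seed (e(k := {b, d})) (mutate_cluster N k B u) (mutate_quiver k B)"
    using triang_seed_mutate[OF e(1) mutation.hyps(2)] e mutation by blast
  moreover have "\<forall>v\<in>N. \<exists>a c. (e(k := {b, d})) v = {a, c}" using e(2) by auto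
  ultimately show ?case by blast
qed

lemma cluster_variable_chord:
  assumes "z \<in> cluster_variables N B0" and "triang_seed e0 var B0"
    and "\<And>v. v \<in> N \<Longrightarrow> \<exists>a c. e0 v = {a, c}"
  obtains p q where "p \<in> verts" "q \<in> verts" "p \<noteq> q" "z = X {p, q}"
proof -
  obtain u B v where z: "z = u v" "seed N B0 u B" "v \<in> N"
    using assms(1) by (auto simp: cluster_variables_def)
  obtain e where e: "triang_seed e u B" "\<forall>v\<in>N. \<exists>a c. e v = {a, c}"
    using seed_triang[OF z(2) assms(2,3)] by blast
  then obtain p q where pq: "e v = {p, q}" using z by blast
  then have "{p, q} \<in> e ` N" using z by (metis imageI)
  moreover have "two_sided (e ` N) (e ` N \<union> bd)" using e by (simp add: triang_seed_def)
  ultimately obtain r where "cyc p r q" unfolding two_sided_def by blast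
  then have "p \<noteq> q" by (auto simp: cyc_def)
  moreover have "{p, q} \<subseteq> verts"
    using e(1) \<open>{p, q} \<in> e ` N\<close> unfolding triang_seed_def by blast
  then have "p \<in> verts" "q \<in> verts" by auto
  moreover have "z = X {p, q}" using e z pq by (auto simp: triang_seed_def)
  ultimately show thesis using that by blast
qed

end

section \<open>The polygon of a snake triangulation\<close>

definition det2 :: "'a::comm_ring_1 \<times> 'a \<Rightarrow> 'a \<times> 'a \<Rightarrow> 'a" where
  "det2 u v = fst u * snd v - snd u * fst v"

definition lincomb :: "'a::comm_ring_1 \<Rightarrow> 'a \<times> 'a \<Rightarrow> 'a \<Rightarrow> 'a \<times> 'a \<Rightarrow> 'a \<times> 'a" where
  "lincomb a u b v = (a * fst u + b * fst v, a * snd u + b * snd v)"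

lemma det2_lincomb_left: "det2 (lincomb a u b v) w = a * det2 u w + b * det2 v w"
  by (simp add: det2_def lincomb_def algebra_simps)

lemma det2_lincomb_right: "det2 w (lincomb a u b v) = a * det2 w u + b * det2 w v"
  by (simp add: det2_def lincomb_def algebra_simps)

lemma det2_self: "det2 u u = 0"
  by (simp add: det2_def)

lemma det2_swap: "det2 v u = - det2 u v"
  by (simp add: det2_def)

text \<open>A determinant changes sign with the order of its arguments; putting the smaller vertex
  first makes the value a function of the chord.\<close>

definition chord_det :: "(int \<Rightarrow> 'a::comm_ring_1 \<times> 'a) \<Rightarrow> int set \<Rightarrow> 'a" where
  "chord_det W C = det2 (W (Min C)) (W (Max C))"

lemma chord_det_less: "p < q \<Longrightarrow> chord_det W {p, q} = det2 (W p) (W q)"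
  by (simp add: chord_det_def)

lemma chord_det_greater: "q < p \<Longrightarrow> chord_det W {p, q} = det2 (W q) (W p)"
  by (simp add: chord_det_def)

lemma chord_det_ptolemy:
  assumes "cyc4 a b c d"
  shows "chord_det W {a, c} * chord_det W {b, d}
    = chord_det W {a, b} * chord_det W {c, d} + chord_det W {b, c} * chord_det W {d, a}"
proof -
  \<comment> \<open>The relation is cyclic but the ordering of end points is not, so each place
    where the cycle can wrap around is checked.\<close>
  consider "a < b" "b < c" "c < d" | "b < c" "c < d" "d < a" | "c < d" "d < a" "a < b" | "d < a" "a < b" "b < c"
    using assms unfolding cyc4_def cyc_def by linarith
  then show ?thesis
    by cases (simp_all add: chord_det_less chord_det_greater det2_def algebra_simps)
qed

text \<open>The diagonals \<open>g 1, \<dots>, g n\<close> zigzag through the polygon: \<open>g i\<close> and \<open>g (Suc i)\<close> share the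
  end point that is kept at step \<open>i\<close>, the other one moves left if \<open>d i\<close> and right otherwise, and
  \<open>h i\<close> closes the triangle. The vertices met by these diagonals get the even positions \<open>2 * p\<close>, the
  tips of the ears the odd ones.\<close>

locale snake =
  fixes n :: nat and d :: "nat \<Rightarrow> bool" and g h :: "nat \<Rightarrow> 'v::linorder"
  assumes n2: "2 \<le> n" and d0: "d 0" and dn: "d n"
    and inj_g: "inj_on g {..Suc n}" and inj_h: "inj_on h {..n}"
    and disj_gh: "g ` {..Suc n} \<inter> h ` {..n} = {}"
begin

primrec zz :: "nat \<Rightarrow> int" where
  "zz 0 = 0"
| "zz (Suc i) = zz i - of_bool (d i)"

text \<open>Each step adds one vertex, \<open>tip i\<close>, on the left or on the right, so the
  interval from \<open>zz i\<close> to \<open>oo i\<close> has length \<open>i + 1\<close>.\<close>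

definition oo :: "nat \<Rightarrow> int" where
  "oo i = zz i + int i + 1"

definition tip :: "nat \<Rightarrow> int" where
  "tip i = (if d i then zz i - 1 else oo i + 1)"

lemma oo_0 [simp]: "oo 0 = 1"
  by (simp add: oo_def)

lemma oo_Suc [simp]: "oo (Suc i) = oo i + of_bool (\<not> d i)"
  by (simp add: oo_def)

lemma zz_mono: "i \<le> j \<Longrightarrow> zz j \<le> zz i"
  by (induction j rule: dec_induct) auto

lemma oo_mono: "i \<le> j \<Longrightarrow> oo i \<le> oo j"
  by (induction j rule: dec_induct) auto

lemma zz_le_0: "zz i \<le> 0" using zz_mono[of 0 i] by simp
lemma oo_ge_1: "1 \<le> oo i" using oo_mono[of 0 i] by simp
lemma zz_less_oo: "zz i < oo i" using zz_le_0 oo_ge_1 by (meson le_less_trans less_le_trans zero_less_one)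
lemma zz_1 [simp]: "zz (Suc 0) = -1" using d0 by simp
lemma oo_1 [simp]: "oo (Suc 0) = 1" using d0 by simp
lemma oo_Suc_n [simp]: "oo (Suc n) = oo n" using dn by simp
lemma zz_Suc_n [simp]: "zz (Suc n) = zz n - 1" using dn by simp

text \<open>Cramer's rule: the vector at \<open>tip i\<close> is the one with determinants
  \<open>var (g (Suc i))\<close> and \<open>var (h i)\<close> against the two ends of
  \<open>g i\<close>. At stage \<open>i\<close> only the positions from \<open>zz i\<close> to
  \<open>oo i\<close> are meaningful; at stage 0 these are 0 and 1.\<close>

primrec vec :: "nat \<Rightarrow> int \<Rightarrow> 'v ratfun \<times> 'v ratfun" where
  "vec 0 = (\<lambda>p. if p = 0 then (1, 0) else (0, var (g 0)))"
| "vec (Suc i) = (vec i)(tip i :=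
     (if d i then lincomb (var (g (Suc i)) / var (g i)) (vec i (zz i)) (- var (h i) / var (g i)) (vec i (oo i))
      else lincomb (- var (h i) / var (g i)) (vec i (zz i)) (var (g (Suc i)) / var (g i)) (vec i (oo i))))"

lemma vec_stable:
  assumes "i \<le> j" "zz i \<le> p" "p \<le> oo i"
  shows "vec j p = vec i p"
  using assms(1)
proof (induction j rule: dec_induct)
  case (step k)
  have "p \<noteq> tip k" using zz_mono[of i k] oo_mono[of i k] step.hyps assms(2,3) by (auto simp: tip_def)
  then show ?case using step.IH by simp
qed simp

lemma vec_edges:
  "det2 (vec i (zz i)) (vec i (oo i)) = var (g i)"
  "d i \<Longrightarrow> det2 (vec (Suc i) (zz i - 1)) (vec (Suc i) (zz i)) = var (h i)"
  "\<not> d i \<Longrightarrow> det2 (vec (Suc i) (oo i)) (vec (Suc i) (oo i + 1)) = var (h i)"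
proof -
  show *: "det2 (vec i (zz i)) (vec i (oo i)) = var (g i)" for i
  proof (induction i)
    case 0 then show ?case by (simp add: det2_def)
  next
    case (Suc i)
    then show ?case using zz_less_oo[of i]
      by (auto simp: tip_def det2_lincomb_left det2_lincomb_right det2_self det2_swap[of "vec i (oo i)" "vec i (zz i)"])
  qed
  show "d i \<Longrightarrow> det2 (vec (Suc i) (zz i - 1)) (vec (Suc i) (zz i)) = var (h i)"
    using *[of i] by (simp add: tip_def det2_lincomb_left det2_self det2_swap[of "vec i (oo i)" "vec i (zz i)"])
  show "\<not> d i \<Longrightarrow> det2 (vec (Suc i) (oo i)) (vec (Suc i) (oo i + 1)) = var (h i)"
    using *[of i] by (simp add: tip_def det2_lincomb_right det2_self det2_swap[of "vec i (oo i)" "vec i (zz i)"])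
qed

text \<open>These are the edges of the inner polygon: every step contributes the edge between its
  tip and the end that the tip replaces, and the edge from 0 to 1 is there from the start.\<close>

lemma boundary_position:
  assumes "zz i \<le> p" "p < oo i" "p \<noteq> 0"
  shows "\<exists>j<i. (\<not> d j \<and> p = oo j) \<or> (d j \<and> p = zz j - 1)"
  using assms
proof (induction i)
  case (Suc i)
  show ?case
  proof (cases "zz i \<le> p \<and> p < oo i")
    case True
    then show ?thesis using Suc by (metis less_Suc_eq)
  next
    case False
    then have "(\<not> d i \<and> p = oo i) \<or> (d i \<and> p = zz i - 1)"
      using Suc.prems by (cases "d i") auto
    then show ?thesis by blast
  qed
qed simp

text \<open>The range \<open>lo..hi\<close> has \<open>2 * n + 6\<close> elements, three more than
  there are labels. Its last vertex \<open>hi\<close> is odd: it is the tip of the ear on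
  \<open>g (Suc n)\<close>, between the last inner vertex and \<open>lo\<close>.\<close>

definition lo :: int where "lo = 2 * zz (Suc n)"
definition hi :: int where "hi = 2 * oo (Suc n) + 1"

definition inner :: "int \<Rightarrow> 'v ratfun \<times> 'v ratfun" where
  "inner = vec (Suc n)"

text \<open>The tip of an ear with base vectors \<open>a\<close>, \<open>b\<close> is
  \<open>(a + b) / det2 a b\<close>, which has determinant 1 with both neighbours. At
  \<open>hi\<close> the base wraps around, which changes one sign.\<close>

definition pt :: "int \<Rightarrow> 'v ratfun \<times> 'v ratfun" where
  "pt q = (if even q then inner (q div 2)
     else if q = hi then lincomb (1 / var (g (Suc n))) (inner (oo (Suc n))) (- 1 / var (g (Suc n))) (inner (zz (Suc n)))
     else (let a = inner (q div 2); b = inner (q div 2 + 1) in lincomb (1 / det2 a b) a (1 / det2 a b) b))"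

definition X :: "int set \<Rightarrow> 'v ratfun" where
  "X = chord_det pt"

definition gchord :: "nat \<Rightarrow> int set" where
  "gchord i = {2 * zz i, 2 * oo i}"

definition hchord :: "nat \<Rightarrow> int set" where
  "hchord i = (if d i then {2 * zz i - 2, 2 * zz i} else {2 * oo i, 2 * oo i + 2})"

definition bd :: "int set set" where
  "bd = (\<lambda>q. {q, q + 1}) ` {lo..<hi} \<union> {{lo, hi}}"

lemma pt_even [simp]: "pt (2 * p) = inner p"
  by (simp add: pt_def)

lemma X_even: "p < q \<Longrightarrow> X {2 * p, 2 * q} = det2 (inner p) (inner q)"
  by (simp add: X_def chord_det_less)

lemma X_gchord: 
  assumes "i \<le> Suc n" shows "X (gchord i) = var (g i)"
  using vec_edges(1)[of i] zz_less_oo[of i] vec_stable[OF assms, of "zz i"] vec_stable[OF assms, of "oo i"]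
  by (simp add: X_def gchord_def chord_det_less inner_def)

lemma X_hchord: 
  assumes "i \<le> n" shows "X (hchord i) = var (h i)"
proof -
  have s: "Suc i \<le> Suc n" using assms by simp
  have e: "2 * zz i - 2 = 2 * (zz i - 1)" "2 * oo i + 2 = 2 * (oo i + 1)" by simp_all
  show ?thesis
    using vec_edges(2,3)[of i] zz_less_oo[of i] vec_stable[OF s, of "zz i - 1"] vec_stable[OF s, of "zz i"]
      vec_stable[OF s, of "oo i"] vec_stable[OF s, of "oo i + 1"]
      X_even[of "zz i - 1" "zz i"] X_even[of "oo i" "oo i + 1"]
    unfolding hchord_def inner_def[symmetric] e by auto
qed

lemma boundary_chord:
  assumes "zz (Suc n) \<le> p" "p < oo (Suc n)"
  shows "{2 * p, 2 * p + 2} = gchord 0 \<or> (\<exists>j\<le>n. {2 * p, 2 * p + 2} = hchord j)"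
proof (cases "p = 0")
  case True then show ?thesis by (simp add: gchord_def)
next
  case False
  then obtain j where "j < Suc n" "(\<not> d j \<and> p = oo j) \<or> (d j \<and> p = zz j - 1)"
    using boundary_position[OF assms] by blast
  then show ?thesis by (intro disjI2 exI[of _ j]) (auto simp: hchord_def)
qed

lemma boundary_neq_0:
  assumes "zz (Suc n) \<le> p" "p < oo (Suc n)"
  shows "det2 (inner p) (inner (p + 1)) \<noteq> 0"
proof -
  have "X {2 * p, 2 * (p + 1)} \<noteq> 0"
    using boundary_chord[OF assms] X_gchord[of 0] X_hchord by (auto simp: algebra_simps)
  then show ?thesis using X_even[of p "p + 1"] by simp
qed

lemma X_bd:
  assumes "C \<in> bd" shows "X C = 1"
proof -
  have lohi: "lo < hi" using zz_less_oo[of "Suc n"] by (simp add: lo_def hi_def)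
  have pt_lo: "pt lo = inner (zz (Suc n))" by (simp only: lo_def pt_even)
  have pt_hi: "pt hi = lincomb (1 / var (g (Suc n))) (inner (oo (Suc n)))
      (- 1 / var (g (Suc n))) (inner (zz (Suc n)))" by (simp add: pt_def hi_def)
  have dN: "det2 (inner (zz (Suc n))) (inner (oo (Suc n))) = var (g (Suc n))"
    using X_gchord[of "Suc n"] X_even[OF zz_less_oo[of "Suc n"]] by (simp only: gchord_def)
  consider "C = {lo, hi}" | q where "C = {q, q + 1}" "lo \<le> q" "q < hi"
    using assms by (auto simp: bd_def)
  then show ?thesis
  proof cases
    case 1
    then show ?thesis using lohi
      by (simp add: X_def chord_det_less pt_lo pt_hi dN det2_lincomb_right det2_self del: zz.simps oo_Suc zz_Suc_n oo_Suc_n)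
  next
    case 2
    consider "q = hi - 1" | p where "q = 2 * p" "q \<noteq> hi - 1" | p where "q = 2 * p + 1"
      by (metis oddE evenE)
    then show ?thesis
    proof cases
      case 1
      then have "pt q = inner (oo (Suc n))" "q + 1 = hi" using pt_even[of "oo (Suc n)"] by (simp_all add: hi_def)
      then show ?thesis using 2
        by (simp add: X_def chord_det_less pt_hi dN det2_lincomb_right det2_self
          det2_swap[of "inner (oo (Suc n))"] del: zz.simps oo_Suc zz_Suc_n oo_Suc_n)
    next
      case (2 p)
      then have p: "zz (Suc n) \<le> p" "p < oo (Suc n)" using \<open>lo \<le> q\<close> \<open>q < hi\<close> by (auto simp: lo_def hi_def)
      then show ?thesis using 2 \<open>C = _\<close> boundary_neq_0[OF p]
        by (simp add: X_def chord_det_less pt_def[of "2 * p + 1"] Let_def hi_def det2_lincomb_right det2_self)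
    next
      case (3 p)
      then have p: "zz (Suc n) \<le> p" "p < oo (Suc n)" using \<open>lo \<le> q\<close> \<open>q < hi\<close> by (auto simp: lo_def hi_def)
      have "q + 1 = 2 * (p + 1)" using 3 by simp
      then have "pt (q + 1) = inner (p + 1)" by (metis pt_even)
      then show ?thesis using 3 \<open>C = _\<close> boundary_neq_0[OF p] p
        by (simp add: X_def chord_det_less pt_def[of "2 * p + 1"] Let_def hi_def det2_lincomb_left det2_self)
    qed
  qed
qed

section \<open>The initial triangulation\<close>

definition labels :: "'v set" where
  "labels = g ` {..Suc n} \<union> h ` {..n}"

definition chord :: "'v \<Rightarrow> int set" where
  "chord v = (if v \<in> g ` {..Suc n} then gchord (inv_into {..Suc n} g v) else hchord (inv_into {..n} h v))"

definition T :: "int set set" where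
  "T = chord ` labels \<union> bd"

lemma chord_g: "i \<le> Suc n \<Longrightarrow> chord (g i) = gchord i"
  using inj_g by (simp add: chord_def inv_into_f_f)

lemma chord_h:
  assumes "i \<le> n" shows "chord (h i) = hchord i"
proof -
  have "h i \<notin> g ` {..Suc n}" using assms disj_gh by blast
  then show ?thesis using assms inj_h by (simp add: chord_def inv_into_f_f)
qed

lemma labels_cases:
  assumes "v \<in> labels"
  obtains (g) i where "i \<le> Suc n" "v = g i" | (h) i where "i \<le> n" "v = h i"
  using assms by (auto simp: labels_def)

lemma g_in_labels: "i \<le> Suc n \<Longrightarrow> g i \<in> labels"
  and h_in_labels: "i \<le> n \<Longrightarrow> h i \<in> labels"
  by (auto simp: labels_def)

lemma T_gchord: "i \<le> Suc n \<Longrightarrow> gchord i \<in> T"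
  using chord_g g_in_labels by (metis T_def UnI1 imageI)

lemma T_hchord: "i \<le> n \<Longrightarrow> hchord i \<in> T"
  using chord_h h_in_labels by (metis T_def UnI1 imageI)

lemma hchord_alt: "hchord i = {2 * (if d i then zz i - 1 else oo i), 2 * (if d i then zz i - 1 else oo i) + 2}"
  by (auto simp: hchord_def)

lemma gchord_inj:
  assumes "gchord i = gchord j" shows "i = j"
proof -
  have "zz i = zz j" "oo i = oo j"
    using assms zz_less_oo[of i] zz_less_oo[of j] by (auto simp: gchord_def doubleton_eq_iff)
  then show ?thesis by (simp add: oo_def)
qed

lemma hchord_inj:
  assumes "hchord i = hchord j" shows "i = j"
proof -
  have eq: "(if d i then zz i - 1 else oo i) = (if d j then zz j - 1 else oo j)"
    using assms by (auto simp: hchord_alt doubleton_eq_iff split: if_splits)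
  have "\<not> i < j" if "(if d i then zz i - 1 else oo i) = (if d j then zz j - 1 else oo j)" for i j
    using that zz_mono[of "Suc i" j] oo_mono[of "Suc i" j] zz_le_0[of i] zz_le_0[of j] oo_ge_1[of i] oo_ge_1[of j]
    by (auto split: if_splits)
  from this[OF eq] this[OF eq[symmetric]] show ?thesis by simp
qed

text \<open>Among the \<open>g i\<close> only \<open>g 0\<close> joins neighbouring inner positions,
  namely 0 and 1, and no \<open>h j\<close> has its left end at 0.\<close>

lemma gchord_neq_hchord: "gchord i \<noteq> hchord j"
proof
  assume "gchord i = hchord j"
  then have e: "zz i = (if d j then zz j - 1 else oo j)" "oo i = zz i + 1"
    using zz_less_oo[of i] by (auto simp: gchord_def hchord_alt doubleton_eq_iff split: if_splits)
  then have "i = 0" by (simp add: oo_def)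
  then show False using e zz_le_0[of j] oo_ge_1[of j] by (auto split: if_splits)
qed

lemma inj_chord: "inj_on chord labels"
proof (rule inj_onI)
  fix v w assume "v \<in> labels" "w \<in> labels" and e: "chord v = chord w"
  then show "v = w"
    using gchord_inj hchord_inj gchord_neq_hchord by (elim labels_cases) (metis chord_g chord_h)+
qed

lemma two_sidedI:
  assumes "\<And>C. C \<in> D \<Longrightarrow> \<exists>a b c d. C = {a, c} \<and> cyc4 a b c d \<and> {a, b} \<in> S \<and> {b, c} \<in> S \<and> {c, d} \<in> S \<and> {d, a} \<in> S"
  shows "two_sided D S"
  unfolding two_sided_def
proof (intro allI impI)
  fix p q assume "{p, q} \<in> D"
  then obtain a b c d where *: "{p, q} = {a, c}" "cyc4 a b c d" "{a, b} \<in> S" "{b, c} \<in> S" "{c, d} \<in> S" "{d, a} \<in> S"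
    using assms by meson
  have cy: "cyc a b c" "cyc c d a" using *(2) by (auto simp: cyc4_def cyc_def)
  from *(1) consider "p = a" "q = c" | "p = c" "q = a" by (auto simp: doubleton_eq_iff)
  then show "\<exists>r. cyc p r q \<and> {p, r} \<in> S \<and> {r, q} \<in> S"
    using cy * by cases blast+
qed

text \<open>With \<open>g_out\<close>, the remaining corners of the quadrilateral around
  \<open>g i\<close>. One is the end of the preceding diagonal that was given up, or the ear tip 1
  for \<open>i = 0\<close>; the other is the next tip, or the ear tip \<open>hi\<close> for
  \<open>i = Suc n\<close>.\<close>

definition g_in :: "nat \<Rightarrow> int" where
  "g_in i = (case i of 0 \<Rightarrow> 1 | Suc j \<Rightarrow> if d j then 2 * zz j else 2 * oo j)"

definition g_out :: "nat \<Rightarrow> int" where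
  "g_out i = (if i = Suc n then hi else 2 * tip i)"

lemma bd_step: "lo \<le> q \<Longrightarrow> q < hi \<Longrightarrow> {q, q + 1} \<in> bd"
  and bd_wrap: "{lo, hi} \<in> bd"
  by (auto simp: bd_def)

lemma bounds:
  assumes "i \<le> Suc n" shows "lo \<le> 2 * zz i" "2 * oo i < hi"
  using zz_mono[OF assms] oo_mono[OF assms] by (auto simp: lo_def hi_def)

lemma g_quad:
  assumes "i \<le> Suc n"
  shows "cyc4 (2 * zz i) (g_in i) (2 * oo i) (g_out i)"
    and "{2 * zz i, g_in i} = (case i of 0 \<Rightarrow> {0, 1} | Suc j \<Rightarrow> if d j then hchord j else gchord j)"
    and "{g_in i, 2 * oo i} = (case i of 0 \<Rightarrow> {1, 2} | Suc j \<Rightarrow> if d j then gchord j else hchord j)"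
    and "{2 * oo i, g_out i} = (if i = Suc n then {2 * oo i, 2 * oo i + 1} else if d i then gchord (Suc i) else hchord i)"
    and "{g_out i, 2 * zz i} = (if i = Suc n then {lo, hi} else if d i then hchord i else gchord (Suc i))"
proof -
  have "cyc (2 * zz i) (g_in i) (2 * oo i)"
  proof (cases i)
    case (Suc j)
    then show ?thesis using zz_less_oo[of j] by (auto simp: g_in_def cyc_def)
  qed (simp add: g_in_def cyc_def)
  moreover have "cyc (2 * zz i) (2 * oo i) (g_out i)"
    using zz_less_oo[of i] by (auto simp: g_out_def cyc_def tip_def hi_def simp del: zz_Suc_n oo_Suc_n)
  ultimately show "cyc4 (2 * zz i) (g_in i) (2 * oo i) (g_out i)" by (simp add: cyc4_def)
  show "{2 * zz i, g_in i} = (case i of 0 \<Rightarrow> {0, 1} | Suc j \<Rightarrow> if d j then hchord j else gchord j)"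
    "{g_in i, 2 * oo i} = (case i of 0 \<Rightarrow> {1, 2} | Suc j \<Rightarrow> if d j then gchord j else hchord j)"
    by (auto simp: g_in_def hchord_def gchord_def split: nat.splits)
  show "{2 * oo i, g_out i} = (if i = Suc n then {2 * oo i, 2 * oo i + 1} else if d i then gchord (Suc i) else hchord i)"
    by (auto simp: g_out_def hi_def tip_def hchord_def gchord_def)
  show "{g_out i, 2 * zz i} = (if i = Suc n then {lo, hi} else if d i then hchord i else gchord (Suc i))"
    by (auto simp: g_out_def hi_def lo_def tip_def hchord_def gchord_def)
qed

lemma g_quad_T:
  assumes "i \<le> Suc n"
  shows "{2 * zz i, g_in i} \<in> T" "{g_in i, 2 * oo i} \<in> T" "{2 * oo i, g_out i} \<in> T" "{g_out i, 2 * zz i} \<in> T"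
proof -
  have i: "i \<le> n" if "i \<noteq> Suc n" using that assms by simp
  have b: "lo \<le> 0" "2 < hi" using bounds[of 0] by auto
  have "{0, 1} \<in> T" "{1, 2} \<in> T"
    using bd_step[of 0] bd_step[of 1] b by (auto simp: T_def)
  moreover have "{2 * oo (Suc n), 2 * oo (Suc n) + 1} \<in> T" "{lo, hi} \<in> T"
    using bd_step[of "2 * oo (Suc n)"] bounds[of "Suc n"] zz_less_oo[of "Suc n"] bd_wrap
    by (auto simp: T_def simp del: zz_Suc_n oo_Suc_n oo_Suc zz.simps)
  ultimately show "{2 * zz i, g_in i} \<in> T" "{g_in i, 2 * oo i} \<in> T" "{2 * oo i, g_out i} \<in> T" "{g_out i, 2 * zz i} \<in> T"
    unfolding g_quad(2-)[OF assms] using assms i T_gchord T_hchord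
    by (auto split: nat.splits simp del: zz_Suc_n oo_Suc_n oo_Suc zz.simps)
qed

text \<open>Left end of the base of the ear on \<open>h i\<close>. Opposite to it,
  \<open>h_opp i\<close> is the end point kept at step \<open>i\<close>, common to
  \<open>g i\<close> and \<open>g (Suc i)\<close>.\<close>

definition h_base :: "nat \<Rightarrow> int" where
  "h_base i = 2 * (if d i then zz i - 1 else oo i)"

definition h_opp :: "nat \<Rightarrow> int" where
  "h_opp i = 2 * (if d i then oo i else zz i)"

lemma h_quad:
  assumes "i \<le> n"
  shows "cyc4 (h_base i) (h_base i + 1) (h_base i + 2) (h_opp i)"
    and "hchord i = {h_base i, h_base i + 2}"
    and "{h_base i, h_base i + 1} \<in> bd" "{h_base i + 1, h_base i + 2} \<in> bd"
    and "{h_base i + 2, h_opp i} = (if d i then gchord i else gchord (Suc i))"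
    and "{h_opp i, h_base i} = (if d i then gchord (Suc i) else gchord i)"
proof -
  show "cyc4 (h_base i) (h_base i + 1) (h_base i + 2) (h_opp i)"
    using zz_less_oo[of i] by (auto simp: cyc4_def cyc_def h_base_def h_opp_def)
  show "hchord i = {h_base i, h_base i + 2}" by (simp add: hchord_alt h_base_def)
  have "lo \<le> h_base i" "h_base i + 2 < hi"
    using bounds[of "Suc i"] bounds[of i] assms zz_less_oo[of i] by (auto simp: h_base_def)
  then show "{h_base i, h_base i + 1} \<in> bd" "{h_base i + 1, h_base i + 2} \<in> bd"
    using bd_step[of "h_base i"] bd_step[of "h_base i + 1"] by (simp_all add: add.assoc)
  show "{h_base i + 2, h_opp i} = (if d i then gchord i else gchord (Suc i))"
    "{h_opp i, h_base i} = (if d i then gchord (Suc i) else gchord i)"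
    by (auto simp: h_base_def h_opp_def gchord_def)
qed

lemma h_quad_T:
  assumes "i \<le> n"
  shows "{h_base i, h_base i + 1} \<in> T" "{h_base i + 1, h_base i + 2} \<in> T" "{h_base i + 2, h_opp i} \<in> T" "{h_opp i, h_base i} \<in> T"
  using h_quad(3,4)[OF assms] T_gchord[of i] T_gchord[of "Suc i"] assms
  unfolding h_quad(5,6)[OF assms] by (auto simp: T_def)

lemma two_sided_T: "two_sided (chord ` labels) T"
proof (rule two_sidedI)
  fix C assume "C \<in> chord ` labels"
  then obtain v where v: "v \<in> labels" "C = chord v" by blast
  from v(1) show "\<exists>a b c d. C = {a, c} \<and> cyc4 a b c d \<and> {a, b} \<in> T \<and> {b, c} \<in> T \<and> {c, d} \<in> T \<and> {d, a} \<in> T"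
  proof (cases rule: labels_cases)
    case (g i)
    then have "C = {2 * zz i, 2 * oo i}" using v by (simp add: chord_g gchord_def)
    then show ?thesis using g_quad(1)[OF g(1)] g_quad_T[OF g(1)] by blast
  next
    case (h i)
    then have "C = {h_base i, h_base i + 2}" using v h_quad(2)[OF h(1)] by (simp add: chord_h)
    then show ?thesis using h_quad(1)[OF h(1)] h_quad_T[OF h(1)] by blast
  qed
qed

lemma bd_cases:
  assumes "C \<in> bd"
  obtains "C = {lo, hi}" | q where "C = {q, q + 1}" "lo \<le> q" "q < hi"
  using assms by (auto simp: bd_def)

lemma T_cases:
  assumes "{x, y} \<in> T" "x < y"
  obtains "y = x + 1" "lo \<le> x" "y \<le> hi" | "x = lo" "y = hi" | "y = x + 2" "even x" "lo \<le> x" "y < hi"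
    | i where "i \<le> Suc n" "x = 2 * zz i" "y = 2 * oo i"
proof -
  from assms(1) consider v where "v \<in> labels" "{x, y} = chord v" | "{x, y} \<in> bd"
    unfolding T_def by blast
  then show thesis
  proof cases
    case 1
    from 1(1) show thesis
    proof (cases rule: labels_cases)
      case (g i)
      then have "x = 2 * zz i" "y = 2 * oo i"
        using 1 assms(2) zz_less_oo[of i] by (auto simp: chord_g gchord_def doubleton_eq_iff)
      then show thesis using g that(4) by blast
    next
      case (h i)
      then have *: "x = h_base i" "y = h_base i + 2"
        using 1 assms(2) h_quad(2)[of i] by (auto simp: chord_h doubleton_eq_iff)
      moreover have "lo \<le> h_base i" "h_base i + 2 < hi" "even (h_base i)"
        using bounds[of "Suc i"] bounds[of i] h zz_less_oo[of i] by (auto simp: h_base_def)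
      ultimately show thesis using that(3) by simp
    qed
  next
    case 2
    then show thesis
    proof (cases rule: bd_cases)
      case 1
      moreover have "lo < hi" using bounds[of 0] by simp
      ultimately have "x = lo" "y = hi" using assms(2) by (auto simp: doubleton_eq_iff)
      then show thesis by (rule that(2))
    next
      case (2 q)
      then have "x = q" "y = q + 1" using assms(2) by (auto simp: doubleton_eq_iff)
      then show thesis using 2 that(1) by simp
    qed
  qed
qed

lemma T_bounds:
  assumes "{x, y} \<in> T" "x < y" shows "lo \<le> x" "y \<le> hi"
proof -
  have "lo < hi" using bounds[of 0] by simp
  then have "lo \<le> x \<and> y \<le> hi"
    using assms
  proof (cases rule: T_cases[OF assms])
    case (4 i)
    then show ?thesis using bounds[of i] by simp
  qed auto
  then show "lo \<le> x" "y \<le> hi" by auto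
qed

text \<open>Two diagonals of the snake are nested as intervals. A chord of length 2 passes over a
  single odd vertex, an ear tip, from which only sides emanate.\<close>

lemma T_no_crossing:
  assumes "x < y" "y < x'" "x' < y'" "{x, x'} \<in> T" "{y, y'} \<in> T"
  shows False
proof -
  have xx: "x < x'" and yy: "y < y'" using assms by auto
  note b = T_bounds[OF assms(4) xx] T_bounds[OF assms(5) yy]
  have lo: "even lo" by (simp add: lo_def)
  from assms(4) xx show False
  proof (cases rule: T_cases)
    case 3
    then have y: "y = x + 1" "x' = y + 1" using assms by auto
    moreover have "odd y" unfolding y(1) using 3 by simp
    ultimately have "{y, y'} \<in> T" "odd y" "x' = y + 1" using assms(5) by auto
    from this(1) yy show False
    proof (cases rule: T_cases)
      case (4 i)
      then have "even y" by simp
      then show False using \<open>odd y\<close> by blast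
    qed (use \<open>odd y\<close> \<open>x' = y + 1\<close> lo assms(3) in auto)
  next
    case (4 i)
    note i = this
    from assms(5) yy show False
    proof (cases rule: T_cases)
      case 3
      then have "x' = y + 1" using assms by auto
      then have "odd x'" using 3 by simp
      then show False using i by simp
    next
      case (4 j)
      then show False using i assms zz_mono[of i j] oo_mono[of i j] zz_mono[of j i] oo_mono[of j i]
        by (cases "i \<le> j") auto
    qed (use assms b in auto)
  qed (use assms b in auto)
qed

lemma noncrossing_T: "noncrossing T"
  unfolding noncrossing_def
proof (intro allI impI notI)
  fix a b c d assume *: "cyc4 a b c d" "{a, c} \<in> T" "{b, d} \<in> T"
  then have **: "{c, a} \<in> T" "{d, b} \<in> T" by (simp_all add: insert_commute)
  consider "a < b" "b < c" "c < d" | "b < c" "c < d" "d < a" | "c < d" "d < a" "a < b" | "d < a" "a < b" "b < c"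
    using *(1) unfolding cyc4_def cyc_def by linarith
  then show False using T_no_crossing * ** by cases blast+
qed

section \<open>The quiver of the initial triangulation\<close>

definition snake_arrow :: "'v \<Rightarrow> 'v \<Rightarrow> bool" where
  "snake_arrow v w \<longleftrightarrow> (\<exists>i\<le>n. (v, w) \<in>
     (if d i then {(g (Suc i), g i), (g i, h i), (h i, g (Suc i))}
      else {(g i, g (Suc i)), (g (Suc i), h i), (h i, g i)}))"

lemma g_eq: "i \<le> Suc n \<Longrightarrow> j \<le> Suc n \<Longrightarrow> g i = g j \<longleftrightarrow> i = j"
  using inj_g by (auto simp: inj_on_def)

lemma h_eq: "i \<le> n \<Longrightarrow> j \<le> n \<Longrightarrow> h i = h j \<longleftrightarrow> i = j"
  using inj_h by (auto simp: inj_on_def)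

lemma g_neq_h: "i \<le> Suc n \<Longrightarrow> j \<le> n \<Longrightarrow> g i \<noteq> h j" "i \<le> Suc n \<Longrightarrow> j \<le> n \<Longrightarrow> h j \<noteq> g i"
  using disj_gh by blast+

lemma chord_eq_iff:
  assumes "v \<in> labels"
  shows "i \<le> Suc n \<Longrightarrow> chord v = gchord i \<longleftrightarrow> v = g i"
    and "i \<le> n \<Longrightarrow> chord v = hchord i \<longleftrightarrow> v = h i"
  using inj_on_eq_iff[OF inj_chord assms g_in_labels[of i]] inj_on_eq_iff[OF inj_chord assms h_in_labels[of i]]
  by (simp_all add: chord_g chord_h)

lemma bd_not_even: 
  assumes "C \<in> bd" shows "\<not> (\<forall>x\<in>C. even x)"
  using assms unfolding bd_def by (auto simp: hi_def)

lemma chord_even: "v \<in> labels \<Longrightarrow> x \<in> chord v \<Longrightarrow> even x"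
  by (erule labels_cases) (auto simp: chord_g chord_h gchord_def hchord_def split: if_splits)

lemma chord_not_bd: "v \<in> labels \<Longrightarrow> chord v \<notin> bd"
  using chord_even bd_not_even by blast

text \<open>It is enough to look at the arrows ending at \<open>chord w\<close>. They are read off
  from the quadrilateral around it, where polygon sides drop out because they carry no
  label.\<close>

lemma tri_arrow_chord:
  assumes v: "v \<in> labels" and w: "w \<in> labels"
  shows "tri_arrow T (chord v) (chord w) \<longleftrightarrow> snake_arrow v w"
proof -
  have vT: "chord v \<in> T" using v by (simp add: T_def)
  have nb: "chord v \<noteq> C" if "C \<in> bd" for C using chord_not_bd[OF v] that by auto
  from w show ?thesis
  proof (cases rule: labels_cases)
    case (g i)
    have "tri_arrow T (chord v) (chord w) \<longleftrightarrow> chord v = {2 * zz i, g_in i} \<or> chord v = {2 * oo i, g_out i}"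
      using tri_arrow_into[OF noncrossing_T g_quad(1) g_quad_T vT] g by (simp add: chord_g gchord_def)
    also have "chord v = {2 * zz i, g_in i} \<longleftrightarrow> (\<exists>j. i = Suc j \<and> v = (if d j then h j else g j))"
    proof (cases i)
      case 0
      have "{0, 1} \<in> bd" using bd_step[of 0] bounds[of 0] by simp
      then show ?thesis using 0 nb g_quad(2)[OF g(1)] by simp
    next
      case (Suc j)
      then show ?thesis unfolding g_quad(2)[OF g(1)]
        using g(1) by (cases "d j") (simp_all add: chord_eq_iff[OF v])
    qed
    also have "chord v = {2 * oo i, g_out i} \<longleftrightarrow> (i \<le> n \<and> v = (if d i then g (Suc i) else h i))"
    proof (cases "i = Suc n")
      case True
      have "{2 * oo i, 2 * oo i + 1} \<in> bd"
        using bounds[OF g(1)] zz_less_oo[of i] by (intro bd_step) auto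
      then show ?thesis using True nb unfolding g_quad(4)[OF g(1)] by simp
    next
      case False
      then show ?thesis unfolding g_quad(4)[OF g(1)]
        using g(1) by (cases "d i") (simp_all add: chord_eq_iff[OF v])
    qed
    also have "(\<exists>j. i = Suc j \<and> v = (if d j then h j else g j)) \<or> (i \<le> n \<and> v = (if d i then g (Suc i) else h i))
       \<longleftrightarrow> snake_arrow v w"
    proof
      assume "(\<exists>j. i = Suc j \<and> v = (if d j then h j else g j)) \<or> (i \<le> n \<and> v = (if d i then g (Suc i) else h i))"
      then show "snake_arrow v w"
      proof
        assume "\<exists>j. i = Suc j \<and> v = (if d j then h j else g j)"
        then obtain j where "i = Suc j" "v = (if d j then h j else g j)" by blast
        then show ?thesis using g unfolding snake_arrow_def by (intro exI[of _ j]) auto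
      next
        assume "i \<le> n \<and> v = (if d i then g (Suc i) else h i)"
        then show ?thesis using g unfolding snake_arrow_def by (intro exI[of _ i]) auto
      qed
    next
      assume "snake_arrow v w"
      then obtain j where "j \<le> n" "(v, g i) \<in> (if d j then {(g (Suc j), g j), (g j, h j), (h j, g (Suc j))}
           else {(g j, g (Suc j)), (g (Suc j), h j), (h j, g j)})"
        using g unfolding snake_arrow_def by blast
      then show "(\<exists>j. i = Suc j \<and> v = (if d j then h j else g j)) \<or> (i \<le> n \<and> v = (if d i then g (Suc i) else h i))"
        using g(1) by (auto simp: g_eq g_neq_h split: if_splits)
    qed
    finally show ?thesis .
  next
    case (h i)
    have "tri_arrow T (chord v) (chord w) \<longleftrightarrow> chord v = {h_base i, h_base i + 1} \<or> chord v = {h_base i + 2, h_opp i}"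
      using tri_arrow_into[OF noncrossing_T h_quad(1) h_quad_T vT] h h_quad(2)[of i] by (simp add: chord_h)
    also have "\<dots> \<longleftrightarrow> v = (if d i then g i else g (Suc i))"
      unfolding h_quad(5)[OF h(1)] using nb[OF h_quad(3)[OF h(1)]] chord_eq_iff[OF v] h by auto
    also have "\<dots> \<longleftrightarrow> snake_arrow v w"
    proof
      assume "v = (if d i then g i else g (Suc i))"
      then show "snake_arrow v w" using h unfolding snake_arrow_def by (intro exI[of _ i]) auto
    next
      assume "snake_arrow v w"
      then obtain j where "j \<le> n" "(v, h i) \<in> (if d j then {(g (Suc j), g j), (g j, h j), (h j, g (Suc j))}
           else {(g j, g (Suc j)), (g (Suc j), h j), (h j, g j)})"
        using h unfolding snake_arrow_def by blast
      then show "v = (if d i then g i else g (Suc i))"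
        using h(1) by (auto simp: h_eq g_neq_h split: if_splits)
    qed
    finally show ?thesis .
  qed
qed

end

section \<open>Denominators of the cluster variables\<close>

lemma prod_var_monomial:
  assumes "finite N" "\<And>v. v \<in> N \<Longrightarrow> d v \<ge> 0"
  shows "\<exists>m. (\<Prod>v\<in>N. var v powi d v) = Fract (monomial m) 1 \<and> (\<forall>v\<in>N. Poly_Mapping.lookup m v = nat (d v))
    \<and> (\<forall>v. v \<notin> N \<longrightarrow> Poly_Mapping.lookup m v = 0)"
  using assms
proof (induction N)
  case empty
  then show ?case by (intro exI[of _ 0]) (simp add: One_fract_def)
next
  case (insert w N)
  then obtain m where m: "(\<Prod>v\<in>N. var v powi d v) = Fract (monomial m) 1"
    "\<And>v. v \<in> N \<Longrightarrow> Poly_Mapping.lookup m v = nat (d v)" "\<And>v. v \<notin> N \<Longrightarrow> Poly_Mapping.lookup m v = 0"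
    by auto
  have pow: "var w ^ k = Fract (monomial (Poly_Mapping.single w k)) 1" for k
  proof (induction k)
    case (Suc k)
    have "Poly_Mapping.single w (Suc k) = Poly_Mapping.single w 1 + Poly_Mapping.single w k"
      by (simp flip: single_add)
    then show ?case using Suc by (simp add: var_def pvar_def mult_single)
  qed (simp add: One_fract_def)
  have "var w powi d w = var w ^ nat (d w)"
    using insert.prems by (simp add: power_int_def)
  then have "(\<Prod>v\<in>insert w N. var v powi d v) = Fract (monomial (Poly_Mapping.single w (nat (d w)) + m)) 1"
    using insert.hyps m(1) pow by (simp add: mult_single)
  then show ?case
    using insert.hyps m by (intro exI[of _ "Poly_Mapping.single w (nat (d w)) + m"])
      (auto simp: lookup_add lookup_single when_def)
qed

lemma has_dvector_monomial:
  assumes "finite N" "\<And>v. v \<in> N \<Longrightarrow> d v \<ge> 0" "has_dvector N z d"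
  obtains P m where "z = Fract P (monomial m)" "\<And>v. v \<in> N \<Longrightarrow> \<not> pvar v dvd P"
    "\<And>v. v \<in> N \<Longrightarrow> Poly_Mapping.lookup m v = nat (d v)"
proof -
  obtain m where m: "(\<Prod>v\<in>N. var v powi d v) = Fract (monomial m) 1"
    "\<And>v. v \<in> N \<Longrightarrow> Poly_Mapping.lookup m v = nat (d v)"
    using prod_var_monomial[of N d, OF assms(1,2)] by blast
  obtain P where "\<And>v. v \<in> N \<Longrightarrow> \<not> pvar v dvd P" "z = Fract P 1 / Fract (monomial m) 1"
    using assms(3) m(1) unfolding has_dvector_def by auto
  then show thesis using that[of P m] m(2) by simp
qed

text \<open>Clearing denominators equates a \<open>g\<close>-free monomial multiple of the numerator
  \<open>P\<close> with a multiple of \<open>pvar g\<close>, so \<open>P\<close> would not be in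
  lowest terms.\<close>

lemma not_dvector_if_no_pole:
  assumes "finite N" "\<And>v. v \<in> N \<Longrightarrow> d v \<ge> 0" "g \<in> N" "d g > 0" "z \<in> laurent_nonneg g"
  shows "\<not> has_dvector N z d"
proof
  assume "has_dvector N z d"
  then obtain P m where P': "z = Fract P (monomial m)" "\<And>v. v \<in> N \<Longrightarrow> \<not> pvar v dvd P"
    "\<And>v. v \<in> N \<Longrightarrow> Poly_Mapping.lookup m v = nat (d v)"
    using has_dvector_monomial[of N d z, OF assms(1,2)] by blast
  note P = P'(1) P'(2,3)[OF assms(3)]
  obtain F k where F: "z = Fract F (monomial k)" "Poly_Mapping.lookup k g = 0"
    using assms(5) by (auto simp: laurent_nonneg_def)
  have "P * monomial k = F * monomial m" using P(1) F(1) by (simp add: eq_fract)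
  moreover have "pvar g dvd monomial m" using P(3) assms(4) by (simp add: pvar_dvd_iff)
  ultimately have "pvar g dvd P * monomial k" by simp
  then show False using pvar_dvd_mult_monomial F(2) P(2) by blast
qed

text \<open>After multiplication by \<open>var g\<close> the value at \<open>g = 0\<close> is finite
  and nonzero, so there is a simple pole; exponent 0 would make that product vanish there.\<close>

lemma not_dvector_if_pole:
  assumes "finite N" "\<And>v. v \<in> N \<Longrightarrow> d v \<ge> 0" "g \<in> N" "d g = 0" "z * var g \<in> laurent_pos g"
  shows "\<not> has_dvector N z d"
proof
  assume "has_dvector N z d"
  then obtain P m where P': "z = Fract P (monomial m)"
    "\<And>v. v \<in> N \<Longrightarrow> Poly_Mapping.lookup m v = nat (d v)"
    using has_dvector_monomial[of N d z, OF assms(1,2)] by blast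
  note P = P'(1) P'(2)[OF assms(3)]
  obtain F k where F: "z * var g = Fract F (monomial k)" "pos_poly g F"
    using assms(5) by (auto simp: laurent_pos_def)
  have "P * pvar g * monomial k = F * monomial m"
    using P(1) F(1) by (simp add: var_def eq_fract)
  then have "pvar g dvd F * monomial m" by (metis dvd_mult2 dvd_triv_right)
  then show False using pvar_dvd_mult_monomial[of g F m] P(2) assms(4) F(2) pos_poly_not_dvd by auto
qed

section \<open>Propagation of positivity from vertex to vertex\<close>

context snake
begin

definition good :: "'v ratfun set \<Rightarrow> int set \<Rightarrow> bool" where
  "good P S \<longleftrightarrow> (\<forall>p\<in>S. \<forall>q\<in>S. p \<noteq> q \<longrightarrow> X {p, q} \<in> P)"

lemma X_ptolemy: "cyc4 a b c d' \<Longrightarrow> X {a, c} * X {b, d'} = X {a, b} * X {c, d'} + X {b, c} * X {d', a}"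
  unfolding X_def by (rule chord_det_ptolemy)

lemma X_commute: "X {p, q} = X {q, p}"
  by (rule arg_cong[of _ _ X]) auto

text \<open>Solves the Ptolemy relation of \<open>a\<close>, \<open>p\<close>, \<open>b\<close>,
  \<open>t\<close> for the chord from \<open>t\<close> to \<open>p\<close>. Only the separating
  chord \<open>{a, b}\<close> is inverted, and this decides where poles may occur.\<close>

lemma good_insert:
  assumes P: "semiring_closed P" and S: "good P S" "a \<in> S" "b \<in> S" "a \<noteq> b"
    and ab: "X {a, b} \<noteq> 0" "inverse (X {a, b}) \<in> P" and t: "X {t, a} \<in> P" "X {t, b} \<in> P"
    and cross: "\<And>p. p \<in> S \<Longrightarrow> p \<noteq> a \<Longrightarrow> p \<noteq> b \<Longrightarrow> p \<noteq> t \<Longrightarrow> cyc4 a p b t \<or> cyc4 b p a t"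
  shows "good P (insert t S)"
proof -
  have one: "X {p, t} \<in> P" if p: "p \<in> S" "p \<noteq> t" for p
  proof -
    consider "p = a" | "p = b" | "p \<noteq> a" "p \<noteq> b" by blast
    then show ?thesis
    proof cases
      case 3
      have XP: "X {a, p} \<in> P" "X {b, p} \<in> P" using S p 3 by (auto simp: good_def)
      have "X {a, b} * X {p, t} = X {a, p} * X {t, b} + X {b, p} * X {t, a}"
        using cross[OF p(1) 3 p(2)] X_ptolemy[of a p b t] X_ptolemy[of b p a t]
        by (auto simp only: X_commute[of b t] X_commute[of p b] X_commute[of b a] X_commute[of a t]
          X_commute[of p a] add.commute)
      then have "X {p, t} = (X {a, p} * X {t, b} + X {b, p} * X {t, a}) * inverse (X {a, b})"
        using ab(1) by (simp add: field_simps)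
      then show ?thesis using P XP t ab(2) by (simp add: semiring_closed_def)
    qed (use t in \<open>simp_all add: X_commute[of a t] X_commute[of b t]\<close>)
  qed
  have two: "X {t, p} \<in> P" if "p \<in> S" "p \<noteq> t" for p
    using one[OF that] by (simp add: X_commute[of t p])
  show ?thesis using S(1) one two unfolding good_def by auto
qed

text \<open>Attaching \<open>tip k\<close> inverts only \<open>var (g k)\<close>, so growing from
  stage \<open>i\<close> to stage \<open>j\<close> inverts no diagonals but those with index in
  \<open>{i..<j}\<close>.\<close>

lemma good_inner:
  assumes P: "semiring_closed P" and ij: "i \<le> j" "j \<le> Suc n"
    and S: "good P ((*) 2 ` S)" "zz i \<in> S" "oo i \<in> S" "S \<subseteq> {zz i..oo i}"
    and k: "\<And>k. i \<le> k \<Longrightarrow> k < j \<Longrightarrow> inverse (var (g k)) \<in> P \<and> var (g (Suc k)) \<in> P \<and> var (h k) \<in> P"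
  shows "good P ((*) 2 ` (S \<union> {zz j..<zz i} \<union> {oo i<..oo j}))"
  using ij k
proof (induction j rule: dec_induct)
  case base
  then show ?case using S by simp
next
  case (step k)
  let ?S = "S \<union> {zz k..<zz i} \<union> {oo i<..oo k}"
  have m: "zz k \<le> zz i" "oo i \<le> oo k" using step.hyps zz_mono oo_mono by auto
  have zo: "zz k \<in> ?S" "oo k \<in> ?S"
    using S(2,3) m by (auto simp: le_less)
  have "S \<union> {zz (Suc k)..<zz i} \<union> {oo i<..oo (Suc k)} = insert (tip k) ?S"
    using m by (auto simp: tip_def)
  moreover have "good P (insert (2 * tip k) ((*) 2 ` ?S))"
  proof (rule good_insert[OF P])
    show "good P ((*) 2 ` ?S)" using step by simp
    show "2 * zz k \<in> (*) 2 ` ?S" "2 * oo k \<in> (*) 2 ` ?S"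
      using zo by (auto intro!: imageI)
    show "2 * zz k \<noteq> 2 * oo k" using zz_less_oo[of k] by simp
    have kn: "k \<le> n" using step by simp
    have "X {2 * zz k, 2 * oo k} = var (g k)"
      using X_gchord[of k] kn by (simp add: gchord_def)
    then show "X {2 * zz k, 2 * oo k} \<noteq> 0" "inverse (X {2 * zz k, 2 * oo k}) \<in> P"
      using step.prems step.hyps by auto
    have *: "{2 * oo k, 2 * tip k} = (if d k then gchord (Suc k) else hchord k)"
        "{2 * tip k, 2 * zz k} = (if d k then hchord k else gchord (Suc k))"
      using g_quad(4,5)[of k] kn by (auto simp: g_out_def)
    then show "X {2 * tip k, 2 * zz k} \<in> P" "X {2 * tip k, 2 * oo k} \<in> P"
      using X_gchord[of "Suc k"] X_hchord[OF kn] step.prems(2)[of k] step.hyps kn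
      by (auto simp: X_commute[of "2 * tip k" "2 * oo k"])
    fix p assume "p \<in> (*) 2 ` ?S" "p \<noteq> 2 * zz k" "p \<noteq> 2 * oo k" "p \<noteq> 2 * tip k"
    then have "2 * zz k < p" "p < 2 * oo k" using S(4) m zz_less_oo[of i] by auto
    then have "cyc4 (2 * zz k) p (2 * oo k) (2 * tip k)"
      by (auto simp: cyc4_def cyc_def tip_def)
    then show "cyc4 (2 * zz k) p (2 * oo k) (2 * tip k) \<or> cyc4 (2 * oo k) p (2 * zz k) (2 * tip k)" by blast
  qed
  ultimately show ?case by simp
qed

text \<open>Cyclic successor, so that the ear at \<open>hi\<close>, with base
  \<open>{hi - 1, lo}\<close>, is treated like the others.\<close>

definition nxt :: "int \<Rightarrow> int" where
  "nxt q = (if q = hi then lo else q + 1)"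

lemma lo_less_hi: "lo < hi"
  using bounds[of 0] by simp

lemma even_lo: "even lo" and odd_hi: "odd hi"
  by (auto simp: lo_def hi_def)

lemma g_end_not_inner:
  assumes "i = 0 \<or> i = Suc n" shows "g i \<notin> g ` {1..n}"
proof
  assume "g i \<in> g ` {1..n}"
  then obtain j where "j \<in> {1..n}" "g i = g j" by blast
  then show False using assms g_eq[of i j] by auto
qed

lemma ear_label:
  assumes "odd q" "lo \<le> q" "q \<le> hi"
  obtains v where "v \<in> labels" "v \<notin> g ` {1..n}" "{q - 1, nxt q} = chord v"
proof (cases "q = hi")
  case True
  then have "{q - 1, nxt q} = gchord (Suc n)" by (auto simp: nxt_def gchord_def hi_def lo_def)
  then show thesis using that[of "g (Suc n)"] g_in_labels[of "Suc n"] chord_g[of "Suc n"] g_end_not_inner[of "Suc n"] by simp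
next
  case False
  from assms(1) obtain p where q: "q = 2 * p + 1" by (elim oddE)
  then have p: "zz (Suc n) \<le> p" "p < oo (Suc n)" using assms False by (auto simp: lo_def hi_def)
  have e: "{q - 1, nxt q} = {2 * p, 2 * p + 2}" using False by (simp add: nxt_def q add.commute)
  from boundary_chord[OF p] show thesis
  proof
    assume "{2 * p, 2 * p + 2} = gchord 0"
    then show thesis using that[of "g 0"] g_in_labels[of 0] chord_g[of 0] g_end_not_inner[of 0] e by simp
  next
    assume "\<exists>j\<le>n. {2 * p, 2 * p + 2} = hchord j"
    then obtain j where j: "j \<le> n" "{2 * p, 2 * p + 2} = hchord j" by blast
    moreover have "h j \<notin> g ` {1..n}"
    proof
      assume "h j \<in> g ` {1..n}"
      then obtain i where "i \<in> {1..n}" "h j = g i" by blast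
      then show False using g_neq_h(2)[of i j] j(1) by simp
    qed
    ultimately show thesis using that[of "h j"] h_in_labels[of j] chord_h[of j] e by auto
  qed
qed

lemma X_chord: "v \<in> labels \<Longrightarrow> X (chord v) = var v"
  by (erule labels_cases) (simp_all add: chord_g chord_h X_gchord X_hchord)

text \<open>An ear tip is attached along its base, so only the label of the base is inverted; the
  two sides of the ear have value 1.\<close>

lemma good_ears:
  assumes P: "semiring_closed P" "1 \<in> P" and S: "good P S" "S \<subseteq> {lo..hi}"
    and E: "finite E" "E \<subseteq> {lo..hi}" "\<And>q. q \<in> E \<Longrightarrow> odd q"
    and nb: "\<And>q. q \<in> E \<Longrightarrow> q - 1 \<in> S \<and> nxt q \<in> S"
    and inv: "\<And>q v. q \<in> E \<Longrightarrow> v \<in> labels \<Longrightarrow> v \<notin> g ` {1..n} \<Longrightarrow> {q - 1, nxt q} = chord v \<Longrightarrow> inverse (var v) \<in> P"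
  shows "good P (S \<union> E)"
  using E nb inv
proof (induction E)
  case empty
  then show ?case using S by simp
next
  case (insert q E)
  have q: "odd q" "lo \<le> q" "q \<le> hi" using insert.prems by auto
  have qlo: "lo < q" using q even_lo by (cases "q = lo") auto
  obtain v where v: "v \<in> labels" "v \<notin> g ` {1..n}" "{q - 1, nxt q} = chord v"
    using ear_label[OF q] by blast
  have "good P (insert q (S \<union> E))"
  proof (rule good_insert[OF P(1)])
    show "good P (S \<union> E)"
      by (rule insert.IH) (use insert.prems in blast)+
    show "q - 1 \<in> S \<union> E" "nxt q \<in> S \<union> E" using insert.prems(3)[of q] by auto
    show "q - 1 \<noteq> nxt q" using zz_less_oo[of "Suc n"] unfolding nxt_def hi_def lo_def by presburger
    show "X {q - 1, nxt q} \<noteq> 0" "inverse (X {q - 1, nxt q}) \<in> P"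
      using v X_chord[of v] insert.prems(4)[of q v] by auto
    have "{q - 1, q} \<in> bd" using bd_step[of "q - 1"] q qlo by simp
    moreover have "{q, q - 1} = {q - 1, q}" by auto
    ultimately show "X {q, q - 1} \<in> P" using X_bd P(2) by simp
    have "{q, nxt q} \<in> bd"
    proof (cases "q = hi")
      case True
      then have "{q, nxt q} = {lo, hi}" by (auto simp: nxt_def)
      then show ?thesis using bd_wrap by simp
    qed (use bd_step[of q] q in \<open>simp add: nxt_def\<close>)
    then show "X {q, nxt q} \<in> P" using X_bd P(2) by simp
    fix p assume p: "p \<in> S \<union> E" "p \<noteq> q - 1" "p \<noteq> nxt q" "p \<noteq> q"
    then have "lo \<le> p" "p \<le> hi" using p(1) S(2) insert.prems(1) by auto
    then have "cyc4 (nxt q) p (q - 1) q"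
      using p(2-4) q(2,3) qlo unfolding nxt_def cyc4_def cyc_def by smt
    then show "cyc4 (q - 1) p (nxt q) q \<or> cyc4 (nxt q) p (q - 1) q" by blast
  qed
  then show ?case by simp
qed

end

text \<open>A spare variable \<open>x\<close> is never inverted, so all chord values lie in
  \<open>laurent_pos x\<close> and hence are nonzero; see \<open>X_neq_0\<close>.\<close>

locale snake_triangulation = snake n d g h
  for n d and g h :: "nat \<Rightarrow> 'v::linorder" +
  assumes extra: "\<exists>x. x \<notin> g ` {..Suc n} \<union> h ` {..n}"
begin

lemmas d_ends [simp] = d0 dn

lemma finite_labels: "finite labels"
  by (simp add: labels_def)

lemma g_neq: "i \<le> Suc n \<Longrightarrow> j \<le> Suc n \<Longrightarrow> i \<noteq> j \<Longrightarrow> g i \<noteq> g j"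
  by (simp add: g_eq)

lemma h_not_g: "j \<le> n \<Longrightarrow> i \<le> Suc n \<Longrightarrow> h j \<noteq> g i"
  using g_neq_h by metis

lemma good_subset: "good P S \<Longrightarrow> S' \<subseteq> S \<Longrightarrow> good P S'"
  by (auto simp: good_def)

lemma not_inner_neq_g: "v \<notin> g ` {1..n} \<Longrightarrow> 1 \<le> i \<Longrightarrow> i \<le> n \<Longrightarrow> v \<noteq> g i"
  by auto

lemma X_g: "i \<le> Suc n \<Longrightarrow> X {2 * zz i, 2 * oo i} = var (g i)"
  using X_gchord[of i] by (simp add: gchord_def)

text \<open>The vertices -1, 0, 1 are those cut off by \<open>g 1\<close>. Starting from the
  triangle on the far side of \<open>g 1\<close> and continuing from stage 2, neither
  \<open>g 0\<close> nor \<open>h 0\<close> occurs and \<open>g 1\<close> is never inverted.\<close>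

lemma good_far:
  assumes P: "semiring_closed P" "1 \<in> P"
    and v: "\<And>v. v \<in> labels - {g 0, h 0} \<Longrightarrow> var v \<in> P"
    and iv: "\<And>v. v \<in> labels - {g 0, h 0, g 1} \<Longrightarrow> inverse (var v) \<in> P"
  shows "good P ({lo..hi} - {-1, 0, 1})"
proof -
  have 1: "X {-2, 2} = var (g 1)" using X_g[of 1] n2 by simp
  have 2: "X {2 * tip 1, -2} \<in> P \<and> X {2 * tip 1, 2} \<in> P"
  proof -
    have q: "{2 * oo 1, 2 * tip 1} = (if d 1 then gchord 2 else hchord 1)"
        "{2 * tip 1, 2 * zz 1} = (if d 1 then hchord 1 else gchord 2)"
      using g_quad(4,5)[of 1] n2 by (auto simp: g_out_def numeral_2_eq_2)
    have "var (g 2) \<in> P" "var (h 1) \<in> P"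
      using v g_in_labels[of 2] h_in_labels[of 1] n2 g_neq[of 2 0] h_not_g[of 1 0] h_not_g[of 0 2] h_eq[of 1 0] by auto
    then show ?thesis
      using q X_gchord[of 2] X_hchord[of 1] n2 X_commute[of "2 * oo 1" "2 * tip 1"] by (cases "d 1") auto
  qed
  have base: "good P ((*) 2 ` {-1, 1, tip 1})"
  proof -
    have "var (g 1) \<in> P"
      using v[of "g 1"] g_in_labels[of 1] n2 g_neq[of 1 0] h_not_g[of 0 1] by auto
    then show ?thesis using 1 2 X_commute[of "2 * tip 1"] X_commute[of 2 "-2"] by (auto simp: good_def)
  qed
  have 2: "zz 2 = zz 1 - of_bool (d 1)" "oo 2 = oo 1 + of_bool (\<not> d 1)"
    by (simp_all add: numeral_2_eq_2)
  have "good P ((*) 2 ` ({-1, 1, tip 1} \<union> {zz (Suc n)..<zz 2} \<union> {oo 2<..oo (Suc n)}))"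
  proof (rule good_inner[OF P(1)])
    show "zz 2 \<in> {-1, 1, tip 1}" "oo 2 \<in> {-1, 1, tip 1}" "{-1, 1, tip 1} \<subseteq> {zz 2..oo 2}"
      unfolding 2 by (auto simp: tip_def)
    fix k assume k: "2 \<le> k" "k < Suc n"
    show "inverse (var (g k)) \<in> P \<and> var (g (Suc k)) \<in> P \<and> var (h k) \<in> P"
      using k v[of "g (Suc k)"] v[of "h k"] iv[of "g k"] g_in_labels[of k] g_in_labels[of "Suc k"] h_in_labels[of k]
        g_neq[of k 0] g_neq[of k 1] g_neq[of "Suc k" 0] h_not_g[of 0 k] h_not_g[of 0 "Suc k"] h_not_g[of k 0]
        h_eq[of k 0] by auto
  qed (use n2 base in auto)
  moreover have "{-1, 1, tip 1} \<union> {zz (Suc n)..<zz 2} \<union> {oo 2<..oo (Suc n)} = {zz (Suc n)..oo (Suc n)} - {0}"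
    using zz_mono[of 2 "Suc n"] oo_mono[of 2 "Suc n"] n2 unfolding 2 by (auto simp: tip_def split: if_splits)
  ultimately have inner: "good P ((*) 2 ` ({zz (Suc n)..oo (Suc n)} - {0}))" by (simp only:)
  let ?E = "{q \<in> {lo..hi} - {-1, 1}. odd q}"
  have "good P ((*) 2 ` ({zz (Suc n)..oo (Suc n)} - {0}) \<union> ?E)"
  proof (rule good_ears[OF P inner])
    show "(*) 2 ` ({zz (Suc n)..oo (Suc n)} - {0}) \<subseteq> {lo..hi}" by (auto simp: lo_def hi_def)
    show "finite ?E" by (rule finite_subset[of _ "{lo..hi}"]) auto
    fix q assume q: "q \<in> ?E"
    then obtain p where p: "q = 2 * p + 1" by (auto elim: oddE)
    have "zz (Suc n) \<le> p" "p \<le> oo (Suc n)" "p \<noteq> 0" "p \<noteq> -1" using q p by (auto simp: lo_def hi_def)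
    moreover define r where "r = (if p = oo (Suc n) then zz (Suc n) else p + 1)"
    ultimately have "p \<in> {zz (Suc n)..oo (Suc n)} - {0}" "r \<in> {zz (Suc n)..oo (Suc n)} - {0}"
      using zz_less_oo[of "Suc n"] zz_mono[of 1 "Suc n"] by (auto simp del: zz_Suc_n oo_Suc_n oo_Suc zz.simps(2))
    then have "2 * p \<in> (*) 2 ` ({zz (Suc n)..oo (Suc n)} - {0})" "2 * r \<in> (*) 2 ` ({zz (Suc n)..oo (Suc n)} - {0})"
      by blast+
    moreover have "q - 1 = 2 * p" "nxt q = 2 * r" using p by (auto simp: r_def nxt_def hi_def lo_def)
    ultimately show "q - 1 \<in> (*) 2 ` ({zz (Suc n)..oo (Suc n)} - {0}) \<and> nxt q \<in> (*) 2 ` ({zz (Suc n)..oo (Suc n)} - {0})"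
      by simp
    fix w assume w: "w \<in> labels" "w \<notin> g ` {1..n}" "{q - 1, nxt q} = chord w"
    have "w \<noteq> g 1" using not_inner_neq_g[OF w(2), of 1] n2 by simp
    moreover have "w \<noteq> g 0"
    proof
      assume "w = g 0"
      then have "{q - 1, nxt q} = {0, 2}" using w(3) chord_g[of 0] by (simp add: gchord_def)
      then have "q = 1" using q lo_less_hi bounds[of 1] by (auto simp: doubleton_eq_iff nxt_def split: if_splits)
      then show False using q by simp
    qed
    moreover have "w \<noteq> h 0"
    proof
      assume "w = h 0"
      then have "{q - 1, nxt q} = {-2, 0}" using w(3) chord_h[of 0] d0 by (simp add: hchord_def)
      then have "q = -1" using q lo_less_hi bounds[of 1] by (auto simp: doubleton_eq_iff nxt_def split: if_splits)
      then show False using q by simp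
    qed
    ultimately show "inverse (var w) \<in> P" using iv w(1) by blast
  qed auto
  moreover have "{lo..hi} - {-1, 0, 1} \<subseteq> (*) 2 ` ({zz (Suc n)..oo (Suc n)} - {0}) \<union> ?E"
  proof
    fix q assume q: "q \<in> {lo..hi} - {-1, 0, 1}"
    show "q \<in> (*) 2 ` ({zz (Suc n)..oo (Suc n)} - {0}) \<union> ?E"
    proof (cases "even q")
      case True
      then obtain p where "q = 2 * p" by (elim evenE)
      then show ?thesis using q by (auto simp: lo_def hi_def)
    qed (use q in auto)
  qed
  ultimately show ?thesis by (rule good_subset)
qed

text \<open>The counterpart of \<open>good_far\<close> at the other end: growth stops at stage
  \<open>n\<close>, leaving out \<open>lo\<close>, \<open>lo + 1\<close> and \<open>hi\<close>, so
  \<open>g n\<close> is not inverted and \<open>g (Suc n)\<close>, \<open>h n\<close> do not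
  occur.\<close>

lemma good_near:
  assumes P: "semiring_closed P" "1 \<in> P"
    and v: "\<And>v. v \<in> labels - {g (Suc n), h n} \<Longrightarrow> var v \<in> P"
    and iv: "\<And>v. v \<in> labels - {g (Suc n), h n, g n} \<Longrightarrow> inverse (var v) \<in> P"
  shows "good P {2 * zz n..2 * oo n}"
proof -
  have "X {0, 2} = var (g 0)" using X_g[of 0] by simp
  moreover have "var (g 0) \<in> P"
    using v[of "g 0"] g_in_labels[of 0] g_neq[of 0 "Suc n"] h_not_g[of n 0] by auto
  ultimately have base: "good P ((*) 2 ` {0, 1})"
    using X_commute[of 2 0] by (auto simp: good_def)
  have "good P ((*) 2 ` ({0, 1} \<union> {zz n..<zz 0} \<union> {oo 0<..oo n}))"
  proof (rule good_inner[OF P(1)])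
    fix k assume k: "0 \<le> k" "k < n"
    show "inverse (var (g k)) \<in> P \<and> var (g (Suc k)) \<in> P \<and> var (h k) \<in> P"
      using k v[of "g (Suc k)"] v[of "h k"] iv[of "g k"] g_in_labels[of k] g_in_labels[of "Suc k"] h_in_labels[of k]
        g_neq[of k n] g_neq[of k "Suc n"] g_neq[of "Suc k" "Suc n"] h_not_g[of n k] h_not_g[of n "Suc k"]
        h_not_g[of k "Suc n"] h_eq[of k n] by auto
  qed (use base in auto)
  moreover have "{0, 1} \<union> {zz n..<zz 0} \<union> {oo 0<..oo n} = {zz n..oo n}"
    using zz_le_0[of n] oo_ge_1[of n] by auto
  ultimately have inner: "good P ((*) 2 ` {zz n..oo n})" by (simp only:)
  let ?E = "{q \<in> {2 * zz n..2 * oo n}. odd q}"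
  have b: "2 * zz n - 2 = lo" "2 * oo n + 1 = hi" by (simp_all add: lo_def hi_def)
  have "good P ((*) 2 ` {zz n..oo n} \<union> ?E)"
  proof (rule good_ears[OF P inner])
    show "(*) 2 ` {zz n..oo n} \<subseteq> {lo..hi}" "?E \<subseteq> {lo..hi}" using b by auto
    show "finite ?E" by (rule finite_subset[of _ "{2 * zz n..2 * oo n}"]) auto
    fix q assume q: "q \<in> ?E"
    then obtain p where p: "q = 2 * p + 1" by (auto elim: oddE)
    have "zz n \<le> p" "p < oo n" using q p by auto
    then have "q \<noteq> hi" "p \<in> {zz n..oo n}" "p + 1 \<in> {zz n..oo n}" using p b by auto
    then have "2 * p \<in> (*) 2 ` {zz n..oo n}" "2 * (p + 1) \<in> (*) 2 ` {zz n..oo n}" by blast+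
    moreover have nq: "nxt q = q + 1" using \<open>q \<noteq> hi\<close> by (simp add: nxt_def)
    ultimately show "q - 1 \<in> (*) 2 ` {zz n..oo n} \<and> nxt q \<in> (*) 2 ` {zz n..oo n}"
      using p by (simp add: algebra_simps)
    fix w assume w: "w \<in> labels" "w \<notin> g ` {1..n}" "{q - 1, nxt q} = chord w"
    have "w \<noteq> g n" using not_inner_neq_g[OF w(2), of n] n2 by simp
    moreover have "w \<noteq> g (Suc n)"
    proof
      assume "w = g (Suc n)"
      then have "{q - 1, q + 1} = {lo, 2 * oo n}" using w(3) nq chord_g[of "Suc n"] by (simp add: gchord_def lo_def)
      then show False using q b zz_less_oo[of n] by (auto simp: doubleton_eq_iff)
    qed
    moreover have "w \<noteq> h n"
    proof
      assume "w = h n"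
      then have "{q - 1, q + 1} = {lo, lo + 2}" using w(3) nq chord_h[of n] dn by (simp add: hchord_def lo_def)
      then show False using q b by (auto simp: doubleton_eq_iff)
    qed
    ultimately show "inverse (var w) \<in> P" using iv w(1) by blast
  qed auto
  moreover have "{2 * zz n..2 * oo n} \<subseteq> (*) 2 ` {zz n..oo n} \<union> ?E"
  proof
    fix q assume q: "q \<in> {2 * zz n..2 * oo n}"
    show "q \<in> (*) 2 ` {zz n..oo n} \<union> ?E"
    proof (cases "even q")
      case True
      then obtain p where "q = 2 * p" by (elim evenE)
      then show ?thesis using q by auto
    qed (use q in auto)
  qed
  ultimately show ?thesis by (rule good_subset)
qed

text \<open>Labels in \<open>R\<close> are not inner diagonals, so they could be inverted only as
  bases of ears; this does not happen as long as no ear tip above them belongs to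
  \<open>A\<close>.\<close>

lemma good_all:
  assumes P: "semiring_closed P" "1 \<in> P"
    and v: "\<And>v. v \<in> labels \<Longrightarrow> var v \<in> P"
    and iv: "\<And>v. v \<in> labels \<Longrightarrow> v \<notin> R \<Longrightarrow> inverse (var v) \<in> P"
    and R: "R \<inter> g ` {1..n} = {}"
    and A: "A \<subseteq> {lo..hi}" "\<And>q v. q \<in> A \<Longrightarrow> odd q \<Longrightarrow> v \<in> R \<Longrightarrow> v \<in> labels \<Longrightarrow> {q - 1, nxt q} \<noteq> chord v"
  shows "good P A"
proof -
  have "X {0, 2} = var (g 0)" "X {-2, 2} = var (g 1)" "X {-2, 0} = var (h 0)"
    using X_g[of 0] X_g[of 1] X_hchord[of 0] n2 d0 by (simp_all add: hchord_def)
  moreover have "var (g 0) \<in> P" "var (g 1) \<in> P" "var (h 0) \<in> P"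
    using v g_in_labels h_in_labels n2 by auto
  ultimately have base: "good P ((*) 2 ` {-1, 0, 1})"
    using X_commute[of 2 0] X_commute[of 2 "-2"] X_commute[of 0 "-2"] by (auto simp: good_def)
  have "good P ((*) 2 ` ({-1, 0, 1} \<union> {zz (Suc n)..<zz 1} \<union> {oo 1<..oo (Suc n)}))"
  proof (rule good_inner[OF P(1)])
    fix k assume k: "1 \<le> k" "k < Suc n"
    then have "g k \<notin> R" using R by auto
    then show "inverse (var (g k)) \<in> P \<and> var (g (Suc k)) \<in> P \<and> var (h k) \<in> P"
      using k v[of "g (Suc k)"] v[of "h k"] iv[of "g k"] g_in_labels[of k] g_in_labels[of "Suc k"] h_in_labels[of k]
      by auto
  qed (use base in auto)
  moreover have "{-1, 0, 1} \<union> {zz (Suc n)..<zz 1} \<union> {oo 1<..oo (Suc n)} = {zz (Suc n)..oo (Suc n)}"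
    using zz_mono[of 1 "Suc n"] oo_mono[of 1 "Suc n"] by auto
  ultimately have inner: "good P ((*) 2 ` {zz (Suc n)..oo (Suc n)})" by (simp only:)
  let ?E = "{q \<in> A. odd q}"
  have "good P ((*) 2 ` {zz (Suc n)..oo (Suc n)} \<union> ?E)"
  proof (rule good_ears[OF P inner])
    show "(*) 2 ` {zz (Suc n)..oo (Suc n)} \<subseteq> {lo..hi}" by (auto simp: lo_def hi_def)
    show "finite ?E" "?E \<subseteq> {lo..hi}" using A(1) by (auto intro: finite_subset)
    fix q assume q: "q \<in> ?E"
    then obtain p where p: "q = 2 * p + 1" by (auto elim: oddE)
    have "lo \<le> q" "q \<le> hi" using q A(1) by auto
    then have "zz (Suc n) \<le> p" "p \<le> oo (Suc n)" using p by (auto simp: lo_def hi_def)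
    moreover define r where "r = (if p = oo (Suc n) then zz (Suc n) else p + 1)"
    ultimately have "p \<in> {zz (Suc n)..oo (Suc n)}" "r \<in> {zz (Suc n)..oo (Suc n)}"
      using zz_less_oo[of "Suc n"] by (auto simp del: zz_Suc_n oo_Suc_n oo_Suc zz.simps(2))
    then have "2 * p \<in> (*) 2 ` {zz (Suc n)..oo (Suc n)}" "2 * r \<in> (*) 2 ` {zz (Suc n)..oo (Suc n)}" by blast+
    moreover have "q - 1 = 2 * p" "nxt q = 2 * r" using p by (auto simp: r_def nxt_def hi_def lo_def)
    ultimately show "q - 1 \<in> (*) 2 ` {zz (Suc n)..oo (Suc n)} \<and> nxt q \<in> (*) 2 ` {zz (Suc n)..oo (Suc n)}"
      by simp
    fix w assume w: "w \<in> labels" "w \<notin> g ` {1..n}" "{q - 1, nxt q} = chord w"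
    then show "inverse (var w) \<in> P" using iv A(2)[of q w] q by blast
  qed auto
  moreover have "A \<subseteq> (*) 2 ` {zz (Suc n)..oo (Suc n)} \<union> ?E"
  proof
    fix q assume q: "q \<in> A"
    show "q \<in> (*) 2 ` {zz (Suc n)..oo (Suc n)} \<union> ?E"
    proof (cases "even q")
      case True
      then obtain p where "q = 2 * p" by (elim evenE)
      then show ?thesis using q A(1) by (auto simp: lo_def hi_def)
    qed (use q in auto)
  qed
  ultimately show ?thesis by (rule good_subset)
qed

lemma X_neq_0:
  assumes "p \<in> {lo..hi}" "q \<in> {lo..hi}" "p \<noteq> q"
  shows "X {p, q} \<noteq> 0"
proof -
  obtain x where x: "x \<notin> labels" using extra by (auto simp: labels_def)
  have "good (laurent_pos x) {lo..hi}"
    using x by (intro good_all[where R = "{}"] laurent_pos_closed laurent_pos_1)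
      (auto intro: laurent_pos_var laurent_pos_inverse_var)
  then have "X {p, q} \<in> laurent_pos x" using assms unfolding good_def by blast
  then show ?thesis by (rule laurent_pos_neq_0)
qed

lemma bd_subset: "\<Union>bd \<subseteq> {lo..hi}"
  using lo_less_hi by (auto simp: bd_def)

lemma chord_subset: "v \<in> labels \<Longrightarrow> chord v \<subseteq> {lo..hi}"
proof (erule labels_cases)
  fix i assume "i \<le> Suc n" "v = g i"
  then show ?thesis using bounds[of i] zz_less_oo[of i] by (auto simp: chord_g gchord_def)
next
  fix i assume "i \<le> n" "v = h i"
  then show ?thesis using bounds[of i] bounds[of "Suc i"] zz_less_oo[of i]
    by (auto simp: chord_h hchord_def split: if_splits)
qed

sublocale polygon labels bd "{lo..hi}" X
  by unfold_locales (auto simp: finite_labels X_ptolemy X_bd X_neq_0)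

lemma initial_triang_seed:
  assumes "\<And>v w. v \<in> labels \<Longrightarrow> w \<in> labels \<Longrightarrow> B v w = of_bool (snake_arrow v w)"
  shows "triang_seed chord var B"
  unfolding triang_seed_def T_def[symmetric]
proof (intro conjI ballI)
  show "\<Union>T \<subseteq> {lo..hi}" using chord_subset bd_subset unfolding T_def by blast
qed (use inj_chord chord_not_bd noncrossing_T two_sided_T X_chord assms tri_arrow_chord in auto)

lemma chord_pair: "v \<in> labels \<Longrightarrow> \<exists>a c. chord v = {a, c}"
  by (erule labels_cases) (auto simp: chord_g chord_h gchord_def hchord_def)

section \<open>Exclusion of all chords but one\<close>

definition inner_vec :: "'v \<Rightarrow> int" where
  "inner_vec v = (if v \<in> g ` {1..n} then 1 else 0)"

lemma good_nonneg:
  assumes w: "w \<notin> g ` {1..n}" and A: "A \<subseteq> {lo..hi}" "\<And>q. q \<in> A \<Longrightarrow> odd q \<Longrightarrow> {q - 1, nxt q} \<noteq> chord w"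
  shows "good (laurent_nonneg w) A"
proof (rule good_all[where R = "{w}"])
  show "1 \<in> laurent_nonneg w" using laurent_pos_1 laurent_pos_subset by blast
  show "inverse (var v) \<in> laurent_nonneg w" if "v \<notin> {w}" for v
    using laurent_pos_inverse_var[of v w] laurent_pos_subset that by blast
qed (use w A laurent_nonneg_closed laurent_nonneg_var in auto)

lemma far_pos: "w \<in> {g 0, h 0} \<Longrightarrow> good (laurent_pos w) ({lo..hi} - {-1, 0, 1})"
  by (rule good_far) (auto intro: laurent_pos_closed laurent_pos_1 laurent_pos_var laurent_pos_inverse_var)

lemma near_pos: "w \<in> {g (Suc n), h n} \<Longrightarrow> good (laurent_pos w) {2 * zz n..2 * oo n}"
  by (rule good_near) (auto intro: laurent_pos_closed laurent_pos_1 laurent_pos_var laurent_pos_inverse_var)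

lemma far_nonneg: "good (laurent_nonneg (g 1)) ({lo..hi} - {-1, 0, 1})"
  using laurent_pos_subset[of "g 1"]
  by (intro good_far) (auto intro: laurent_nonneg_closed laurent_nonneg_var laurent_pos_1 laurent_pos_inverse_var)

lemma near_nonneg: "good (laurent_nonneg (g n)) {2 * zz n..2 * oo n}"
  using laurent_pos_subset[of "g n"]
  by (intro good_near) (auto intro: laurent_nonneg_closed laurent_nonneg_var laurent_pos_1 laurent_pos_inverse_var)

lemma goodD: "good P S \<Longrightarrow> p \<in> S \<Longrightarrow> q \<in> S \<Longrightarrow> p \<noteq> q \<Longrightarrow> X {p, q} \<in> P"
  by (simp add: good_def)

text \<open>Ptolemy across the ear, whose two sides have value 1, gives
  \<open>X {e, q} * var w\<close> as the sum of the values at the two base ends. The names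
  \<open>a\<close> and \<open>b\<close> allow either end to be the one known to be nonzero along
  \<open>w\<close>.\<close>

lemma ear_pole:
  assumes e: "odd e" "lo < e" "e \<le> hi" and w: "w \<in> labels" "{e - 1, nxt e} = chord w"
    and q: "lo \<le> q" "q \<le> hi" "q \<noteq> e - 1" "q \<noteq> e" "q \<noteq> nxt e"
    and ab: "{e - 1, nxt e} = {a, b}" "X {a, q} \<in> laurent_nonneg w" "X {b, q} \<in> laurent_pos w"
  shows "X {e, q} * var w \<in> laurent_pos w"
proof -
  have "cyc4 (nxt e) q (e - 1) e"
    using e q unfolding nxt_def cyc4_def cyc_def by smt
  then have "X {nxt e, e - 1} * X {q, e} = X {nxt e, q} * X {e - 1, e} + X {q, e - 1} * X {e, nxt e}"
    by (rule X_ptolemy)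
  moreover have "{e - 1, e} \<in> bd" using bd_step[of "e - 1"] e by simp
  moreover have "{e, nxt e} \<in> bd"
  proof (cases "e = hi")
    case True
    then have "{e, nxt e} = {lo, hi}" by (auto simp: nxt_def)
    then show ?thesis using bd_wrap by simp
  qed (use bd_step[of e] e in \<open>simp add: nxt_def\<close>)
  ultimately have "X {e, q} * X (chord w) = X {e - 1, q} + X {nxt e, q}"
    using X_bd X_commute[of "nxt e" "e - 1"] X_commute[of q e] X_commute[of q "e - 1"] w(2)
    by (simp add: algebra_simps)
  moreover have "X {e - 1, q} + X {nxt e, q} = X {b, q} + X {a, q}"
    using ab(1) by (auto simp: doubleton_eq_iff)
  ultimately show ?thesis using X_chord[OF w(1)] laurent_pos_add[OF ab(3,2)] by simp
qed

lemma inner_vec_simps: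
  "inner_vec v \<ge> 0" "v \<in> g ` {1..n} \<Longrightarrow> inner_vec v = 1" "v \<notin> g ` {1..n} \<Longrightarrow> inner_vec v = 0"
  by (auto simp: inner_vec_def)

lemma g_mem_image: "i \<le> Suc n \<Longrightarrow> S \<subseteq> {..Suc n} \<Longrightarrow> g i \<in> g ` S \<longleftrightarrow> i \<in> S"
  using inj_on_image_mem_iff[OF inj_g, of i S] by simp

lemma h_not_mem_image: "j \<le> n \<Longrightarrow> S \<subseteq> {..Suc n} \<Longrightarrow> h j \<notin> g ` S"
  using disj_gh by blast

lemma outer_not_inner: "g 0 \<notin> g ` {1..n}" "g (Suc n) \<notin> g ` {1..n}" "j \<le> n \<Longrightarrow> h j \<notin> g ` {1..n}"
  using g_end_not_inner[of 0] g_end_not_inner[of "Suc n"] h_not_mem_image[of j "{1..n}"] by auto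

lemma not_dvector_nonneg:
  "i \<in> {1..n} \<Longrightarrow> z \<in> laurent_nonneg (g i) \<Longrightarrow> \<not> has_dvector labels z inner_vec"
  by (rule not_dvector_if_no_pole[where g = "g i"]) (auto simp: finite_labels inner_vec_simps g_in_labels)

lemma not_dvector_pole:
  "w \<in> labels \<Longrightarrow> w \<notin> g ` {1..n} \<Longrightarrow> z * var w \<in> laurent_pos w \<Longrightarrow> \<not> has_dvector labels z inner_vec"
  by (rule not_dvector_if_pole[where g = w]) (auto simp: finite_labels inner_vec_simps)

text \<open>Every vertex listed for \<open>p\<close> or \<open>q\<close> other than 0 and
  \<open>lo\<close> is an ear tip, so \<open>ear_pole\<close> yields a pole along its base, a label
  with entry 0 in \<open>inner_vec\<close>.\<close>

lemma dvector_crossing: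
  assumes p: "p \<in> {-1, 0, 1}" and q: "q \<in> {lo, lo + 1, hi}" and dv: "has_dvector labels (X {p, q}) inner_vec"
  shows "p = 0 \<and> q = lo"
proof -
  have lo: "lo \<le> -4" "2 * zz n = lo + 2" using zz_mono[of 1 n] n2 by (auto simp: lo_def)
  have hi: "3 \<le> hi" "2 * oo n = hi - 1" using oo_ge_1[of n] by (auto simp: hi_def)
  have g0: "g 0 \<in> labels" "g (Suc n) \<in> labels" "h 0 \<in> labels" "h n \<in> labels"
    by (auto intro: g_in_labels h_in_labels)
  have c: "chord (g 0) = {0, 2}" "chord (h 0) = {-2, 0}" "chord (h n) = {lo, lo + 2}" "chord (g (Suc n)) = {lo, hi - 1}"
    by (simp_all add: chord_g chord_h gchord_def hchord_def lo_def hi_def)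
  have odd_lo: "odd (lo + 1)" using even_lo by simp
  have "p \<noteq> 1"
  proof
    assume p1: "p = 1"
    have "X {1, q} * var (g 0) \<in> laurent_pos (g 0)"
    \<comment> \<open>The base end 2 is among the vertices covered by \<open>far_pos\<close>, which
      gives nonvanishing; for the end 0 regularity is enough.\<close>
    proof (rule ear_pole[where a = 0 and b = 2])
      show "X {2, q} \<in> laurent_pos (g 0)"
        by (rule goodD[OF far_pos]) (use q lo hi in auto)
      have "good (laurent_nonneg (g 0)) {0, q}"
        using q lo hi odd_hi by (intro good_nonneg outer_not_inner) (auto simp: c doubleton_eq_iff nxt_def split: if_splits)
      then show "X {0, q} \<in> laurent_nonneg (g 0)" using q lo hi by (auto simp: good_def)
    qed (use q lo hi g0 c in \<open>auto simp: nxt_def\<close>)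
    then show False using not_dvector_pole[OF g0(1) outer_not_inner(1)] dv p1 by blast
  qed
  moreover have "p \<noteq> -1"
  proof
    assume p1: "p = -1"
    have "X {-1, q} * var (h 0) \<in> laurent_pos (h 0)"
    proof (rule ear_pole[where a = 0 and b = "-2"])
      show "X {-2, q} \<in> laurent_pos (h 0)"
        by (rule goodD[OF far_pos]) (use q lo hi in auto)
      have "good (laurent_nonneg (h 0)) {0, q}"
        using q lo hi odd_hi by (intro good_nonneg outer_not_inner) (auto simp: c doubleton_eq_iff nxt_def split: if_splits)
      then show "X {0, q} \<in> laurent_nonneg (h 0)" using q lo hi by (auto simp: good_def)
    qed (use q lo hi g0 c in \<open>auto simp: nxt_def\<close>)
    then show False using not_dvector_pole[OF g0(3) outer_not_inner(3)] dv p1 by blast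
  qed
  ultimately have p0: "p = 0" using p by simp
  have "q \<noteq> lo + 1"
  proof
    assume ql: "q = lo + 1"
    have "X {lo + 1, 0} * var (h n) \<in> laurent_pos (h n)"
    proof (rule ear_pole[where a = lo and b = "lo + 2"])
      show "X {lo + 2, 0} \<in> laurent_pos (h n)"
        by (rule goodD[OF near_pos]) (use q lo hi in auto)
      have "good (laurent_nonneg (h n)) {lo, 0}"
        using lo hi even_lo by (intro good_nonneg outer_not_inner) auto
      then show "X {lo, 0} \<in> laurent_nonneg (h n)" using lo by (auto simp: good_def)
    qed (use lo hi g0 c odd_lo in \<open>auto simp: nxt_def\<close>)
    then show False
      using not_dvector_pole[OF g0(4) outer_not_inner(3)] dv ql p0 X_commute[of 0 "lo + 1"] by simp
  qed
  moreover have "q \<noteq> hi"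
  proof
    assume ql: "q = hi"
    have "X {hi, 0} * var (g (Suc n)) \<in> laurent_pos (g (Suc n))"
    proof (rule ear_pole[where a = lo and b = "hi - 1"])
      show "X {hi - 1, 0} \<in> laurent_pos (g (Suc n))"
        by (rule goodD[OF near_pos]) (use q lo hi in auto)
      have "good (laurent_nonneg (g (Suc n))) {lo, 0}"
        using lo hi even_lo by (intro good_nonneg outer_not_inner) auto
      then show "X {lo, 0} \<in> laurent_nonneg (g (Suc n))" using lo by (auto simp: good_def)
    qed (use lo hi g0 c odd_hi in \<open>auto simp: nxt_def\<close>)
    then show False
      using not_dvector_pole[OF g0(2) outer_not_inner(2)] dv ql p0 X_commute[of 0 hi] by simp
  qed
  ultimately show ?thesis using p0 q by simp
qed

lemma dvector_unique:
  assumes B: "\<And>v w. v \<in> labels \<Longrightarrow> w \<in> labels \<Longrightarrow> B v w = of_bool (snake_arrow v w)"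
    and z: "z \<in> cluster_variables labels B" and dv: "has_dvector labels z inner_vec"
  shows "z = X {0, lo}"
proof -
  obtain p q where pq: "p \<in> {lo..hi}" "q \<in> {lo..hi}" "p \<noteq> q" "z = X {p, q}"
    using cluster_variable_chord[OF z initial_triang_seed[OF B] chord_pair] by blast
  have lo: "lo \<le> -4" "2 * zz n = lo + 2" using zz_mono[of 1 n] n2 by (auto simp: lo_def)
  have hi: "3 \<le> hi" "2 * oo n = hi - 1" using oo_ge_1[of n] by (auto simp: hi_def)
  have "p \<in> {-1, 0, 1} \<or> q \<in> {-1, 0, 1}"
  proof (rule ccontr)
    assume "\<not> ?thesis"
    then have "z \<in> laurent_nonneg (g 1)" using far_nonneg pq unfolding good_def by blast
    then show False using not_dvector_nonneg[of 1] n2 dv by auto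
  qed
  moreover have "\<not> (p \<in> {2 * zz n..2 * oo n} \<and> q \<in> {2 * zz n..2 * oo n})"
  proof
    assume "p \<in> {2 * zz n..2 * oo n} \<and> q \<in> {2 * zz n..2 * oo n}"
    then have "z \<in> laurent_nonneg (g n)" using near_nonneg pq unfolding good_def by blast
    then show False using not_dvector_nonneg[of n] n2 dv by auto
  qed
  \<comment> \<open>As \<open>2 * zz n = lo + 2\<close> and \<open>2 * oo n = hi - 1\<close>, the
    diagonal \<open>g n\<close> cuts off just these three vertices. A chord not excluded so far
    joins one of them to one of -1, 0, 1.\<close>
  moreover have "x \<in> {lo, lo + 1, hi}" if "x \<in> {lo..hi}" "x \<notin> {2 * zz n..2 * oo n}" for x
    using that lo hi by auto
  moreover have "x \<in> {2 * zz n..2 * oo n}" if "x \<in> {-1, 0, 1}" for x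
    using that lo hi by auto
  ultimately consider "p \<in> {-1, 0, 1}" "q \<in> {lo, lo + 1, hi}" | "q \<in> {-1, 0, 1}" "p \<in> {lo, lo + 1, hi}"
    using pq(1,2) by meson
  then show ?thesis
  proof cases
    case 1
    then show ?thesis using dvector_crossing[OF 1] dv pq(4) by simp
  next
    case 2
    then show ?thesis using dvector_crossing[OF 2] dv pq(4) X_commute[of p q] by simp
  qed
qed

section \<open>The long chord: flips, recursion and denominator\<close>

text \<open>After \<open>k\<close> flips the ends of \<open>g (Suc k)\<close> are both joined to 0,
  so for \<open>k < n\<close> this diagonal can be flipped next, into the chord from 0 to
  \<open>2 * tip (Suc k)\<close>. The last of these chords ends at \<open>lo\<close>.\<close>

lemma flip_sequence:
  assumes B: "\<And>v w. v \<in> labels \<Longrightarrow> w \<in> labels \<Longrightarrow> B v w = of_bool (snake_arrow v w)"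
    and "k \<le> n"
  shows "\<exists>e u B'. seed labels B u B' \<and> triang_seed e u B' \<and> (\<forall>v \<in> labels - g ` {1..k}. e v = chord v) \<and>
    (k \<ge> 1 \<longrightarrow> e (g k) = {0, 2 * tip k}) \<and>
    {0, 2 * zz (Suc k)} \<in> e ` labels \<union> bd \<and> {0, 2 * oo (Suc k)} \<in> e ` labels \<union> bd"
  using \<open>k \<le> n\<close>
proof (induction k)
  case 0
  have "{0, 2 * zz (Suc 0)} = chord (h 0)" "{0, 2 * oo (Suc 0)} = chord (g 0)"
    using chord_h[of 0] chord_g[of 0] by (auto simp: hchord_def gchord_def)
  then have "{0, 2 * zz (Suc 0)} \<in> chord ` labels" "{0, 2 * oo (Suc 0)} \<in> chord ` labels"
    using h_in_labels[of 0] g_in_labels[of 0] by auto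
  then show ?case using seed.initial initial_triang_seed[OF B] by fastforce
next
  case (Suc k)
  then obtain e u B' where IH: "seed labels B u B'" "triang_seed e u B'"
    "\<And>v. v \<in> labels - g ` {1..k} \<Longrightarrow> e v = chord v"
    "{0, 2 * zz (Suc k)} \<in> e ` labels \<union> bd" "{0, 2 * oo (Suc k)} \<in> e ` labels \<union> bd"
    by auto
  let ?K = "Suc k"
  have Kn: "?K \<le> n" using Suc by simp
  have new: "g i \<notin> g ` {1..k}" if "k < i" "i \<le> Suc n" for i
    using that Kn by (subst g_mem_image) auto
  have gK: "g ?K \<in> labels" using g_in_labels Kn by simp
  have eK: "e (g ?K) = {2 * zz ?K, 2 * oo ?K}"
    using IH(3)[of "g ?K"] gK new[of ?K] Kn by (simp add: chord_g gchord_def)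
  have eh: "e (h ?K) = hchord ?K" "e (g (Suc ?K)) = gchord (Suc ?K)"
    using IH(3)[of "h ?K"] IH(3)[of "g (Suc ?K)"] h_in_labels[OF Kn] g_in_labels[of "Suc ?K"] Kn new[of "Suc ?K"]
      h_not_mem_image[of ?K "{1..k}"] by (simp_all add: chord_h chord_g)
  have sides: "{2 * oo ?K, 2 * tip ?K} \<in> e ` labels" "{2 * tip ?K, 2 * zz ?K} \<in> e ` labels"
    using g_quad(4,5)[of ?K] Kn eh h_in_labels[OF Kn] g_in_labels[of "Suc ?K"]
    by (auto simp: g_out_def simp del: zz.simps(2) oo_Suc split: if_splits intro: image_eqI[OF sym])
  have zo: "zz ?K < 0" "0 < oo ?K" using zz_mono[of 1 ?K] oo_ge_1[of ?K] by auto
  have quad: "cyc4 (2 * zz ?K) 0 (2 * oo ?K) (2 * tip ?K)"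
    using zo by (auto simp: cyc4_def cyc_def tip_def simp del: zz.simps(2) oo_Suc)
  have s0: "{2 * zz ?K, 0} \<in> e ` labels \<union> bd" using IH(4) by (simp add: insert_commute)
  let ?e = "e(g ?K := {0, 2 * tip ?K})"
  have ts: "triang_seed ?e (mutate_cluster labels (g ?K) B' u) (mutate_quiver (g ?K) B')"
    by (rule triang_seed_flip[OF IH(2) gK quad eK]) (use s0 IH(5) sides in auto)
  \<comment> \<open>The flipped diagonal misses the vertex 0, so chords at 0 survive.\<close>
  have keep: "C \<in> ?e ` labels \<union> bd" if C: "C \<in> e ` labels \<union> bd" "0 \<in> C" for C
  proof (cases "C \<in> bd")
    case False
    then obtain v where v: "v \<in> labels" "C = e v" using C(1) by blast
    then have "v \<noteq> g ?K" using eK C(2) zo by auto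
    then have "?e v = C" using v by simp
    then show ?thesis using v(1) by blast
  qed simp
  have new_chord: "{0, 2 * tip ?K} \<in> ?e ` labels \<union> bd"
    using gK by (metis UnI1 fun_upd_same imageI)
  have "{0, 2 * zz (Suc ?K)} \<in> ?e ` labels \<union> bd"
    using keep[OF IH(4)] new_chord by (cases "d ?K") (auto simp: tip_def)
  moreover have "{0, 2 * oo (Suc ?K)} \<in> ?e ` labels \<union> bd"
    using keep[OF IH(5)] new_chord by (cases "d ?K") (auto simp: tip_def)
  moreover have "?e v = chord v" if "v \<in> labels - g ` {1..?K}" for v
  proof -
    have "v \<noteq> g ?K" "v \<in> labels - g ` {1..k}" using that by auto
    then show ?thesis using IH(3) by simp
  qed
  moreover have "?e (g ?K) = {0, 2 * tip ?K}" by simp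
  ultimately show ?case
    using seed.mutation[OF IH(1) gK] ts by blast
qed

lemma cluster_variable_X:
  assumes B: "\<And>v w. v \<in> labels \<Longrightarrow> w \<in> labels \<Longrightarrow> B v w = of_bool (snake_arrow v w)"
  shows "X {0, lo} \<in> cluster_variables labels B"
proof -
  obtain e u B' where *: "seed labels B u B'" "triang_seed e u B'" "e (g n) = {0, 2 * tip n}"
    using flip_sequence[of B n, OF B] n2 by auto
  have "2 * tip n = lo" by (simp add: tip_def lo_def)
  moreover have "u (g n) = X (e (g n))" using *(2) g_in_labels[of n] by (simp add: triang_seed_def)
  ultimately have "X {0, lo} = u (g n)" using *(3) by simp
  then show ?thesis using *(1) g_in_labels[of n] unfolding cluster_variables_def by auto
qed

text \<open>The pair at stage \<open>k\<close> consists of \<open>X\<close> at the chords from the tip \<open>0\<close> to the two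
  endpoints of the \<open>(k+1)\<close>-st diagonal, cleared of denominators.\<close>

primrec chain :: "(nat \<Rightarrow> 'c::comm_ring_1) \<Rightarrow> (nat \<Rightarrow> 'c) \<Rightarrow> nat \<Rightarrow> 'c \<times> 'c" where
  "chain G H 0 = (H 0, G 0)"
| "chain G H (Suc k) = (let (a, b) = chain G H k in
     if d (Suc k) then (b * H (Suc k) + a * G (Suc (Suc k)), b * G (Suc k))
     else (a * G (Suc k), a * H (Suc k) + b * G (Suc (Suc k))))"

text \<open>One step is the Ptolemy relation for 0, the two ends of \<open>g (Suc k)\<close> and the
  next tip, multiplied by all diagonals passed; the chord to the end that is kept is only rescaled
  by \<open>var (g (Suc k))\<close>.\<close>

lemma chain_X:
  assumes "k \<le> n"
  shows "chain (\<lambda>i. var (g i)) (\<lambda>i. var (h i)) k =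
    (X {0, 2 * zz (Suc k)} * (\<Prod>i=1..k. var (g i)), X {0, 2 * oo (Suc k)} * (\<Prod>i=1..k. var (g i)))"
  using assms
proof (induction k)
  case 0
  have "{0, 2 * zz (Suc 0)} = hchord 0" "{0, 2 * oo (Suc 0)} = gchord 0"
    by (auto simp: hchord_def gchord_def)
  then show ?case using X_hchord[of 0] X_gchord[of 0] by simp
next
  case (Suc k)
  let ?K = "Suc k"
  let ?a = "X {0, 2 * zz ?K}" and ?b = "X {0, 2 * oo ?K}" and ?t = "X {0, 2 * tip ?K}"
  have Kn: "?K \<le> n" using Suc by simp
  have zo: "zz ?K < 0" "0 < oo ?K" using zz_mono[of 1 ?K] oo_ge_1[of ?K] by auto
  have quad: "cyc4 (2 * zz ?K) 0 (2 * oo ?K) (2 * tip ?K)"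
    using zo by (auto simp: cyc4_def cyc_def tip_def simp del: zz.simps(2) oo_Suc)
  have q: "{2 * oo ?K, 2 * tip ?K} = (if d ?K then gchord (Suc ?K) else hchord ?K)"
      "{2 * tip ?K, 2 * zz ?K} = (if d ?K then hchord ?K else gchord (Suc ?K))"
    using g_quad(4,5)[of ?K] Kn by (auto simp: g_out_def simp del: zz.simps(2) oo_Suc)
  have "var (g ?K) * ?t = ?a * X {2 * oo ?K, 2 * tip ?K} + ?b * X {2 * tip ?K, 2 * zz ?K}"
    using X_ptolemy[OF quad] X_g[of ?K] Kn X_commute[of "2 * zz ?K" 0] by simp
  then have step: "?t * var (g ?K) = (if d ?K then ?b * var (h ?K) + ?a * var (g (Suc ?K))
      else ?a * var (h ?K) + ?b * var (g (Suc ?K)))"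
    unfolding q using X_gchord[of "Suc ?K"] X_hchord[OF Kn] Kn by (simp add: mult.commute)
  let ?P = "\<Prod>i=1..k. var (g i)"
  have "chain (\<lambda>i. var (g i)) (\<lambda>i. var (h i)) k = (?a * ?P, ?b * ?P)" using Suc by simp
  moreover have "(\<Prod>i=1..?K. var (g i)) = ?P * var (g ?K)" by simp
  moreover have "zz (Suc ?K) = (if d ?K then tip ?K else zz ?K)" "oo (Suc ?K) = (if d ?K then oo ?K else tip ?K)"
    by (auto simp: tip_def)
  moreover have "?t * (?P * var (g ?K)) = (if d ?K then ?b * ?P * var (h ?K) + ?a * ?P * var (g (Suc ?K))
      else ?a * ?P * var (h ?K) + ?b * ?P * var (g (Suc ?K)))"
  proof -
    have "?t * (?P * var (g ?K)) = (?t * var (g ?K)) * ?P" by (simp only: ac_simps)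
    then show ?thesis unfolding step by (cases "d ?K") (simp_all add: algebra_simps)
  qed
  ultimately show ?case
    unfolding chain.simps(2) by (cases "d ?K") (simp_all add: mult.assoc del: zz.simps(2) oo_Suc)
qed

text \<open>The recursion contains no division, so the cleared numerators are polynomials given by
  the same recursion.\<close>

lemma chain_Fract:
  "chain (\<lambda>i. var (g i)) (\<lambda>i. var (h i)) k =
    (let (a, b) = chain (\<lambda>i. pvar (g i)) (\<lambda>i. pvar (h i)) k in (Fract a 1, Fract b 1))"
  by (induction k) (auto simp: var_def Let_def split: prod.splits)

lemma pvar_nonneg: "nonneg_poly (pvar v)"
  unfolding pvar_def by (rule nonneg_poly_single) simp

lemma pvar_pos: "v \<noteq> w \<Longrightarrow> pos_poly w (pvar v)"
  unfolding pvar_def by (rule pos_poly_single) (simp_all add: lookup_single)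

text \<open>One component nonzero at \<open>v = 0\<close> makes the next sum nonzero, unless
  \<open>v\<close> is one of the labels entering at that step. For these the last clause is carried
  along: it gives both components nonzero along \<open>g (Suc k)\<close>, \<open>h (Suc k)\<close>
  and \<open>g (Suc (Suc k))\<close> when they enter.\<close>

lemma chain_pos:
  assumes "k < n" "v \<in> labels" and ab: "chain (\<lambda>i. pvar (g i)) (\<lambda>i. pvar (h i)) k = (a, b)"
  shows "nonneg_poly a \<and> nonneg_poly b \<and> (pos_poly v a \<or> pos_poly v b) \<and>
    (v \<notin> {g 0, h 0} \<union> g ` {1..k} \<longrightarrow> pos_poly v a \<and> pos_poly v b)"
  using assms(1) ab
proof (induction k arbitrary: a b)
  case 0
  then show ?case
    using pvar_nonneg pvar_pos[of "g 0" v] pvar_pos[of "h 0" v] g_neq_h[of 0 0] by (cases "v = g 0") auto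
next
  case (Suc k)
  let ?K = "Suc k"
  obtain a' b' where ab': "chain (\<lambda>i. pvar (g i)) (\<lambda>i. pvar (h i)) k = (a', b')" by fastforce
  have IH: "nonneg_poly a'" "nonneg_poly b'" "pos_poly v a' \<or> pos_poly v b'"
    "v \<notin> {g 0, h 0} \<union> g ` {1..k} \<Longrightarrow> pos_poly v a' \<and> pos_poly v b'"
    using Suc.IH[OF _ ab'] Suc.prems by auto
  have kn: "?K \<le> n" "Suc ?K \<le> Suc n" using Suc.prems by auto
  have gK: "g ?K \<notin> {g 0, h 0} \<union> g ` {1..k}"
    using g_neq[of ?K 0] h_not_g[of 0 ?K] kn by (simp add: g_mem_image)
  have hK: "h ?K \<noteq> h 0" "h ?K \<noteq> g (Suc ?K)" "h ?K \<noteq> g ?K" "h ?K \<notin> g ` {1..?K}" "h ?K \<noteq> g 0"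
    using h_eq[of ?K 0] h_not_g[of ?K 0] h_not_g[of ?K ?K] h_not_g[of ?K "Suc ?K"] kn
      h_not_mem_image[of ?K "{1..?K}"] by simp_all
  have gSK: "g (Suc ?K) \<notin> {g 0, h 0} \<union> g ` {1..?K}"
    using g_neq[of "Suc ?K" 0] h_not_g[of 0 "Suc ?K"] kn by (simp add: g_mem_image)
  have ins: "g ` {1..?K} = insert (g ?K) (g ` {1..k})" by (simp add: atLeastAtMostSuc_conv)
  have split: "pos_poly v a'" "pos_poly v b'" if "v = g ?K \<or> v = h ?K \<or> v = g (Suc ?K) \<or> v \<notin> {g 0, h 0} \<union> g ` {1..k}"
    using IH(4) that gK hK gSK unfolding ins by auto
  have stay: "pos_poly v (c * pvar (g ?K))" if "pos_poly v c" "v \<noteq> g ?K" for c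
    using that by (intro pos_poly_mult pvar_pos) auto
  have nn: "nonneg_poly (c * pvar w)" if "nonneg_poly c" for c w
    using that by (intro nonneg_poly_mult pvar_nonneg)
  have sum2: "pos_poly v (c * pvar (h ?K) + c' * pvar (g (Suc ?K)))"
    if "nonneg_poly c" "nonneg_poly c'" "pos_poly v c \<and> v \<noteq> h ?K \<or> pos_poly v c' \<and> v \<noteq> g (Suc ?K)" for c c'
    using that(3)
  proof
    assume "pos_poly v c \<and> v \<noteq> h ?K"
    then have "pos_poly v (c * pvar (h ?K))" by (intro pos_poly_mult pvar_pos) auto
    then show ?thesis using nn[OF that(2)] by (rule pos_poly_add)
  next
    assume "pos_poly v c' \<and> v \<noteq> g (Suc ?K)"
    then have "pos_poly v (c' * pvar (g (Suc ?K)))" by (intro pos_poly_mult pvar_pos) auto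
    then have "pos_poly v (c' * pvar (g (Suc ?K)) + c * pvar (h ?K))" using nn[OF that(1)] by (rule pos_poly_add)
    then show ?thesis by (simp add: add.commute)
  qed
  show ?case
  proof (cases "d ?K")
    case True
    then have e: "a = b' * pvar (h ?K) + a' * pvar (g (Suc ?K))" "b = b' * pvar (g ?K)"
      using Suc.prems(2) ab' by simp_all
    have "nonneg_poly a" "nonneg_poly b" unfolding e using IH(1,2) by (auto intro: nn nonneg_poly_add)
    moreover have "pos_poly v a \<or> pos_poly v b"
      unfolding e using sum2[OF IH(2,1)] stay[of b'] split IH(3) hK by metis
    moreover have "pos_poly v a \<and> pos_poly v b" if "v \<notin> {g 0, h 0} \<union> g ` {1..?K}"
      unfolding e using sum2[OF IH(2,1)] stay[of b'] split that hK unfolding ins by auto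
    ultimately show ?thesis by blast
  next
    case False
    then have e: "b = a' * pvar (h ?K) + b' * pvar (g (Suc ?K))" "a = a' * pvar (g ?K)"
      using Suc.prems(2) ab' by simp_all
    have "nonneg_poly a" "nonneg_poly b" unfolding e using IH(1,2) by (auto intro: nn nonneg_poly_add)
    moreover have "pos_poly v a \<or> pos_poly v b"
      unfolding e using sum2[OF IH(1,2)] stay[of a'] split IH(3) hK by metis
    moreover have "pos_poly v a \<and> pos_poly v b" if "v \<notin> {g 0, h 0} \<union> g ` {1..?K}"
      unfolding e using sum2[OF IH(1,2)] stay[of a'] split that hK unfolding ins by auto
    ultimately show ?thesis by blast
  qed
qed

lemma prod_inner_vec: "(\<Prod>v\<in>labels. var v powi inner_vec v) = (\<Prod>i=1..n. var (g i))"
proof -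
  have "(\<Prod>v\<in>labels. var v powi inner_vec v) = (\<Prod>v\<in>g ` {1..n}. var v)"
    using finite_labels by (intro prod.mono_neutral_cong_right) (auto simp: inner_vec_def labels_def)
  also have "\<dots> = (\<Prod>i=1..n. var (g i))"
    using inj_g by (subst prod.reindex) (auto simp: inj_on_def)
  finally show ?thesis .
qed

lemma has_dvector_X: "has_dvector labels (X {0, lo}) inner_vec"
proof -
  \<comment> \<open>The last sum is taken apart at stage \<open>n - 1\<close>. Its new labels
    \<open>h n\<close> and \<open>g (Suc n)\<close> are distinct and have not occurred before, so no
    label divides it.\<close>
  obtain m where m: "n = Suc m" using n2 by (cases n) auto
  obtain a b where ab: "chain (\<lambda>i. pvar (g i)) (\<lambda>i. pvar (h i)) m = (a, b)" by fastforce
  define F where "F = b * pvar (h n) + a * pvar (g (Suc n))"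
  have "fst (chain (\<lambda>i. pvar (g i)) (\<lambda>i. pvar (h i)) n) = F"
    using ab dn by (simp add: m F_def)
  then have "X {0, lo} * (\<Prod>i=1..n. var (g i)) = Fract F 1"
    using chain_X[of n] chain_Fract[of n] by (auto simp: lo_def Let_def split: prod.splits)
  moreover have "(\<Prod>i=1..n. var (g i)) \<noteq> 0" by simp
  ultimately have "X {0, lo} = Fract F 1 / (\<Prod>v\<in>labels. var v powi inner_vec v)"
    unfolding prod_inner_vec by (simp add: field_simps)
  moreover have "\<not> pvar v dvd F" if v: "v \<in> labels" for v
  proof (rule pos_poly_not_dvd)
    have *: "nonneg_poly a" "nonneg_poly b" "pos_poly v a \<or> pos_poly v b"
      "v \<notin> {g 0, h 0} \<union> g ` {1..m} \<Longrightarrow> pos_poly v a \<and> pos_poly v b"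
      using chain_pos[OF _ v ab] m by auto
    have nn: "nonneg_poly (c * pvar w)" if "nonneg_poly c" for c w
      using that by (intro nonneg_poly_mult pvar_nonneg)
    have out: "h n \<notin> {g 0, h 0} \<union> g ` {1..m}" "g (Suc n) \<notin> {g 0, h 0} \<union> g ` {1..m}" "h n \<noteq> g (Suc n)"
      using h_not_g[of n 0] h_not_g[of n "Suc n"] h_eq[of n 0] n2 g_neq[of "Suc n" 0] h_not_g[of 0 "Suc n"] m
        h_not_mem_image[of n "{1..m}"] by (simp_all add: g_mem_image)
    then have "pos_poly v b \<and> v \<noteq> h n \<or> pos_poly v a \<and> v \<noteq> g (Suc n)" using * by blast
    then show "pos_poly v F"
    proof
      assume "pos_poly v b \<and> v \<noteq> h n"
      then have "pos_poly v (b * pvar (h n))" by (intro pos_poly_mult pvar_pos) auto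
      then show ?thesis unfolding F_def using nn[OF *(1)] by (rule pos_poly_add)
    next
      assume "pos_poly v a \<and> v \<noteq> g (Suc n)"
      then have "pos_poly v (a * pvar (g (Suc n)))" by (intro pos_poly_mult pvar_pos) auto
      then show ?thesis unfolding F_def using nn[OF *(2)] pos_poly_add add.commute by metis
    qed
  qed
  ultimately show ?thesis unfolding has_dvector_def by blast
qed

theorem snake_cluster_variable:
  assumes "\<And>v w. v \<in> labels \<Longrightarrow> w \<in> labels \<Longrightarrow> B v w = of_bool (snake_arrow v w)"
  shows "{z \<in> cluster_variables labels B. has_dvector labels z inner_vec} =
    {fst (chain (\<lambda>i. var (g i)) (\<lambda>i. var (h i)) n) / (\<Prod>i=1..n. var (g i))}"
proof -
  have "X {0, lo} = fst (chain (\<lambda>i. var (g i)) (\<lambda>i. var (h i)) n) / (\<Prod>i=1..n. var (g i))"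
    using chain_X[of n] by (simp add: lo_def)
  moreover have "{z \<in> cluster_variables labels B. has_dvector labels z inner_vec} = {X {0, lo}}"
    using dvector_unique[of B, OF assms] cluster_variable_X[of B, OF assms] has_dvector_X by blast
  ultimately show ?thesis by simp
qed

end

section \<open>Globally compatible collections as paths\<close>

primrec transfer :: "(bool \<Rightarrow> 'a::comm_semiring_1) \<Rightarrow> (nat \<Rightarrow> bool \<Rightarrow> bool \<Rightarrow> 'a) \<Rightarrow> nat \<Rightarrow> bool \<Rightarrow> 'a" where
  "transfer w M 0 b = w b"
| "transfer w M (Suc k) b = transfer w M k False * M (Suc k) False b + transfer w M k True * M (Suc k) True b"

lemma sum_PiE_insert:
  assumes "x \<notin> A"
  shows "(\<Sum>s\<in>PiE (insert x A) B. F s) = (\<Sum>y\<in>B x. \<Sum>s\<in>PiE A B. F (s(x := y)))"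
proof -
  have "(\<Sum>s\<in>PiE (insert x A) B. F s) = (\<Sum>(y, s)\<in>B x \<times> PiE A B. F (s(x := y)))"
    unfolding PiE_insert_eq by (subst sum.reindex[OF inj_combinator[OF assms]]) (auto simp: case_prod_unfold)
  then show ?thesis by (simp add: sum.cartesian_product)
qed

text \<open>The arbitrary end vector \<open>f\<close> makes the induction work: the last factor of
  the product is absorbed into it.\<close>

lemma sum_paths_transfer:
  "(\<Sum>s\<in>PiE {1..Suc k} (\<lambda>_. UNIV). w (s 1) * (\<Prod>i=1..k. M i (s i) (s (Suc i))) * f (s (Suc k)))
    = transfer w M k False * f False + transfer w M k True * f True"
proof (induction k arbitrary: f)
  case 0
  have e: "{1..Suc 0} = insert (1::nat) {}" by auto
  show ?case unfolding e by (subst sum_PiE_insert) (auto simp: UNIV_bool)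
next
  case (Suc k)
  have e: "{1..Suc (Suc k)} = insert (Suc (Suc k)) {1..Suc k}" by auto
  have "(\<Sum>s\<in>PiE {1..Suc (Suc k)} (\<lambda>_. UNIV). w (s 1) * (\<Prod>i=1..Suc k. M i (s i) (s (Suc i))) * f (s (Suc (Suc k))))
    = (\<Sum>c\<in>UNIV. \<Sum>s\<in>PiE {1..Suc k} (\<lambda>_. UNIV). w (s 1) * (\<Prod>i=1..k. M i (s i) (s (Suc i))) * (M (Suc k) (s (Suc k)) c * f c))"
    unfolding e
  proof (subst sum_PiE_insert, simp, intro sum.cong refl)
    fix c :: bool and s :: "nat \<Rightarrow> bool"
    let ?s = "s(Suc (Suc k) := c)"
    have "(\<Prod>i=1..k. M i (?s i) (?s (Suc i))) = (\<Prod>i=1..k. M i (s i) (s (Suc i)))"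
      by (intro prod.cong) auto
    then show "w (?s 1) * (\<Prod>i=1..Suc k. M i (?s i) (?s (Suc i))) * f (?s (Suc (Suc k)))
      = w (s 1) * (\<Prod>i=1..k. M i (s i) (s (Suc i))) * (M (Suc k) (s (Suc k)) c * f c)"
      by (simp add: mult.assoc)
  qed
  also have "\<dots> = (\<Sum>c\<in>UNIV. transfer w M k False * (M (Suc k) False c * f c) + transfer w M k True * (M (Suc k) True c * f c))"
    by (intro sum.cong refl) (rule Suc.IH)
  also have "\<dots> = transfer w M (Suc k) False * f False + transfer w M (Suc k) True * f True"
    by (simp add: UNIV_bool algebra_simps)
  finally show ?case .
qed

lemma delta_cases: "delta Q i = 0 \<or> delta Q i = 1"
  by (simp add: delta_def)

text \<open>A bit \<open>s j\<close> is attached to each vertex of \<open>Q\<close>. As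
  \<open>i + delta Q i\<close> is the source of arrow \<open>i\<close> and
  \<open>i + 1 - delta Q i\<close> its target, \<open>Hor i\<close> is chosen when the source bit is
  set and \<open>Ver i\<close> when the target bit is not.\<close>

definition collection :: "nat \<Rightarrow> nat quiver \<Rightarrow> (nat \<Rightarrow> bool) \<Rightarrow> nat \<times> nat \<Rightarrow> dyck_edge set" where
  "collection n Q s = (\<lambda>(i, r) \<in> {1..n - 1} \<times> {1, 2}.
     if r = 1 then (if s (i + delta Q i) then {Hor i} else {})
     else (if s (i + 1 - delta Q i) then {} else {Ver i}))"

text \<open>Each bit is read from the arrow on the left of its vertex, the bit at 1 from the first
  arrow. Conditions (a) to (d) say that the arrow on the right gives the same value.\<close>

definition bits :: "nat \<Rightarrow> nat quiver \<Rightarrow> (nat \<times> nat \<Rightarrow> dyck_edge set) \<Rightarrow> nat \<Rightarrow> bool" where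
  "bits n Q S = (\<lambda>j \<in> {1..n}.
     if j = 1 then (if delta Q 1 = 0 then S (1, 1) \<noteq> {} else S (1, 2) = {})
     else (if delta Q (j - 1) = 0 then S (j - 1, 2) = {} else S (j - 1, 1) \<noteq> {}))"

text \<open>These are the vertex sets closed under the arrows of \<open>Q\<close>, that is, the
  supports of subrepresentations of the representation that is one-dimensional at every vertex with
  nonzero maps. Failure at arrow \<open>i\<close> is the forbidden case
  \<open>(1, 1)\<close>.\<close>

definition admissible :: "nat \<Rightarrow> nat quiver \<Rightarrow> (nat \<Rightarrow> bool) \<Rightarrow> bool" where
  "admissible n Q s \<longleftrightarrow> (\<forall>i\<in>{1..n - 1}. s (i + delta Q i) \<longrightarrow> s (i + 1 - delta Q i))"

lemma collection_apply:
  assumes "i \<in> {1..n - 1}"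
  shows "collection n Q s (i, 1) = (if s (i + delta Q i) then {Hor i} else {})"
    and "collection n Q s (i, 2) = (if s (i + 1 - delta Q i) then {} else {Ver i})"
  using assms by (simp_all add: collection_def)

lemma card_collection:
  assumes "i \<in> {1..n - 1}"
  shows "card (collection n Q s (i, 1)) = of_bool (s (i + delta Q i))"
    and "card (collection n Q s (i, 2)) = of_bool (\<not> s (i + 1 - delta Q i))"
  using collection_apply[OF assms] by simp_all

lemma collection_in: "collection n Q s \<in> edge_collections n"
  unfolding edge_collections_def collection_def by (auto simp: restrict_def PiE_def extensional_def)

lemma collection_is_GCC:
  assumes "admissible n Q s"
  shows "is_GCC n Q (collection n Q s)"
  unfolding is_GCC_def
proof (intro conjI ballI)
  fix i assume i: "i \<in> {1..n - 1}"
  show "(card (collection n Q s (i, 1)), card (collection n Q s (i, 2))) \<noteq> (1, 1)"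
    using assms i unfolding admissible_def card_collection[OF i] by auto
next
  fix i assume i: "i \<in> {2..n - 1}"
  then have i': "i \<in> {1..n - 1}" "i - 1 \<in> {1..n - 1}" "i - 1 + 1 = i" by auto
  note c = card_collection[OF i'(1), of Q s] card_collection[OF i'(2), of Q s]
  show "(delta Q (i - 1), delta Q i) = (0, 0) \<longrightarrow>
      card (collection n Q s (i - 1, 2)) \<noteq> card (collection n Q s (i, 1))"
    "(delta Q (i - 1), delta Q i) = (1, 1) \<longrightarrow>
      card (collection n Q s (i - 1, 1)) \<noteq> card (collection n Q s (i, 2))"
    "(delta Q (i - 1), delta Q i) = (0, 1) \<longrightarrow>
      card (collection n Q s (i - 1, 2)) = card (collection n Q s (i, 2))"
    "(delta Q (i - 1), delta Q i) = (1, 0) \<longrightarrow>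
      card (collection n Q s (i - 1, 1)) = card (collection n Q s (i, 1))"
    unfolding c using i'(3) by auto
qed (rule collection_in)

lemma bits_apply:
  assumes S: "is_GCC n Q S" and i: "i \<in> {1..n - 1}"
  shows "bits n Q S (i + delta Q i) \<longleftrightarrow> S (i, 1) \<noteq> {}"
    and "bits n Q S (i + 1 - delta Q i) \<longleftrightarrow> S (i, 2) = {}"
    and "S (i, 1) = {} \<or> S (i, 1) = {Hor i}" "S (i, 2) = {} \<or> S (i, 2) = {Ver i}"
proof -
  have E: "S (j, 1) = {} \<or> S (j, 1) = {Hor j}" "S (j, 2) = {} \<or> S (j, 2) = {Ver j}" if "j \<in> {1..n - 1}" for j
  proof -
    have "S (j, 1) \<in> Pow {Hor j}" "S (j, 2) \<in> Pow {Ver j}"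
      using S that unfolding is_GCC_def edge_collections_def PiE_def Pi_def by fastforce+
    then show "S (j, 1) = {} \<or> S (j, 1) = {Hor j}" "S (j, 2) = {} \<or> S (j, 2) = {Ver j}" by auto
  qed
  show "S (i, 1) = {} \<or> S (i, 1) = {Hor i}" "S (i, 2) = {} \<or> S (i, 2) = {Ver i}" using E[OF i] by auto
  have succ: "bits n Q S (i + 1) = (if delta Q i = 0 then S (i, 2) = {} else S (i, 1) \<noteq> {})"
    using i by (auto simp: bits_def)
  \<comment> \<open>The bit at \<open>i\<close> comes from arrow \<open>i - 1\<close>. That arrow
    \<open>i\<close> yields the same value is the content of (a) to (d), once cardinalities are
    turned into emptiness.\<close>
  have same: "bits n Q S i = (if delta Q i = 0 then S (i, 1) \<noteq> {} else S (i, 2) = {})"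
  proof (cases "i = 1")
    case True
    moreover have "1 \<in> {1..n}" using i by auto
    ultimately show ?thesis by (simp add: bits_def)
  next
    case False
    then have i2: "i \<in> {2..n - 1}" and j: "i - 1 \<in> {1..n - 1}" using i by auto
    have ce: "card (S (j, 1)) = of_bool (S (j, 1) \<noteq> {})" "card (S (j, 2)) = of_bool (S (j, 2) \<noteq> {})"
      if "j \<in> {1..n - 1}" for j using E[OF that] by auto
    have "bits n Q S i = (if delta Q (i - 1) = 0 then S (i - 1, 2) = {} else S (i - 1, 1) \<noteq> {})"
      using i False by (auto simp: bits_def)
    moreover have "\<forall>j\<in>{2..n - 1}.
        ((delta Q (j - 1), delta Q j) = (0, 0) \<longrightarrow> card (S (j - 1, 2)) \<noteq> card (S (j, 1))) \<and>
        ((delta Q (j - 1), delta Q j) = (1, 1) \<longrightarrow> card (S (j - 1, 1)) \<noteq> card (S (j, 2))) \<and>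
        ((delta Q (j - 1), delta Q j) = (0, 1) \<longrightarrow> card (S (j - 1, 2)) = card (S (j, 2))) \<and>
        ((delta Q (j - 1), delta Q j) = (1, 0) \<longrightarrow> card (S (j - 1, 1)) = card (S (j, 1)))"
      using S unfolding is_GCC_def by (elim conjE)
    note bspec[OF this i2, unfolded ce[OF i] ce[OF j] of_bool_eq_iff]
    ultimately show ?thesis
      using delta_cases[of Q i] delta_cases[of Q "i - 1"] by (elim disjE) simp_all
  qed
  show "bits n Q S (i + delta Q i) \<longleftrightarrow> S (i, 1) \<noteq> {}" "bits n Q S (i + 1 - delta Q i) \<longleftrightarrow> S (i, 2) = {}"
    using same succ delta_cases[of Q i] by auto
qed

lemma collection_bits:
  assumes S: "is_GCC n Q S"
  shows "collection n Q (bits n Q S) = S"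
proof (rule PiE_ext[where k = "{1..n - 1} \<times> {1, 2}" and s = "\<lambda>_. UNIV"])
  show "collection n Q (bits n Q S) \<in> ({1..n - 1} \<times> {1, 2}) \<rightarrow>\<^sub>E UNIV"
    by (auto simp: collection_def)
  show "S \<in> ({1..n - 1} \<times> {1, 2}) \<rightarrow>\<^sub>E UNIV"
    using S unfolding is_GCC_def edge_collections_def by (auto simp: PiE_def)
  fix x :: "nat \<times> nat" assume "x \<in> {1..n - 1} \<times> {1, 2}"
  then obtain i where i: "i \<in> {1..n - 1}" "x = (i, 1) \<or> x = (i, 2)" by auto
  show "collection n Q (bits n Q S) x = S x"
    using i(2) bits_apply[OF S i(1)] collection_apply[OF i(1)] by auto
qed

lemma bits_admissible:
  assumes S: "is_GCC n Q S"
  shows "admissible n Q (bits n Q S)"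
  unfolding admissible_def
proof (intro ballI impI)
  fix i assume i: "i \<in> {1..n - 1}" "bits n Q S (i + delta Q i)"
  have "(card (S (i, 1)), card (S (i, 2))) \<noteq> (1, 1)" using S i(1) by (simp add: is_GCC_def)
  then show "bits n Q S (i + 1 - delta Q i)"
    using i(2) bits_apply[OF S i(1)] by auto
qed

lemma bits_collection:
  assumes s: "s \<in> PiE {1..n} (\<lambda>_. UNIV)" and n: "n > 1"
  shows "bits n Q (collection n Q s) = s"
proof (rule PiE_ext[where k = "{1..n}" and s = "\<lambda>_. UNIV"])
  show "bits n Q (collection n Q s) \<in> {1..n} \<rightarrow>\<^sub>E UNIV" by (simp add: bits_def)
  fix j assume j: "j \<in> {1..n}"
  show "bits n Q (collection n Q s) j = s j"
  proof (cases "j = 1")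
    case True
    then show ?thesis using n delta_cases[of Q 1] collection_apply[of 1 n Q s] by (auto simp: bits_def)
  next
    case False
    then have "j - 1 \<in> {1..n - 1}" "j - 1 + 1 = j" using j by auto
    then show ?thesis
      using j False delta_cases[of Q "j - 1"] collection_apply[of "j - 1" n Q s] by (auto simp: bits_def)
  qed
qed (rule s)

text \<open>A transfer matrix from the bit at \<open>i\<close> to the bit at \<open>i + 1\<close>.
  Its zero entry is the inadmissible pair of bits, so sums may run over all bit sequences.\<close>

definition weight :: "nat quiver \<Rightarrow> nat \<Rightarrow> bool \<Rightarrow> bool \<Rightarrow> vertex ratfun" where
  "weight Q i b c =
     (if b = c then (if b = (delta Q i = 0) then var (V (i + 1)) else var (V i))
      else if c = (delta Q i = 0) then var (VV i (i + 1)) else 0)"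

lemma y_factor_weight:
  assumes s: "admissible n Q s" and i: "i \<in> {1..n - 1}"
  shows "y_factor n Q (collection n Q s) i = weight Q i (s i) (s (Suc i))"
proof -
  have "i \<noteq> 0" "i \<noteq> n" "s (i + delta Q i) \<longrightarrow> s (i + 1 - delta Q i)"
    using s i by (auto simp: admissible_def)
  then show ?thesis
    using delta_cases[of Q i] unfolding y_factor_def weight_def card_collection[OF i]
    by (cases "s i"; cases "s (Suc i)") auto
qed

lemma weight_not_admissible:
  assumes "\<not> admissible n Q s"
  shows "(\<Prod>i=1..n - 1. weight Q i (s i) (s (Suc i))) = 0"
proof -
  obtain i where i: "i \<in> {1..n - 1}" "s (i + delta Q i)" "\<not> s (i + 1 - delta Q i)"
    using assms by (auto simp: admissible_def)
  then have "weight Q i (s i) (s (Suc i)) = 0"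
    using delta_cases[of Q i] by (auto simp: weight_def)
  then show ?thesis using i(1) by (intro prod_zero) auto
qed

definition first_var :: "bool \<Rightarrow> vertex ratfun" where
  "first_var b = (if b then var (VV 1 0) else var (VV 1 1))"

definition last_var :: "nat \<Rightarrow> bool \<Rightarrow> vertex ratfun" where
  "last_var n b = (if b then var (VV n 0) else var (VV n 1))"

lemma y_factor_ends:
  assumes n: "n > 1"
  shows "y_factor n Q (collection n Q s) 0 = first_var (s 1)"
    and "y_factor n Q (collection n Q s) n = last_var n (s n)"
proof -
  have 1: "1 \<in> {1..n - 1}" "n - 1 \<in> {1..n - 1}" "n - 1 + 1 = n" using n by auto
  show "y_factor n Q (collection n Q s) 0 = first_var (s 1)"
    using delta_cases[of Q 1] card_collection[OF 1(1), of Q s]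
    by (auto simp: y_factor_def first_var_def numeral_2_eq_2)
  show "y_factor n Q (collection n Q s) n = last_var n (s n)"
    using n delta_cases[of Q "n - 1"] card_collection[OF 1(2), of Q s] 1(3)
    by (auto simp: y_factor_def last_var_def numeral_2_eq_2)
qed

lemma sum_GCC_transfer:
  assumes n: "n > 1"
  shows "(\<Sum>S | is_GCC n Q S. \<Prod>i = 0..n. y_factor n Q S i) =
    transfer first_var (weight Q) (n - 1) False * last_var n False +
    transfer first_var (weight Q) (n - 1) True * last_var n True"
proof -
  let ?P = "PiE {1..n} (\<lambda>_. UNIV) :: (nat \<Rightarrow> bool) set"
  let ?t = "\<lambda>s. first_var (s 1) * (\<Prod>i=1..n - 1. weight Q i (s i) (s (Suc i))) * last_var n (s n)"
  obtain k where k: "n = Suc k" using n by (cases n) auto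
  have y: "(\<Prod>i = 0..n. y_factor n Q S i) = y_factor n Q S 0 * (\<Prod>i=1..n - 1. y_factor n Q S i) * y_factor n Q S n" for S
    using k by (simp add: prod.atLeast_Suc_atMost)
  have "(\<Sum>S | is_GCC n Q S. \<Prod>i = 0..n. y_factor n Q S i) = (\<Sum>s | s \<in> ?P \<and> admissible n Q s. ?t s)"
  proof (rule sum.reindex_bij_witness[where i = "collection n Q" and j = "bits n Q"])
    fix S assume "S \<in> {S. is_GCC n Q S}"
    then have S: "is_GCC n Q S" by simp
    show "collection n Q (bits n Q S) = S" by (rule collection_bits[OF S])
    have bP: "bits n Q S \<in> ?P" by (auto simp: bits_def)
    then show "bits n Q S \<in> {s. s \<in> ?P \<and> admissible n Q s}" using bits_admissible[OF S] by simp
    have "(\<Prod>i=1..n - 1. y_factor n Q (collection n Q (bits n Q S)) i) =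
        (\<Prod>i=1..n - 1. weight Q i (bits n Q S i) (bits n Q S (Suc i)))"
      by (intro prod.cong refl y_factor_weight bits_admissible S)
    then show "?t (bits n Q S) = (\<Prod>i = 0..n. y_factor n Q S i)"
      unfolding y using y_factor_ends[OF n, of Q "bits n Q S"] unfolding collection_bits[OF S] by simp
  next
    fix s assume s: "s \<in> {s. s \<in> ?P \<and> admissible n Q s}"
    then show "bits n Q (collection n Q s) = s" using bits_collection n by blast
    show "collection n Q s \<in> {S. is_GCC n Q S}" using s collection_is_GCC by simp
  qed
  also have "\<dots> = (\<Sum>s\<in>?P. ?t s)"
    using weight_not_admissible[of n Q] by (intro sum.mono_neutral_left) (auto intro!: finite_PiE)
  also have "\<dots> = transfer first_var (weight Q) (n - 1) False * last_var n False +
    transfer first_var (weight Q) (n - 1) True * last_var n True"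
    using sum_paths_transfer[where k = k and w = first_var and M = "weight Q" and f = "last_var n"] unfolding k by simp
  finally show ?thesis .
qed

section \<open>Completely extended linear quivers as snakes\<close>

text \<open>With \<open>side_vertex\<close>, fits the end cycles in as steps 0 and \<open>n\<close>.
  Being leftward, these steps have the arrow cycles \<open>V 1\<close>, \<open>VV 1 0\<close>,
  \<open>VV 1 1\<close> and \<open>VV n 1\<close>, \<open>V n\<close>, \<open>VV n 0\<close>, which
  fixes the assignment at both ends.\<close>

definition diag_vertex :: "nat \<Rightarrow> nat \<Rightarrow> vertex" where
  "diag_vertex n i = (if i = 0 then VV 1 0 else if i = Suc n then VV n 1 else V i)"

definition side_vertex :: "nat \<Rightarrow> nat \<Rightarrow> vertex" where
  "side_vertex n i = (if i = 0 then VV 1 1 else if i = n then VV n 0 else VV i (i + 1))"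

definition leftward :: "nat quiver \<Rightarrow> nat \<Rightarrow> bool" where
  "leftward Q i \<longleftrightarrow> delta Q i = 1"

lemma linear_quiver_step:
  assumes "linear_quiver n Q" "i \<in> {1..<n}"
  shows "Q i (i + 1) = 1 \<longleftrightarrow> \<not> leftward Q i" "Q (i + 1) i = 1 \<longleftrightarrow> leftward Q i"
proof -
  have "Q i (i + 1) + Q (i + 1) i = 1" using assms by (simp add: linear_quiver_def)
  then show "Q i (i + 1) = 1 \<longleftrightarrow> \<not> leftward Q i" "Q (i + 1) i = 1 \<longleftrightarrow> leftward Q i"
    by (auto simp: leftward_def delta_def)
qed

text \<open>\<open>delta\<close> falls back to the value 1 here, as \<open>Q\<close> has no arrow
  between 0 and 1 or between \<open>n\<close> and \<open>n + 1\<close>.\<close>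

lemma leftward_ends:
  assumes "linear_quiver n Q"
  shows "leftward Q 0" "leftward Q n"
proof -
  have "Q 0 1 = 0" "Q n (n + 1) = 0" using assms unfolding linear_quiver_def by fastforce+
  then show "leftward Q 0" "leftward Q n" by (simp_all add: leftward_def delta_def)
qed

lemma snake_triangulation_ext:
  assumes "n > 1" "linear_quiver n Q"
  shows "snake_triangulation n (leftward Q) (diag_vertex n) (side_vertex n)"
proof
  show "2 \<le> n" using assms by simp
  show "leftward Q 0" "leftward Q n" using leftward_ends[OF assms(2)] by auto
  show "inj_on (diag_vertex n) {..Suc n}" using assms(1) by (auto simp: inj_on_def diag_vertex_def split: if_splits)
  show "inj_on (side_vertex n) {..n}" using assms(1) by (auto simp: inj_on_def side_vertex_def split: if_splits)
  show "diag_vertex n ` {..Suc n} \<inter> side_vertex n ` {..n} = {}"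
    using assms(1) by (auto simp: diag_vertex_def side_vertex_def split: if_splits)
  show "\<exists>x. x \<notin> diag_vertex n ` {..Suc n} \<union> side_vertex n ` {..n}"
    \<comment> \<open>Vertices of \<open>Q\<close> are numbered from 1, so \<open>V 0\<close> is a
      spare variable.\<close>
    by (rule exI[of _ "V 0"]) (auto simp: diag_vertex_def side_vertex_def split: if_splits)
qed

lemma diag_inner_image: "diag_vertex n ` {1..n} = old_verts n"
  unfolding old_verts_def by (rule image_cong) (auto simp: diag_vertex_def)

lemma vertex_images:
  assumes "n > 1"
  shows "diag_vertex n ` {..Suc n} \<union> side_vertex n ` {..n} = ext_verts n"
proof -
  have "{..Suc n} = {0, Suc n} \<union> {1..n}" "{..n} = {0, n} \<union> {1..<n}" by auto
  moreover have "side_vertex n ` {1..<n} = (\<lambda>i. VV i (i + 1)) ` {1..<n}"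
    by (rule image_cong) (auto simp: side_vertex_def)
  ultimately have "diag_vertex n ` {..Suc n} = {VV 1 0, VV n 1} \<union> old_verts n"
    "side_vertex n ` {..n} = {VV 1 1, VV n 0} \<union> (\<lambda>i. VV i (i + 1)) ` {1..<n}"
    using assms diag_inner_image[of n] by (simp_all only: image_Un) (auto simp: diag_vertex_def side_vertex_def)
  then show ?thesis by (auto simp: ext_verts_def)
qed

lemma ext_arrow_iff:
  assumes n: "n > 1" and Q: "linear_quiver n Q"
  shows "ext_arrow n Q v w \<longleftrightarrow> snake.snake_arrow n (leftward Q) (diag_vertex n) (side_vertex n) v w"
    (is "_ \<longleftrightarrow> ?snake")
proof -
  interpret snake_triangulation n "leftward Q" "diag_vertex n" "side_vertex n"
    by (rule snake_triangulation_ext[OF n Q])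
  note ends = leftward_ends[OF Q]
  have inner: "i \<in> {1..<n} \<Longrightarrow> diag_vertex n i = V i \<and> diag_vertex n (Suc i) = V (i + 1) \<and> side_vertex n i = VV i (i + 1)" for i
    by (auto simp: diag_vertex_def side_vertex_def)
  have outer: "diag_vertex n 0 = VV 1 0" "diag_vertex n (Suc 0) = V 1" "side_vertex n 0 = VV 1 1"
    "diag_vertex n n = V n" "diag_vertex n (Suc n) = VV n 1" "side_vertex n n = VV n 0"
    using n by (auto simp: diag_vertex_def side_vertex_def)
  show ?thesis
  proof
    have I: "snake_arrow v w" if "i \<in> {1..<n}" "(v, w) \<in> (if leftward Q i
        then {(V (i + 1), V i), (V i, VV i (i + 1)), (VV i (i + 1), V (i + 1))}
        else {(V i, V (i + 1)), (V (i + 1), VV i (i + 1)), (VV i (i + 1), V i)})" for i v w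
      using that inner[OF that(1)] unfolding snake_arrow_def by (intro exI[of _ i]) auto
    have O: "snake_arrow (V k) (VV k 0)" "snake_arrow (VV k 0) (VV k 1)" "snake_arrow (VV k 1) (V k)" if "k \<in> {1, n}" for k
    proof -
      have "snake_arrow (V 1) (VV 1 0)" "snake_arrow (VV 1 0) (VV 1 1)" "snake_arrow (VV 1 1) (V 1)"
        using ends outer unfolding snake_arrow_def by (auto intro!: exI[of _ 0])
      moreover have "snake_arrow (V n) (VV n 0)" "snake_arrow (VV n 0) (VV n 1)" "snake_arrow (VV n 1) (V n)"
        using ends outer unfolding snake_arrow_def by (auto intro!: exI[of _ n])
      ultimately show "snake_arrow (V k) (VV k 0)" "snake_arrow (VV k 0) (VV k 1)" "snake_arrow (VV k 1) (V k)"
        using that by auto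
    qed
    assume "ext_arrow n Q v w"
    then show ?snake
    proof cases
      case (1 i j)
      then have "i \<in> {1..n} \<and> j \<in> {1..n} \<and> (j = i + 1 \<or> i = j + 1)"
        using Q unfolding linear_quiver_def by (metis one_neq_zero)
      then show ?thesis
        using 1 I[of i v w] I[of j v w] linear_quiver_step[OF Q, of i] linear_quiver_step[OF Q, of j] by auto
    next
      case (2 i) then show ?thesis using I[of i v w] linear_quiver_step[OF Q, of i] by auto
    next
      case (3 i) then show ?thesis using I[of i v w] linear_quiver_step[OF Q, of i] by auto
    next
      case (4 i) then show ?thesis using I[of i v w] linear_quiver_step[OF Q, of i] by auto
    next
      case (5 i) then show ?thesis using I[of i v w] linear_quiver_step[OF Q, of i] by auto
    qed (use O in auto)
  next
    assume ?snake
    then obtain i where i: "i \<le> n" "(v, w) \<in> (if leftward Q i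
        then {(diag_vertex n (Suc i), diag_vertex n i), (diag_vertex n i, side_vertex n i), (side_vertex n i, diag_vertex n (Suc i))}
        else {(diag_vertex n i, diag_vertex n (Suc i)), (diag_vertex n (Suc i), side_vertex n i), (side_vertex n i, diag_vertex n i)})"
      unfolding snake_arrow_def by blast
    consider "i = 0" | "i = n" | "i \<in> {1..<n}" using i(1) by fastforce
    then show "ext_arrow n Q v w"
    proof cases
      case 1
      then show ?thesis using i(2) outer ends ext_arrow.intros(6-8)[of "Suc 0" n Q] by auto
    next
      case 2
      then show ?thesis using i(2) outer ends ext_arrow.intros(6-8)[of n n Q] by auto
    next
      case 3
      then show ?thesis
        using i(2) inner[OF 3] linear_quiver_step[OF Q 3] ext_arrow.intros(1)[of Q i "i + 1" n]
          ext_arrow.intros(1)[of Q "i + 1" i n] ext_arrow.intros(2-5)[OF 3, of Q]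
        by (cases "leftward Q i") auto
    qed
  qed
qed

text \<open>The bit False belongs to the chord ending at \<open>zz\<close>, True to the one ending
  at \<open>oo\<close>; the zero entry of \<open>weight\<close> matches the component that is only
  rescaled. The bound \<open>k < n\<close> keeps away from the exceptional labels of step
  \<open>n\<close>.\<close>

lemma chain_transfer:
  assumes n: "n > 1" and Q: "linear_quiver n Q" and k: "k < n"
  shows "snake_triangulation.chain (leftward Q) (\<lambda>i. var (diag_vertex n i)) (\<lambda>i. var (side_vertex n i)) k =
    (transfer first_var (weight Q) k False, transfer first_var (weight Q) k True)"
proof -
  interpret snake_triangulation n "leftward Q" "diag_vertex n" "side_vertex n"
    by (rule snake_triangulation_ext[OF n Q])
  from k show ?thesis
  proof (induction k)
    case 0
    then show ?case by (simp add: first_var_def diag_vertex_def side_vertex_def)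
  next
    case (Suc k)
    have "diag_vertex n (Suc k) = V (Suc k)" "diag_vertex n (Suc (Suc k)) = V (Suc (Suc k))"
      "side_vertex n (Suc k) = VV (Suc k) (Suc (Suc k))"
      using Suc.prems by (auto simp: diag_vertex_def side_vertex_def)
    then show ?case
      using Suc delta_cases[of Q "Suc k"]
      by (auto simp: weight_def[of Q "Suc k"] leftward_def[of Q "Suc k"])
  qed
qed

theorem theorem4p6:
  fixes n :: nat and Q :: "nat quiver"
  assumes "n > 1"
    and "linear_quiver n Q"
  shows "{z \<in> cluster_variables (ext_verts n) (ext_quiver n Q).
            has_dvector (ext_verts n) z (a_vec n)} =
         {(\<Prod>i = 1..n. inverse (var (V i))) *
            (\<Sum>S | is_GCC n Q S. \<Prod>i = 0..n. y_factor n Q S i)}"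
proof -
  interpret snake_triangulation n "leftward Q" "diag_vertex n" "side_vertex n"
    by (rule snake_triangulation_ext[OF assms])
  have labels: "labels = ext_verts n"
    using vertex_images[OF assms(1)] by (simp add: labels_def)
  have dvec: "inner_vec = a_vec n"
    by (rule ext) (simp only: inner_vec_def a_vec_def diag_inner_image)
  obtain k where k: "n = Suc k" using assms(1) by (cases n) auto
  have "fst (chain (\<lambda>i. var (diag_vertex n i)) (\<lambda>i. var (side_vertex n i)) (Suc k)) =
      transfer first_var (weight Q) k True * var (side_vertex n (Suc k)) +
      transfer first_var (weight Q) k False * var (diag_vertex n (Suc (Suc k)))"
    using chain_transfer[OF assms, of k] leftward_ends(2)[OF assms(2)] by (simp add: k)
  \<comment> \<open>The last step of the chain corresponds to the end vector instead of a transfer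
    matrix: its labels \<open>VV n 0\<close> and \<open>VV n 1\<close> are the two values of
    \<open>last_var n\<close>.\<close>
  also have "\<dots> = (\<Sum>S | is_GCC n Q S. \<Prod>i = 0..n. y_factor n Q S i)"
    unfolding sum_GCC_transfer[OF assms(1)] by (simp add: k last_var_def diag_vertex_def side_vertex_def add.commute)
  finally have chain: "fst (chain (\<lambda>i. var (diag_vertex n i)) (\<lambda>i. var (side_vertex n i)) n) =
      (\<Sum>S | is_GCC n Q S. \<Prod>i = 0..n. y_factor n Q S i)"
    by (simp only: k)
  have "(\<Prod>i = 1..n. var (diag_vertex n i)) = (\<Prod>i = 1..n. var (V i))"
    by (rule prod.cong) (auto simp: diag_vertex_def)
  then have den: "inverse (\<Prod>i = 1..n. var (diag_vertex n i)) = (\<Prod>i = 1..n. inverse (var (V i)))"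
    using prod_inversef[of "\<lambda>i. var (V i)" "{1..n}"] by (simp add: o_def)
  have "ext_quiver n Q v w = of_bool (snake_arrow v w)" for v w
    by (simp add: ext_quiver_def ext_arrow_iff[OF assms])
  then have "{z \<in> cluster_variables labels (ext_quiver n Q). has_dvector labels z inner_vec} =
    {fst (chain (\<lambda>i. var (diag_vertex n i)) (\<lambda>i. var (side_vertex n i)) n) / (\<Prod>i=1..n. var (diag_vertex n i))}"
    by (intro snake_cluster_variable)
  then show ?thesis
    unfolding labels dvec chain divide_inverse den by (simp only: mult.commute)
qed

end
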